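(* In the Poisson arrival model of edge-weighted online stochastic matching, the Multistage Suggested Matching algorithm (for a suitable choice of boundary times $0\le t_0\le t_1\le 1$, e.g. $t_0=0.05$, $t_1=0.75$) is $0.645$-competitive: on every instance, its expected total matched weight is at least $0.645$ times the expected weight of the offline optimal matching.
   Context: Edge-weighted online stochastic matching, Poisson arrival model: there is a finite set $I$ of online vertex types with arrival rates $\lambda_i>0$, a finite set $J$ of offline vertices, and edges $E\subseteq I\times J$ with nonnegative weights $w_{ij}$, all known in advance. Online vertices of each type $i$ arrive independently according to a Poisson process of rate $\lambda_i$ on the time horizon $[0,1]$. On arrival, an online vertex must be immediately and irrevocably matched to an unmatched adjacent offline vertex or discarded. The offline optimum is the maximum-weight matching of the realized graph; the competitive ratio is the infimum over instances of (expected algorithm weight)/(expected offline optimum). The algorithm: compute an optimal solution $x$ of the Jaillet–Lu LP (maximize $\sum w_{ij}x_{ij}$ subject to $\sum_j x_{ij}\le\lambda_i$, $\sum_i x_{ij}\le 1$, $\sum_i(2x_{ij}-\lambda_i)^+\le 1-\ln 2$ for each $j$, $x\ge0$). Transform it into an equivalent instance and fractional matching of equal weight (by adding dummy zero-weight offline vertices and online types, and splitting each online type $i$ into types $i_u$, an arriving vertex of type $i$ being relabeled $i_u$ with probability $\lambda_{i_u}/\lambda_i$) satisfying $\sum_j x_{ij}=\lambda_i$, $\sum_i x_{ij}=1$, $x_{ij}\in\{0,\lambda_i/2,\lambda_i\}$, and $y_j:=\sum_{i\in I_1}x_{ij}\le 1-\ln 2$. Here edge $(i,j)$ is first-class if $x_{ij}=\lambda_i$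 and second-class if $x_{ij}=\lambda_i/2$; $I_1$ ($I_2$) are the types having a first-class (second-class) edge, so types in $I_1$ have one neighbor and types in $I_2$ have two neighbors (neighbors meaning $x_{ij}>0$). Then run: a vertex of type $i\in I_1$ is matched to its unique neighbor if it is unmatched. A vertex of type $i\in I_2$ arriving at time $t\le t_0$ is discarded; arriving at $t_0<t\le t_1$, it is matched to each unmatched neighbor with probability $\tfrac12$; arriving at $t_1<t\le1$, if exactly one of its neighbors was unmatched at time $t_1$ it is matched to that neighbor if still unmatched, otherwise it is matched to each unmatched neighbor with probability $\tfrac12$. *)

theory Defs
  imports "HOL-Probability.Probability"
begin

record ('i, 'j) osm =
  on_types :: "'i set"
  offline :: "'j set"
  edges :: "('i \<times> 'j) set"
  rate :: "'i \<Rightarrow> real"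
  weight :: "'i \<Rightarrow> 'j \<Rightarrow> real"

definition valid_osm :: "('i, 'j) osm \<Rightarrow> bool" where
  "valid_osm G \<longleftrightarrow>
     finite (on_types G) \<and> finite (offline G) \<and>
     edges G \<subseteq> on_types G \<times> offline G \<and>
     (\<forall>i\<in>on_types G. rate G i > 0) \<and>
     (\<forall>(i, j)\<in>edges G. weight G i j \<ge> 0)"

text \<open>A realization of the arrivals is given by the set of arrival times of every type; the online
  vertex of type \<open>i\<close> that arrives at time \<open>t\<close> is the pair \<open>(i, t)\<close>.\<close>

definition online_vertices :: "('i, 'j) osm \<Rightarrow> ('i \<Rightarrow> real set) \<Rightarrow> ('i \<times> real) set" where
  "online_vertices G T = {(i, t). i \<in> on_types G \<and> t \<in> T i}"

definition is_matching ::
    "('i, 'j) osm \<Rightarrow> ('i \<Rightarrow> real set) \<Rightarrow> (('i \<times> real) \<times> 'j) set \<Rightarrow> bool" where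
  "is_matching G T m \<longleftrightarrow>
     m \<subseteq> {((i, t), j). (i, t) \<in> online_vertices G T \<and> (i, j) \<in> edges G} \<and>
     inj_on fst m \<and> inj_on snd m"

definition offline_opt :: "('i, 'j) osm \<Rightarrow> ('i \<Rightarrow> real set) \<Rightarrow> real" where
  "offline_opt G T =
     Max ((\<lambda>m. \<Sum>((i, t), j)\<in>m. weight G i j) ` {m. is_matching G T m})"

definition arrival_count :: "('w \<Rightarrow> real set) \<Rightarrow> real \<Rightarrow> real \<Rightarrow> 'w \<Rightarrow> nat" where
  "arrival_count S s t \<omega> = card (S \<omega> \<inter> {s<..t})"

text \<open>A Poisson process of rate \<open>l\<close> on the horizon \<open>[0, 1]\<close>, given by its random set of arrival times:
  independent increments, and the number of arrivals in \<open>(s, t]\<close> has the Poisson distribution with mean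
  \<open>l (t - s)\<close>. The case \<open>s = t\<close> is left out because \<open>poisson_pmf\<close> is specified for positive rates only.\<close>

definition poisson_process :: "'w measure \<Rightarrow> real \<Rightarrow> ('w \<Rightarrow> real set) \<Rightarrow> bool" where
  "poisson_process M l S \<longleftrightarrow>
     (\<forall>\<omega>\<in>space M. finite (S \<omega>) \<and> S \<omega> \<subseteq> {0<..1}) \<and>
     (\<forall>s t. 0 \<le> s \<and> s < t \<and> t \<le> 1 \<longrightarrow>
        arrival_count S s t \<in> measurable M (count_space UNIV) \<and>
        distr M (count_space UNIV) (arrival_count S s t) = measure_pmf (poisson_pmf (l * (t - s)))) \<and>
     (\<forall>n. \<forall>\<tau> :: nat \<Rightarrow> real. mono \<tau> \<and> 0 \<le> \<tau> 0 \<and> \<tau> n \<le> 1 \<longrightarrow>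
        prob_space.indep_vars M (\<lambda>_. count_space UNIV)
          (\<lambda>k. arrival_count S (\<tau> k) (\<tau> (Suc k))) {..<n})"

definition process_algebra :: "'w measure \<Rightarrow> ('w \<Rightarrow> real set) \<Rightarrow> 'w set set" where
  "process_algebra M S = sigma_sets (space M)
     {{\<omega> \<in> space M. arrival_count S s t \<omega> = n} | s t n. 0 \<le> s \<and> s \<le> t \<and> t \<le> 1}"

definition poisson_arrivals ::
    "'w measure \<Rightarrow> ('i, 'j) osm \<Rightarrow> ('i \<Rightarrow> 'w \<Rightarrow> real set) \<Rightarrow> bool" where
  "poisson_arrivals M G A \<longleftrightarrow>
     prob_space M \<and>
     (\<forall>i\<in>on_types G. poisson_process M (rate G i) (A i)) \<and>
     prob_space.indep_sets M (\<lambda>i. process_algebra M (A i)) (on_types G)"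

definition frac_weight :: "('i, 'j) osm \<Rightarrow> ('i \<Rightarrow> 'j \<Rightarrow> real) \<Rightarrow> real" where
  "frac_weight G x = (\<Sum>(i, j)\<in>edges G. weight G i j * x i j)"

definition jl_feasible :: "('i, 'j) osm \<Rightarrow> ('i \<Rightarrow> 'j \<Rightarrow> real) \<Rightarrow> bool" where
  "jl_feasible G x \<longleftrightarrow>
     (\<forall>i j. x i j \<ge> 0) \<and>
     (\<forall>i j. (i, j) \<notin> edges G \<longrightarrow> x i j = 0) \<and>
     (\<forall>i\<in>on_types G. (\<Sum>j\<in>offline G. x i j) \<le> rate G i) \<and>
     (\<forall>j\<in>offline G. (\<Sum>i\<in>on_types G. x i j) \<le> 1) \<and>
     (\<forall>j\<in>offline G. (\<Sum>i\<in>on_types G. max 0 (2 * x i j - rate G i)) \<le> 1 - ln 2)"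

definition jl_optimal :: "('i, 'j) osm \<Rightarrow> ('i \<Rightarrow> 'j \<Rightarrow> real) \<Rightarrow> bool" where
  "jl_optimal G x \<longleftrightarrow>
     jl_feasible G x \<and> (\<forall>x'. jl_feasible G x' \<longrightarrow> frac_weight G x' \<le> frac_weight G x)"

text \<open>Preprocessing has two steps: dummy online types and dummy offline vertices are added, where every
  edge at a dummy has weight zero; then every online type is split.\<close>

datatype 'a ext = Orig 'a | Dummy nat

definition dummy_extension :: "('i, 'j) osm \<Rightarrow> ('i ext, 'j ext) osm \<Rightarrow> bool" where
  "dummy_extension G G' \<longleftrightarrow>
     valid_osm G' \<and>
     (\<forall>i. Orig i \<in> on_types G' \<longleftrightarrow> i \<in> on_types G) \<and>
     (\<forall>j. Orig j \<in> offline G' \<longleftrightarrow> j \<in> offline G) \<and>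
     (\<forall>i j. (Orig i, Orig j) \<in> edges G' \<longleftrightarrow> (i, j) \<in> edges G) \<and>
     (\<forall>i\<in>on_types G. rate G' (Orig i) = rate G i) \<and>
     (\<forall>(i, j)\<in>edges G. weight G' (Orig i) (Orig j) = weight G i j) \<and>
     (\<forall>(k, l)\<in>edges G'. k \<in> range Dummy \<or> l \<in> range Dummy \<longrightarrow> weight G' k l = 0)"

text \<open>The type \<open>(i, u)\<close> is the \<open>u\<close>-th part of the type \<open>i\<close>.\<close>

definition split_instance :: "('i, 'j) osm \<Rightarrow> ('i \<times> nat, 'j) osm \<Rightarrow> bool" where
  "split_instance G H \<longleftrightarrow>
     valid_osm H \<and>
     fst ` on_types H = on_types G \<and>
     offline H = offline G \<and>
     (\<forall>i\<in>on_types G. (\<Sum>r\<in>{r \<in> on_types H. fst r = i}. rate H r) = rate G i) \<and>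
     (\<forall>r j. (r, j) \<in> edges H \<longleftrightarrow> r \<in> on_types H \<and> (fst r, j) \<in> edges G) \<and>
     (\<forall>(r, j)\<in>edges H. weight H r j = weight G (fst r) j)"

definition first_class_types :: "('r, 'j) osm \<Rightarrow> ('r \<Rightarrow> 'j \<Rightarrow> real) \<Rightarrow> 'r set" where
  "first_class_types H x = {r \<in> on_types H. \<exists>j\<in>offline H. x r j = rate H r}"

definition two_class_matching :: "('r, 'j) osm \<Rightarrow> ('r \<Rightarrow> 'j \<Rightarrow> real) \<Rightarrow> bool" where
  "two_class_matching H x \<longleftrightarrow>
     (\<forall>r j. (r, j) \<notin> edges H \<longrightarrow> x r j = 0) \<and>
     (\<forall>r\<in>on_types H. (\<Sum>j\<in>offline H. x r j) = rate H r) \<and>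
     (\<forall>j\<in>offline H. (\<Sum>r\<in>on_types H. x r j) = 1) \<and>
     (\<forall>r\<in>on_types H. \<forall>j\<in>offline H. x r j \<in> {0, rate H r / 2, rate H r}) \<and>
     (\<forall>j\<in>offline H. (\<Sum>r\<in>first_class_types H x. x r j) \<le> 1 - ln 2)"

definition preprocessed ::
    "('i, 'j) osm \<Rightarrow> ('i \<Rightarrow> 'j \<Rightarrow> real) \<Rightarrow>
     ('i ext, 'j ext) osm \<Rightarrow> ('i ext \<times> nat, 'j ext) osm \<Rightarrow>
     ('i ext \<times> nat \<Rightarrow> 'j ext \<Rightarrow> real) \<Rightarrow> bool" where
  "preprocessed G x G' H z \<longleftrightarrow>
     dummy_extension G G' \<and> split_instance G' H \<and> two_class_matching H z \<and>
     frac_weight H z = frac_weight G x"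

text \<open>Internal random choices of the algorithm are modelled by probability mass functions. Its state
  is the set of pairs of a (relabelled) type and the offline vertex matched to a vertex of that type;
  an offline vertex occurs in at most one pair.\<close>

text \<open>Arrivals in order of time. Simultaneous arrivals of different types form a null event; they are
  ordered by a fixed enumeration of the types, so that the result depends measurably on the arrival
  times.\<close>

definition type_list :: "('i, 'j) osm \<Rightarrow> 'i list" where
  "type_list G = (SOME ks. distinct ks \<and> set ks = on_types G)"

definition arrivals :: "('i, 'j) osm \<Rightarrow> ('i \<Rightarrow> real set) \<Rightarrow> ('i \<times> real) list" where
  "arrivals G T =
     sort_key snd (concat (map (\<lambda>i. map (Pair i) (sorted_list_of_set (T i))) (type_list G)))"

definition relabel :: "('i, 'j) osm \<Rightarrow> ('i \<times> nat, 'j) osm \<Rightarrow> 'i \<Rightarrow> ('i \<times> nat) pmf" where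
  "relabel G H i =
     embed_pmf (\<lambda>r. if r \<in> on_types H \<and> fst r = i then rate H r / rate G i else 0)"

definition neighbors :: "('r, 'j) osm \<Rightarrow> ('r \<Rightarrow> 'j \<Rightarrow> real) \<Rightarrow> 'r \<Rightarrow> 'j set" where
  "neighbors H x r = {j \<in> offline H. x r j > 0}"

definition try_match :: "'r \<Rightarrow> 'j \<Rightarrow> ('r \<times> 'j) set \<Rightarrow> ('r \<times> 'j) set" where
  "try_match r j m = (if j \<in> snd ` m then m else insert (r, j) m)"

text \<open>A second-class type has exactly two neighbors, so proposing to a uniformly random neighbor
  matches every unmatched neighbor with probability one half.\<close>

definition suggest ::
    "('r, 'j) osm \<Rightarrow> ('r \<Rightarrow> 'j \<Rightarrow> real) \<Rightarrow> 'r \<Rightarrow> ('r \<times> 'j) set \<Rightarrow> ('r \<times> 'j) set pmf" where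
  "suggest H x r m = map_pmf (\<lambda>j. try_match r j m) (pmf_of_set (neighbors H x r))"

definition serve_early ::
    "real \<Rightarrow> ('r, 'j) osm \<Rightarrow> ('r \<Rightarrow> 'j \<Rightarrow> real) \<Rightarrow> real \<Rightarrow> 'r \<Rightarrow>
     ('r \<times> 'j) set \<Rightarrow> ('r \<times> 'j) set pmf" where
  "serve_early t0 H x t r m =
     (if r \<in> first_class_types H x then return_pmf (try_match r (the_elem (neighbors H x r)) m)
      else if t \<le> t0 then return_pmf m
      else suggest H x r m)"

text \<open>Here \<open>m1\<close> is the matching at time \<open>t1\<close>.\<close>

definition serve_late ::
    "('r \<times> 'j) set \<Rightarrow> ('r, 'j) osm \<Rightarrow> ('r \<Rightarrow> 'j \<Rightarrow> real) \<Rightarrow> 'r \<Rightarrow>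
     ('r \<times> 'j) set \<Rightarrow> ('r \<times> 'j) set pmf" where
  "serve_late m1 H x r m =
     (if r \<in> first_class_types H x then return_pmf (try_match r (the_elem (neighbors H x r)) m)
      else if card (neighbors H x r - snd ` m1) = 1
        then return_pmf (try_match r (the_elem (neighbors H x r - snd ` m1)) m)
      else suggest H x r m)"

primrec process :: "('a \<Rightarrow> 's \<Rightarrow> 's pmf) \<Rightarrow> 'a list \<Rightarrow> 's \<Rightarrow> 's pmf" where
  "process f [] s = return_pmf s"
| "process f (a # as) s = bind_pmf (f a s) (process f as)"

text \<open>The first instance argument is the one with dummies, and the arrivals are those of its types: the
  algorithm simulates the arrivals of the dummy types. The second one is the split instance, on which
  the fractional matching lives.\<close>

definition msm ::
    "real \<Rightarrow> real \<Rightarrow> ('i, 'j) osm \<Rightarrow> ('i \<times> nat, 'j) osm \<Rightarrow> ('i \<times> nat \<Rightarrow> 'j \<Rightarrow> real) \<Rightarrow>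
     ('i \<Rightarrow> real set) \<Rightarrow> (('i \<times> nat) \<times> 'j) set pmf" where
  "msm t0 t1 G H x T =
     (let as = arrivals G T in
      bind_pmf
        (process (\<lambda>(i, t) m. bind_pmf (relabel G H i) (\<lambda>r. serve_early t0 H x t r m))
           (filter (\<lambda>(i, t). t \<le> t1) as) {})
        (\<lambda>m1. process (\<lambda>(i, t) m. bind_pmf (relabel G H i) (\<lambda>r. serve_late m1 H x r m))
           (filter (\<lambda>(i, t). t > t1) as) m1))"

definition matched_weight :: "('r, 'j) osm \<Rightarrow> ('r \<times> 'j) set \<Rightarrow> real" where
  "matched_weight H m = (\<Sum>(r, j)\<in>m. weight H r j)"

definition msm_expected_weight ::
    "real \<Rightarrow> real \<Rightarrow> ('i, 'j) osm \<Rightarrow> ('i \<times> nat, 'j) osm \<Rightarrow> ('i \<times> nat \<Rightarrow> 'j \<Rightarrow> real) \<Rightarrow>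
     'w measure \<Rightarrow> ('i \<Rightarrow> 'w \<Rightarrow> real set) \<Rightarrow> real" where
  "msm_expected_weight t0 t1 G H x M A =
     (\<integral>\<omega>. measure_pmf.expectation (msm t0 t1 G H x (\<lambda>i. A i \<omega>)) (matched_weight H) \<partial>M)"

end

theory Submission
  imports Defs "HOL-Real_Asymp.Real_Asymp"
begin

text \<open>Upper bound: the frequencies with which the edges are used by an optimal matching are feasible for the
  linear program. For the third family of constraints let \<open>S\<close> be the set of types with \<open>2 x\<^sub>i\<^sub>j > \<lambda>\<^sub>i\<close>, of
  total rate \<open>L\<close>; as \<open>j\<close> is matched to \<open>S\<close> only if a type of \<open>S\<close> arrives, the left-hand side is at most
  \<open>2 (1 - exp (- L)) - L\<close>, whose maximum \<open>1 - ln 2\<close> is attained at \<open>L = ln 2\<close>.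

  Lower bound: every edge \<open>(r, j)\<close> is matched with probability at least \<open>0.645 x\<^sub>r\<^sub>j\<close>. For this one needs a
  function of time and state that is a subsolution of the backward equation of the jump process and is at
  most the indicator of the event at time \<open>1\<close>; its initial value then bounds the probability. Up to time
  \<open>0.75\<close> offline vertices receive independent proposals, so the indicators "all of \<open>S\<close> is unmatched"
  are eigenfunctions of the generator. Afterwards the proposal rate at \<open>j\<close> is \<open>1 + Z\<close>, where \<open>Z\<close> is the
  fractional weight of the second-class edges at \<open>j\<close> whose other end was matched by then; the reward is
  bounded below by a function affine in \<open>Z\<close>, hence a combination of such indicators with \<open>card S \<le> 2\<close>.

  The Poisson processes enter through discretization: in \<open>N\<close> equal cells the arrival counts are
  independent Poisson variables, a subsolution loses only \<open>o(1 / N)\<close> per cell, and for each fixed sample the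
  algorithm agrees with its discretized run once \<open>N\<close> is large. The pointwise limit also supplies the
  measurability of the performance of the algorithm.\<close>

section \<open>Subsolutions for finite chains driven by Poisson counts\<close>

abbreviation mean :: "'a pmf \<Rightarrow> ('a \<Rightarrow> real) \<Rightarrow> real" where
  "mean p \<equiv> measure_pmf.expectation p"

lemma expectation_bind_pmf:
  fixes g :: "'b \<Rightarrow> real"
  assumes "finite S" "\<And>x. x \<in> set_pmf p \<Longrightarrow> set_pmf (f x) \<subseteq> S"
  shows "mean (bind_pmf p f) g =
    mean p (\<lambda>x. mean (f x) g)"
proof -
  have int: "integrable (measure_pmf p) (\<lambda>x. pmf (f x) s)" for s
    by (rule measure_pmf.integrable_const_bound[where B = 1]) (auto simp: pmf_nonneg pmf_le_1)
  have "set_pmf (bind_pmf p f) \<subseteq> S"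
    using assms(2) by auto
  then have "mean (bind_pmf p f) g = (\<Sum>s\<in>S. g s * pmf (bind_pmf p f) s)"
    using assms(1) by (subst integral_measure_pmf_real[of S]) auto
  also have "\<dots> = (\<Sum>s\<in>S. mean p (\<lambda>x. g s * pmf (f x) s))"
    by (simp add: pmf_bind)
  also have "\<dots> = mean p (\<lambda>x. \<Sum>s\<in>S. g s * pmf (f x) s)"
    by (rule Bochner_Integration.integral_sum[symmetric]) (auto intro: int)
  also have "\<dots> = mean p (\<lambda>x. mean (f x) g)"
  proof (rule integral_cong_AE)
    show "AE x in measure_pmf p. (\<Sum>s\<in>S. g s * pmf (f x) s) = mean (f x) g"
      unfolding AE_measure_pmf_iff
      using assms by (auto intro!: integral_measure_pmf_real[symmetric])
  qed auto
  finally show ?thesis .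
qed

lemma expectation_finite_support:
  fixes g :: "'b \<Rightarrow> real"
  assumes "finite S" "set_pmf p \<subseteq> S"
  shows "mean p g = (\<Sum>s\<in>S. pmf p s * g s)"
  using assms by (subst integral_measure_pmf_real[of S]) (auto simp: mult.commute)

lemma integrable_finite_support:
  fixes g :: "'b \<Rightarrow> real"
  assumes "finite S" "set_pmf p \<subseteq> S"
  shows "integrable (measure_pmf p) g"
  using assms by (meson finite_subset integrable_measure_pmf_finite)

lemma expectation_mono_on:
  fixes f g :: "'b \<Rightarrow> real"
  assumes "finite S" "set_pmf p \<subseteq> S" "\<And>s. s \<in> S \<Longrightarrow> f s \<le> g s"
  shows "mean p f \<le> mean p g"
  unfolding expectation_finite_support[OF assms(1,2)]
  by (intro sum_mono mult_left_mono assms(3)) (auto simp: pmf_nonneg)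

lemma expectation_abs_le:
  fixes g :: "'b \<Rightarrow> real"
  assumes "finite S" "set_pmf p \<subseteq> S" "\<And>s. s \<in> S \<Longrightarrow> \<bar>g s\<bar> \<le> B"
  shows "\<bar>mean p g\<bar> \<le> B"
proof -
  have c: "mean p (\<lambda>_. c) = c" for c :: real
    by simp
  show ?thesis
    using expectation_mono_on[OF assms(1,2), of "\<lambda>_. - B" g]
      expectation_mono_on[OF assms(1,2), of g "\<lambda>_. B"] assms(3)
    by (force simp: c abs_le_iff)
qed

lemma set_pmf_process:
  assumes "\<And>a s. a \<in> set as \<Longrightarrow> s \<in> S \<Longrightarrow> set_pmf (f a s) \<subseteq> S" "s \<in> S"
  shows "set_pmf (process f as s) \<subseteq> S"
  using assms by (induction as arbitrary: s) fastforce+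

lemma process_append: "process f (xs @ ys) s = bind_pmf (process f xs s) (process f ys)"
proof (induction xs arbitrary: s)
  case (Cons x xs)
  show ?case
    by (simp add: bind_assoc_pmf) (rule bind_pmf_cong[OF refl Cons.IH])
qed (simp add: bind_return_pmf)

lemma process_Nil: "process f [] = return_pmf"
  by (rule ext) simp

lemma process_map: "process f (map h xs) s = process (\<lambda>a. f (h a)) xs s"
  by (induction xs arbitrary: s) (auto cong: bind_pmf_cong)

lemma process_concat: "process f (concat xss) s = process (process f) xss s"
proof (induction xss arbitrary: s)
  case (Cons xs xss)
  show ?case
    by (simp add: process_append) (rule bind_pmf_cong[OF refl Cons.IH])
qed simp

lemma process_cong:
  assumes "xs = ys" "\<And>a s. a \<in> set ys \<Longrightarrow> f a s = g a s"
  shows "process f xs s = process g ys s"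
  unfolding assms(1) using assms(2)
  by (induction ys arbitrary: s) (auto cong: bind_pmf_cong)

definition poisson_kernel :: "real \<Rightarrow> ('s \<Rightarrow> 's pmf) \<Rightarrow> 's \<Rightarrow> 's pmf" where
  "poisson_kernel l f s = bind_pmf (poisson_pmf l) (\<lambda>n. process (\<lambda>_. f) (replicate n ()) s)"

lemma set_pmf_poisson_kernel:
  assumes "\<And>s. s \<in> S \<Longrightarrow> set_pmf (f s) \<subseteq> S" "s \<in> S"
  shows "set_pmf (poisson_kernel l f s) \<subseteq> S"
  unfolding poisson_kernel_def using set_pmf_process[of _ S "\<lambda>_. f"] assms by fastforce

lemma exp_minus_quadratic_bound:
  fixes x :: real
  assumes "0 \<le> x"
  shows "1 - x \<le> exp (- x)" "exp (- x) \<le> 1 - x + x\<^sup>2"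
proof -
  show "1 - x \<le> exp (- x)"
    using exp_ge_add_one_self[of "- x"] by simp
  have "1 \<le> (1 - x + x\<^sup>2) * (1 + x)"
    using assms by (simp add: algebra_simps power2_eq_square power3_eq_cube)
  also have "\<dots> \<le> (1 - x + x\<^sup>2) * exp x"
  proof (rule mult_left_mono)
    have "0 \<le> (x - 1/2)\<^sup>2 + 3/4" by simp
    also have "\<dots> = 1 - x + x\<^sup>2" by (simp add: power2_eq_square algebra_simps)
    finally show "0 \<le> 1 - x + x\<^sup>2" .
  qed (rule exp_ge_add_one_self)
  finally show "exp (- x) \<le> 1 - x + x\<^sup>2"
    by (simp add: exp_minus divide_simps)
qed

lemma poisson_expectation_linearization:
  fixes u :: "nat \<Rightarrow> real"
  assumes l: "0 < l" and u: "\<And>n. \<bar>u n\<bar> \<le> B"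
  shows "\<bar>mean (poisson_pmf l) u - u 0 - l * (u 1 - u 0)\<bar> \<le> 3 * B * l\<^sup>2"
proof -
  let ?P = "measure_pmf (poisson_pmf l)"
  define v where "v n = (if n < 2 then 0 else u n)" for n
  have B: "0 \<le> B" using u[of 0] by linarith
  have i0: "integrable ?P (indicator A :: nat \<Rightarrow> real)" for A
    by (rule measure_pmf.integrable_const_bound[where B = 1]) (auto simp: indicator_def)
  have iv: "integrable ?P v"
    by (rule measure_pmf.integrable_const_bound[where B = B]) (use u B in \<open>auto simp: v_def\<close>)
  have p0: "mean (poisson_pmf l) (indicator {k}) = l ^ k / fact k * exp (- l)" for k
    using l by (simp add: measure_pmf_single)
  have u_eq: "u = (\<lambda>n. u 0 * indicator {0} n + u 1 * indicator {1} n + v n)"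
  proof
    show "u n = u 0 * indicator {0} n + u 1 * indicator {1} n + v n" for n
      by (cases "n = 0"; cases "n = 1") (auto simp: v_def)
  qed
  have "mean (poisson_pmf l) u =
      mean (poisson_pmf l) (\<lambda>n. u 0 * indicator {0} n + u 1 * indicator {1} n + v n)"
    using u_eq by (rule arg_cong)
  also have "\<dots> = u 0 * exp (- l) + u 1 * (l * exp (- l)) + mean (poisson_pmf l) v"
    using iv i0 p0[of 0] p0[of 1] by simp
  finally have Eu: "mean (poisson_pmf l) u = \<dots>" .
  have "\<bar>mean (poisson_pmf l) v\<bar>
      \<le> mean (poisson_pmf l) (\<lambda>n. \<bar>v n\<bar>)"
    by (rule integral_abs_bound)
  also have "\<dots> \<le> mean (poisson_pmf l)
      (\<lambda>n. B * (1 - indicator {0} n - indicator {1} n))"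
  proof (rule integral_mono)
    show "\<bar>v n\<bar> \<le> B * (1 - indicator {0} n - indicator {1} n)" for n
      using u[of n] by (cases "n = 0"; cases "n = 1") (auto simp: v_def)
  qed (use iv i0 in auto)
  also have "\<dots> = B * (1 - exp (- l) - l * exp (- l))"
    using i0 p0[of 0] p0[of 1] by simp
  also have "\<dots> \<le> B * l\<^sup>2"
  proof (rule mult_left_mono)
    have "(1 - l) * (1 + l) \<le> exp (- l) * (1 + l)"
      using exp_minus_quadratic_bound[of l] l by (intro mult_right_mono) auto
    then show "1 - exp (- l) - l * exp (- l) \<le> l\<^sup>2"
      by (simp add: algebra_simps power2_eq_square)
  qed (rule B)
  finally have v: "\<bar>mean (poisson_pmf l) v\<bar> \<le> B * l\<^sup>2" .
  have e: "\<bar>exp (- l) - 1 + l\<bar> \<le> l\<^sup>2" "\<bar>exp (- l) - 1\<bar> \<le> l"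
    using exp_minus_quadratic_bound[of l] l by auto
  have h1: "\<bar>u 0 * (exp (- l) - 1 + l)\<bar> \<le> B * l\<^sup>2"
    unfolding abs_mult using u[of 0] e(1) B by (intro mult_mono) auto
  have h2: "\<bar>u 1 * (l * (exp (- l) - 1))\<bar> \<le> B * l\<^sup>2"
    unfolding abs_mult power2_eq_square using u[of 1] e(2) B l by (intro mult_mono) auto
  have "mean (poisson_pmf l) u - u 0 - l * (u 1 - u 0)
      = u 0 * (exp (- l) - 1 + l) + u 1 * (l * (exp (- l) - 1)) + mean (poisson_pmf l) v"
    unfolding Eu by (simp add: algebra_simps)
  then show ?thesis
    using h1 h2 v by linarith
qed

lemma poisson_kernel_linearization:
  fixes g :: "'s \<Rightarrow> real"
  assumes S: "finite S" "\<And>s. s \<in> S \<Longrightarrow> set_pmf (f s) \<subseteq> S"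
    and g: "\<And>s. s \<in> S \<Longrightarrow> \<bar>g s\<bar> \<le> B" and l: "0 < l" and s: "s \<in> S"
  shows "\<bar>mean (poisson_kernel l f s) g - g s
    - l * (mean (f s) g - g s)\<bar> \<le> 3 * B * l\<^sup>2"
proof -
  define u where "u n = mean (process (\<lambda>_. f) (replicate n ()) s) g" for n
  have sub: "set_pmf (process (\<lambda>_. f) (replicate n ()) s) \<subseteq> S" for n
    by (rule set_pmf_process) (use S s in auto)
  have "mean (poisson_kernel l f s) g = mean (poisson_pmf l) u"
    unfolding poisson_kernel_def u_def
    by (rule expectation_bind_pmf[OF S(1)]) (use sub in auto)
  moreover have "\<bar>u n\<bar> \<le> B" for n
    unfolding u_def by (rule expectation_abs_le[OF S(1) sub g])
  moreover have "u 0 = g s" "u 1 = mean (f s) g"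
    unfolding u_def by (simp_all add: process_Nil bind_return_pmf')
  ultimately show ?thesis
    using poisson_expectation_linearization[OF l, of u B] by simp
qed

definition cell_kernel :: "('i \<Rightarrow> real) \<Rightarrow> 'i list \<Rightarrow> real \<Rightarrow> ('i \<Rightarrow> 's \<Rightarrow> 's pmf) \<Rightarrow> 's \<Rightarrow> 's pmf" where
  "cell_kernel l ks h F = process (\<lambda>i. poisson_kernel (l i * h) (F i)) ks"

lemma set_pmf_cell_kernel:
  assumes "\<And>i s. i \<in> set ks \<Longrightarrow> s \<in> S \<Longrightarrow> set_pmf (F i s) \<subseteq> S" "s \<in> S"
  shows "set_pmf (cell_kernel l ks h F s) \<subseteq> S"
  unfolding cell_kernel_def
proof (rule set_pmf_process[OF _ assms(2)])
  show "set_pmf (poisson_kernel (l i * h) (F i) s) \<subseteq> S" if "i \<in> set ks" "s \<in> S" for i s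
    by (rule set_pmf_poisson_kernel) (use assms(1) that in auto)
qed

definition drift :: "('i \<Rightarrow> real) \<Rightarrow> 'i list \<Rightarrow> ('i \<Rightarrow> 's \<Rightarrow> 's pmf) \<Rightarrow> ('s \<Rightarrow> real) \<Rightarrow> 's \<Rightarrow> real" where
  "drift l ks F g s = (\<Sum>i\<leftarrow>ks. l i * (mean (F i s) g - g s))"

lemma expectation_bind_ge:
  fixes f g :: "'s \<Rightarrow> real"
  assumes "finite S" "finite T" "set_pmf p \<subseteq> S" "\<And>s. s \<in> S \<Longrightarrow> set_pmf (q s) \<subseteq> T"
    "\<And>s. s \<in> S \<Longrightarrow> f s - e \<le> mean (q s) g"
  shows "mean p f - e \<le> mean (bind_pmf p q) g"
proof -
  have "mean p f - e = mean p (\<lambda>s. f s - e)"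
    by (subst Bochner_Integration.integral_diff) (auto intro: integrable_finite_support[OF assms(1,3)])
  also have "\<dots> \<le> mean p (\<lambda>s. mean (q s) g)"
    by (rule expectation_mono_on[OF assms(1,3,5)])
  also have "\<dots> = mean (bind_pmf p q) g"
    by (rule expectation_bind_pmf[OF assms(2), symmetric]) (use assms(3,4) in auto)
  finally show ?thesis .
qed

lemma expectation_perturbation:
  fixes f g :: "'s \<Rightarrow> real"
  assumes "finite S" "set_pmf p \<subseteq> S" "\<And>s. s \<in> S \<Longrightarrow> \<bar>f s - g s\<bar> \<le> e"
  shows "\<bar>mean p f - mean p g\<bar> \<le> e"
proof -
  have "mean p f - mean p g =
      mean p (\<lambda>s. f s - g s)"
    by (subst Bochner_Integration.integral_diff) (auto intro: integrable_finite_support[OF assms(1,2)])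
  then show ?thesis
    using expectation_abs_le[OF assms(1,2), of "\<lambda>s. f s - g s" e] assms(3) by simp
qed

lemma cell_kernel_linearization:
  assumes S: "finite S" and F: "\<And>i s. i \<in> set ks \<Longrightarrow> s \<in> S \<Longrightarrow> set_pmf (F i s) \<subseteq> S"
    and l: "\<And>i. i \<in> set ks \<Longrightarrow> 0 < l i"
  shows "\<exists>C. \<forall>h g s. 0 < h \<longrightarrow> h \<le> 1 \<longrightarrow> (\<forall>s\<in>S. \<bar>g s\<bar> \<le> B) \<longrightarrow> s \<in> S \<longrightarrow>
    \<bar>mean (cell_kernel l ks h F s) g - g s - h * drift l ks F g s\<bar> \<le> C * h\<^sup>2"
  using F l
proof (induction ks)
  case Nil
  show ?case
    by (rule exI[of _ 0]) (simp add: cell_kernel_def drift_def)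
next
  case (Cons i ks)
  have "\<exists>C. \<forall>h g s. 0 < h \<longrightarrow> h \<le> 1 \<longrightarrow> (\<forall>s\<in>S. \<bar>g s\<bar> \<le> B) \<longrightarrow> s \<in> S \<longrightarrow>
      \<bar>mean (cell_kernel l ks h F s) g - g s - h * drift l ks F g s\<bar> \<le> C * h\<^sup>2"
    by (rule Cons.IH) (use Cons.prems in auto)
  then obtain C where C: "\<forall>h g s. 0 < h \<longrightarrow> h \<le> 1 \<longrightarrow> (\<forall>s\<in>S. \<bar>g s\<bar> \<le> B) \<longrightarrow> s \<in> S \<longrightarrow>
      \<bar>mean (cell_kernel l ks h F s) g - g s - h * drift l ks F g s\<bar> \<le> C * h\<^sup>2" ..
  define L where "L = (\<Sum>k\<leftarrow>ks. l k)"
  define D where "D = 2 * B * L + C"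
  have li: "0 < l i" and Fi: "\<And>s. s \<in> S \<Longrightarrow> set_pmf (F i s) \<subseteq> S"
    using Cons.prems by auto
  have L: "0 \<le> L"
    unfolding L_def using Cons.prems(2) by (intro sum_list_nonneg) (auto intro: less_imp_le)
  have "\<bar>mean (cell_kernel l (i # ks) h F s) g - g s - h * drift l (i # ks) F g s\<bar>
      \<le> (3 * B * (l i)\<^sup>2 + 2 * l i * D + C) * h\<^sup>2"
    if h: "0 < h" "h \<le> 1" and g: "\<forall>s\<in>S. \<bar>g s\<bar> \<le> B" and s: "s \<in> S" for h g s
  proof -
    define g' where "g' s = mean (cell_kernel l ks h F s) g" for s
    have B: "0 \<le> B" using g s by fastforce
    have sub: "set_pmf (cell_kernel l ks h F s) \<subseteq> S" if "s \<in> S" for s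
      using that Cons.prems(1) by (intro set_pmf_cell_kernel) auto
    have g': "\<bar>g' s\<bar> \<le> B" if "s \<in> S" for s
      unfolding g'_def using expectation_abs_le[OF S sub[OF that]] g by auto
    have C0: "0 \<le> C"
    proof -
      have "0 \<le> C * h\<^sup>2"
        using C[THEN spec, THEN spec, THEN spec, THEN mp, THEN mp, THEN mp, THEN mp, OF h g s] by (smt (verit))
      then show ?thesis using h by (simp add: zero_le_mult_iff)
    qed
    have dr: "\<bar>drift l ks F g s\<bar> \<le> 2 * B * L" if "s \<in> S" for s
    proof -
      have "\<bar>drift l ks F g s\<bar> \<le> (\<Sum>k\<leftarrow>ks. \<bar>l k * (mean (F k s) g - g s)\<bar>)"
        unfolding drift_def using sum_list_abs[of "map _ ks"] by (simp add: comp_def)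
      also have "\<dots> \<le> (\<Sum>k\<leftarrow>ks. l k * (2 * B))"
      proof (rule sum_list_mono)
        fix k assume k: "k \<in> set ks"
        have "\<bar>mean (F k s) g\<bar> \<le> B"
          using expectation_abs_le[OF S, of "F k s" g B] Cons.prems(1) k that g by auto
        then have "\<bar>mean (F k s) g - g s\<bar> \<le> 2 * B"
          using g that by fastforce
        then show "\<bar>l k * (mean (F k s) g - g s)\<bar> \<le> l k * (2 * B)"
          using Cons.prems(2)[of k] k by (auto simp: abs_mult)
      qed
      also have "\<dots> = 2 * B * L"
        unfolding L_def by (simp add: sum_list_mult_const mult.commute)
      finally show ?thesis .
    qed
    have gg': "\<bar>g' s - g s\<bar> \<le> D * h" if "s \<in> S" for s
    proof -
      have "\<bar>h * drift l ks F g s\<bar> \<le> 2 * B * L * h"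
        using dr[OF that] h by (simp add: abs_mult mult.commute mult_right_mono)
      moreover have "C * h\<^sup>2 \<le> C * h"
        using h C0 by (intro mult_left_mono) (auto simp: power2_eq_square mult_left_le)
      ultimately show ?thesis
        using C[THEN spec, THEN spec, THEN spec, THEN mp, THEN mp, THEN mp, THEN mp, OF h g that] unfolding g'_def[symmetric] D_def by (simp add: algebra_simps)
    qed
    have "mean (cell_kernel l (i # ks) h F s) g =
        mean (poisson_kernel (l i * h) (F i) s) g'"
      unfolding cell_kernel_def process.simps g'_def
      by (rule expectation_bind_pmf[OF S])
        (use sub[unfolded cell_kernel_def] set_pmf_poisson_kernel[where f = "F i", OF Fi s] in blast)
    moreover have "\<bar>mean (poisson_kernel (l i * h) (F i) s) g' - g' s
        - l i * h * (mean (F i s) g' - g' s)\<bar> \<le> 3 * B * (l i * h)\<^sup>2"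
      by (rule poisson_kernel_linearization[OF S]) (use Fi g' li h s in auto)
    moreover have "\<bar>l i * h * (mean (F i s) g' - g' s)
        - l i * h * (mean (F i s) g - g s)\<bar> \<le> 2 * l i * D * h\<^sup>2"
    proof -
      have "\<bar>mean (F i s) g' - mean (F i s) g\<bar> \<le> D * h"
        by (rule expectation_perturbation[OF S]) (use Fi s gg' in auto)
      then have "\<bar>(mean (F i s) g' - g' s) - (mean (F i s) g - g s)\<bar>
          \<le> 2 * (D * h)"
        using gg'[OF s] by linarith
      then have "l i * h * \<bar>(mean (F i s) g' - g' s) - (mean (F i s) g - g s)\<bar>
          \<le> l i * h * (2 * (D * h))"
        using li h by (intro mult_left_mono) auto
      moreover have "l i * h * (2 * (D * h)) = 2 * l i * D * h\<^sup>2"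
        by (simp add: power2_eq_square)
      moreover have "\<bar>l i * h * (mean (F i s) g' - g' s)
        - l i * h * (mean (F i s) g - g s)\<bar> = l i * h *
        \<bar>(mean (F i s) g' - g' s) - (mean (F i s) g - g s)\<bar>"
        using li h by (simp add: right_diff_distrib[symmetric] abs_mult del: right_diff_distrib)
      ultimately show ?thesis
        by linarith
    qed
    moreover have "\<bar>g' s - g s - h * drift l ks F g s\<bar> \<le> C * h\<^sup>2"
      using C[THEN spec, THEN spec, THEN spec, THEN mp, THEN mp, THEN mp, THEN mp, OF h g s] unfolding g'_def .
    moreover have "h * drift l (i # ks) F g s =
        l i * h * (mean (F i s) g - g s) + h * drift l ks F g s"
      unfolding drift_def by (simp add: algebra_simps)
    ultimately show ?thesis
      by (simp add: distrib_right power_mult_distrib)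
  qed
  then show ?case by blast
qed

lemma expectation_bind_process:
  fixes g :: "'s \<Rightarrow> real"
  assumes S: "finite S" and F: "\<And>a s. s \<in> S \<Longrightarrow> set_pmf (f a s) \<subseteq> S" and s: "s \<in> S"
  shows "mean (process f (a # as) s) g =
    mean (f a s) (\<lambda>s'. mean (process f as s') g)"
  unfolding process.simps
proof (rule expectation_bind_pmf[OF S])
  show "set_pmf (process f as s') \<subseteq> S" if "s' \<in> set_pmf (f a s)" for s'
    by (rule set_pmf_process) (use F s that in auto)
qed

lemma uniformly_continuous_finite_family:
  fixes V' :: "real \<Rightarrow> 's \<Rightarrow> real"
  assumes S: "finite S" and c: "\<And>s. s \<in> S \<Longrightarrow> continuous_on {a..b} (\<lambda>t. V' t s)" and e: "0 < e"
  shows "\<exists>d>0. \<forall>s\<in>S. \<forall>t\<in>{a..b}. \<forall>t'\<in>{a..b}. \<bar>t' - t\<bar> < d \<longrightarrow> \<bar>V' t' s - V' t s\<bar> < e"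
  using S c
proof (induction S rule: finite_induct)
  case empty
  show ?case by (auto intro: exI[of _ 1])
next
  case (insert s S)
  then obtain d where d: "d > 0"
    "\<forall>s\<in>S. \<forall>t\<in>{a..b}. \<forall>t'\<in>{a..b}. \<bar>t' - t\<bar> < d \<longrightarrow> \<bar>V' t' s - V' t s\<bar> < e"
    by auto
  have "uniformly_continuous_on {a..b} (\<lambda>t. V' t s)"
    using insert.prems by (intro compact_uniformly_continuous) auto
  then obtain d' where d': "d' > 0"
    "\<forall>t\<in>{a..b}. \<forall>t'\<in>{a..b}. \<bar>t' - t\<bar> < d' \<longrightarrow> \<bar>V' t' s - V' t s\<bar> < e"
    using e unfolding uniformly_continuous_on_def dist_real_def by blast
  show ?case
    by (rule exI[of _ "min d d'"]) (use d d' in auto)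
qed

lemma bounded_finite_family:
  fixes V :: "real \<Rightarrow> 's \<Rightarrow> real"
  assumes S: "finite S" and c: "\<And>s. s \<in> S \<Longrightarrow> continuous_on {a..b} (\<lambda>t. V t s)"
  shows "\<exists>B. \<forall>s\<in>S. \<forall>t\<in>{a..b}. \<bar>V t s\<bar> \<le> B"
  using S c
proof (induction S rule: finite_induct)
  case (insert s S)
  then obtain B where B: "\<forall>s\<in>S. \<forall>t\<in>{a..b}. \<bar>V t s\<bar> \<le> B"
    by auto
  have "compact ((\<lambda>t. V t s) ` {a..b})"
    using insert.prems by (intro compact_continuous_image) auto
  then obtain B' where B': "\<forall>t\<in>{a..b}. \<bar>V t s\<bar> \<le> B'"
    using compact_imp_bounded[of "(\<lambda>t. V t s) ` {a..b}"] unfolding bounded_real by auto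
  show ?case
    by (rule exI[of _ "max B B'"]) (use B B' in \<open>auto simp: le_max_iff_disj\<close>)
qed auto

lemma cell_kernel_subsolution_step:
  fixes V V' :: "real \<Rightarrow> 's \<Rightarrow> real"
  assumes S: "finite S" and F: "\<And>i s. i \<in> set ks \<Longrightarrow> s \<in> S \<Longrightarrow> set_pmf (F i s) \<subseteq> S"
    and l: "\<And>i. i \<in> set ks \<Longrightarrow> 0 < l i"
    and V: "\<And>t s. t \<in> {a..b} \<Longrightarrow> s \<in> S \<Longrightarrow> ((\<lambda>t. V t s) has_real_derivative V' t s) (at t)"
    and V': "\<And>s. s \<in> S \<Longrightarrow> continuous_on {a..b} (\<lambda>t. V' t s)"
    and sub: "\<And>t s. t \<in> {a..b} \<Longrightarrow> s \<in> S \<Longrightarrow> 0 \<le> V' t s + drift l ks F (V t) s"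
    and e: "0 < e"
  shows "\<exists>d>0. \<forall>h t s. 0 < h \<longrightarrow> h < d \<longrightarrow> a \<le> t \<longrightarrow> t + h \<le> b \<longrightarrow> s \<in> S \<longrightarrow>
    V t s - e * h \<le> mean (cell_kernel l ks h F s) (V (t + h))"
proof -
  have cV: "continuous_on {a..b} (\<lambda>t. V t s)" if "s \<in> S" for s
    using V[OF _ that] by (meson DERIV_isCont continuous_at_imp_continuous_on)
  have "\<exists>B. \<forall>s\<in>S. \<forall>t\<in>{a..b}. \<bar>V t s\<bar> \<le> B"
    by (rule bounded_finite_family[OF S cV])
  then obtain B where B: "\<forall>s\<in>S. \<forall>t\<in>{a..b}. \<bar>V t s\<bar> \<le> B" ..
  have "\<exists>C. \<forall>h g s. 0 < h \<longrightarrow> h \<le> 1 \<longrightarrow> (\<forall>s\<in>S. \<bar>g s\<bar> \<le> B) \<longrightarrow> s \<in> S \<longrightarrow>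
    \<bar>mean (cell_kernel l ks h F s) g - g s - h * drift l ks F g s\<bar> \<le> C * h\<^sup>2"
    by (rule cell_kernel_linearization[OF S F l])
  then obtain C where C: "\<forall>h g s. 0 < h \<longrightarrow> h \<le> 1 \<longrightarrow> (\<forall>s\<in>S. \<bar>g s\<bar> \<le> B) \<longrightarrow> s \<in> S \<longrightarrow>
    \<bar>mean (cell_kernel l ks h F s) g - g s - h * drift l ks F g s\<bar> \<le> C * h\<^sup>2" ..
  have "\<exists>d>0. \<forall>s\<in>S. \<forall>t\<in>{a..b}. \<forall>t'\<in>{a..b}. \<bar>t' - t\<bar> < d \<longrightarrow> \<bar>V' t' s - V' t s\<bar> < e / 2"
    by (rule uniformly_continuous_finite_family[OF S V']) (use e in auto)
  then obtain d where d: "d > 0"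
    "\<forall>s\<in>S. \<forall>t\<in>{a..b}. \<forall>t'\<in>{a..b}. \<bar>t' - t\<bar> < d \<longrightarrow> \<bar>V' t' s - V' t s\<bar> < e / 2"
    by auto
  define d0 where "d0 = min (min d 1) (e / (2 * (\<bar>C\<bar> + 1)))"
  have d0: "0 < d0" using d e by (auto simp: d0_def)
  have "V t s - e * h \<le> mean (cell_kernel l ks h F s) (V (t + h))"
    if h: "0 < h" "h < d0" and t: "a \<le> t" "t + h \<le> b" and s: "s \<in> S" for h t s
  proof -
    have "\<exists>z. t < z \<and> z < t + h \<and> V (t + h) s - V t s = (t + h - t) * V' z s"
      by (rule MVT2) (use h t s in \<open>auto intro!: V\<close>)
    then obtain z where z: "t < z" "z < t + h" "V (t + h) s - V t s = h * V' z s"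
      by auto
    have "\<bar>V' (t + h) s - V' z s\<bar> < e / 2"
      by (rule d(2)[rule_format]) (use s t z h in \<open>auto simp: d0_def\<close>)
    then have "h * (V' (t + h) s - V' z s) \<le> h * (e / 2)"
      using h(1) by (intro mult_left_mono) linarith+
    then have v: "V (t + h) s - h * V' (t + h) s \<ge> V t s - h * (e / 2)"
      using z by (simp add: algebra_simps)
    have "C * h\<^sup>2 \<le> (\<bar>C\<bar> + 1) * h * h"
      unfolding power2_eq_square using h by (auto intro!: mult_right_mono simp: mult.assoc[symmetric])
    also have "\<dots> \<le> (e / 2) * h"
      using h e by (intro mult_right_mono) (auto simp: d0_def field_simps)
    finally have c: "C * h\<^sup>2 \<le> h * (e / 2)"
      by (simp add: mult.commute)
    have sd: "0 \<le> h * (V' (t + h) s + drift l ks F (V (t + h)) s)"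
      using sub[of "t + h" s] h t s by (intro mult_nonneg_nonneg) auto
    have "\<bar>mean (cell_kernel l ks h F s) (V (t + h)) - V (t + h) s
        - h * drift l ks F (V (t + h)) s\<bar> \<le> C * h\<^sup>2"
      by (rule C[rule_format]) (use h t s B in \<open>auto simp: d0_def\<close>)
    then show ?thesis
      using v c sd by (simp add: algebra_simps)
  qed
  then show ?thesis using d0 by blast
qed

lemma cell_chain_subsolution:
  fixes V V' :: "real \<Rightarrow> 's \<Rightarrow> real"
  assumes S: "finite S" and F: "\<And>i s. i \<in> set ks \<Longrightarrow> s \<in> S \<Longrightarrow> set_pmf (F i s) \<subseteq> S"
    and l: "\<And>i. i \<in> set ks \<Longrightarrow> 0 < l i"
    and V: "\<And>t s. t \<in> {a..b} \<Longrightarrow> s \<in> S \<Longrightarrow> ((\<lambda>t. V t s) has_real_derivative V' t s) (at t)"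
    and V': "\<And>s. s \<in> S \<Longrightarrow> continuous_on {a..b} (\<lambda>t. V' t s)"
    and sub: "\<And>t s. t \<in> {a..b} \<Longrightarrow> s \<in> S \<Longrightarrow> 0 \<le> V' t s + drift l ks F (V t) s"
    and ab: "a \<le> b" and e: "0 < e"
  shows "\<exists>d>0. \<forall>h xs s. 0 < h \<longrightarrow> h < d \<longrightarrow> real (length xs) * h = b - a \<longrightarrow> s \<in> S \<longrightarrow>
    V a s - e \<le> mean (process (\<lambda>_. cell_kernel l ks h F) xs s) (V b)"
proof -
  define e' where "e' = e / (b - a + 1)"
  have e': "0 < e'" "e' * (b - a) \<le> e"
    using ab e by (auto simp: e'_def field_simps)
  have "\<exists>d>0. \<forall>h t s. 0 < h \<longrightarrow> h < d \<longrightarrow> a \<le> t \<longrightarrow> t + h \<le> b \<longrightarrow> s \<in> S \<longrightarrow>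
    V t s - e' * h \<le> mean (cell_kernel l ks h F s) (V (t + h))"
    by (rule cell_kernel_subsolution_step[OF S F l V V' sub e'(1)])
  then obtain d where d: "d > 0" "\<forall>h t s. 0 < h \<longrightarrow> h < d \<longrightarrow> a \<le> t \<longrightarrow> t + h \<le> b \<longrightarrow> s \<in> S \<longrightarrow>
    V t s - e' * h \<le> mean (cell_kernel l ks h F s) (V (t + h))"
    by (elim exE conjE) (rule that)
  have *: "V (b - real (length xs) * h) s - e' * (real (length xs) * h)
      \<le> mean (process (\<lambda>_. cell_kernel l ks h F) xs s) (V b)"
    if h: "0 < h" "h < d" and len: "real (length xs) * h \<le> b - a" and s: "s \<in> S" for h and xs :: "'c list" and s
    using len s
  proof (induction xs arbitrary: s)
    case (Cons x xs)
    define t where "t = b - real (length (x # xs)) * h"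
    have th: "t + h = b - real (length xs) * h"
      by (simp add: t_def algebra_simps)
    have sub': "set_pmf (cell_kernel l ks h F s) \<subseteq> S" if "s \<in> S" for s
      by (rule set_pmf_cell_kernel) (use F that in auto)
    have at: "a \<le> t" using Cons.prems by (simp add: t_def)
    have tb: "t + h \<le> b" using h by (simp add: th)
    have "V t s - e' * h \<le> mean (cell_kernel l ks h F s) (V (t + h))"
      by (rule d(2)[rule_format, OF h at tb Cons.prems(2)])
    then have "V t s - e' * (real (length (x # xs)) * h)
        \<le> mean (cell_kernel l ks h F s) (V (t + h)) - e' * (real (length xs) * h)"
      by (simp add: algebra_simps)
    also have "\<dots> = mean (cell_kernel l ks h F s)
        (\<lambda>s'. V (t + h) s' - e' * (real (length xs) * h))"
      by (subst Bochner_Integration.integral_diff)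
        (auto intro: integrable_finite_support[OF S sub'[OF Cons.prems(2)]])
    also have "\<dots> \<le> mean (cell_kernel l ks h F s)
        (\<lambda>s'. mean (process (\<lambda>_. cell_kernel l ks h F) xs s') (V b))"
    proof (rule expectation_mono_on[OF S sub'[OF Cons.prems(2)]])
      fix s' assume s': "s' \<in> S"
      have "real (length xs) * h \<le> b - a"
        using Cons.prems(1) h by (simp add: algebra_simps)
      then show "V (t + h) s' - e' * (real (length xs) * h)
          \<le> mean (process (\<lambda>_. cell_kernel l ks h F) xs s') (V b)"
        unfolding th by (rule Cons.IH[OF _ s'])
    qed
    also have "\<dots> = mean (process (\<lambda>_. cell_kernel l ks h F) (x # xs) s) (V b)"
      by (rule expectation_bind_process[OF S, symmetric]) (use sub' Cons.prems(2) in auto)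
    finally show ?case by (simp add: t_def)
  qed simp
  have "V a s - e \<le> mean (process (\<lambda>_. cell_kernel l ks h F) xs s) (V b)"
    if h: "0 < h" "h < d" and len: "real (length xs) * h = b - a" and s: "s \<in> S" for h and xs :: "'c list" and s
    using *[OF h _ s, of xs] len e'(2) by simp
  then show ?thesis
    using d(1) by blast
qed

section \<open>Discretized arrivals\<close>

lemma filter_eq_sorted_list_of_set:
  assumes "finite A"
  shows "filter (\<lambda>x. t = x) (sorted_list_of_set A) = (if t \<in> A then [t] else [])"
proof -
  have "filter (\<lambda>x. t = x) xs = (if t \<in> set xs then [t] else [])" if "distinct xs" for xs
    using that by (induction xs) auto
  from this[of "sorted_list_of_set A"] show ?thesis
    using assms by simp
qed

abbreviation cell :: "nat \<Rightarrow> nat \<Rightarrow> real set" where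
  "cell N k \<equiv> {real k / real N <.. real (Suc k) / real N}"

definition cell_arrivals :: "'i list \<Rightarrow> ('i \<Rightarrow> real set) \<Rightarrow> nat \<Rightarrow> nat \<Rightarrow> ('i \<times> real) list" where
  "cell_arrivals ks T N k = concat (map (\<lambda>i. map (Pair i)
     (sorted_list_of_set (T i \<inter> cell N k))) ks)"

lemma filter_snd_arrivals:
  assumes "\<And>i. i \<in> set ks \<Longrightarrow> finite (T i)"
  shows "filter (\<lambda>x. t = snd x) (concat (map (\<lambda>i. map (Pair i) (sorted_list_of_set (T i))) ks)) =
    concat (map (\<lambda>i. if t \<in> T i then [(i, t)] else []) ks)"
proof -
  have "filter (\<lambda>x. t = snd x) (map (Pair i) (sorted_list_of_set (T i))) = (if t \<in> T i then [(i, t)] else [])"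
    if "i \<in> set ks" for i
    using filter_eq_sorted_list_of_set[OF assms[OF that], of t] by (auto simp: filter_map comp_def)
  then show ?thesis
    unfolding filter_concat map_map comp_def by (intro arg_cong[where f = concat] map_cong) auto
qed

lemma concat_map_single:
  assumes "distinct xs" "\<And>x. x \<in> set xs \<Longrightarrow> x \<noteq> a \<Longrightarrow> f x = []" "a \<in> set xs"
  shows "concat (map f xs) = f a"
proof -
  have e: "concat (map f ys) = []" if "a \<notin> set ys" "set ys \<subseteq> set xs" for ys
    using that assms(2) by (induction ys) fastforce+
  obtain ys zs where xs: "xs = ys @ a # zs" "a \<notin> set ys"
    using assms(3) by (meson split_list_first)
  then have "a \<notin> set zs" using assms(1) by auto
  moreover have "set ys \<subseteq> set xs" "set zs \<subseteq> set xs"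
    using xs(1) by auto
  ultimately have "concat (map f ys) = []" "concat (map f zs) = []"
    using xs(2) e[of ys] e[of zs] by blast+
  then show ?thesis unfolding xs(1) by (simp del: concat_eq_Nil_conv)
qed

lemma count_mset_filter_snd:
  "count (mset zs) x = length (filter (\<lambda>y. x = y) (filter (\<lambda>y. snd x = snd y) zs))"
  by (auto simp: count_mset count_list_eq_length_filter intro!: arg_cong[where f = length] filter_cong)

lemma mem_cell_unique:
  fixes t :: real
  assumes "0 < N" "t \<in> cell N k"
    "t \<in> cell N k'"
  shows "k = k'"
proof (rule ccontr)
  assume "k \<noteq> k'"
  then consider "Suc k \<le> k'" | "Suc k' \<le> k" by linarith
  then show False
  proof cases
    case 1
    then have "real (Suc k) / real N \<le> real k' / real N"
      using assms(1) by (intro divide_right_mono) auto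
    then show False using assms by auto
  next
    case 2
    then have "real (Suc k') / real N \<le> real k / real N"
      using assms(1) by (intro divide_right_mono) auto
    then show False using assms by auto
  qed
qed

lemma mem_cell_exists:
  fixes t :: real
  assumes "0 < N" "0 < t" "t \<le> 1"
  shows "\<exists>k<N. t \<in> cell N k"
proof -
  define c where "c = nat \<lceil>t * real N\<rceil>"
  have p: "0 < t * real N" using assms by simp
  have c: "t * real N \<le> real c" "real c < t * real N + 1"
    unfolding c_def using p by linarith+
  have "t * real N \<le> real N" using assms by (simp add: mult_left_le_one_le)
  then have "real c < real N + 1" using c by linarith
  then have cN: "c \<le> N" by linarith
  have c0: "0 < c" using c p by (cases c) auto
  show ?thesis
    by (rule exI[of _ "c - 1"]) (use c c0 cN assms in \<open>auto simp: field_simps of_nat_diff\<close>)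
qed

lemma sorted_if_all_equal:
  assumes "\<And>x y. x \<in> set xs \<Longrightarrow> y \<in> set xs \<Longrightarrow> x = (y :: 'a :: linorder)"
  shows "sorted xs"
  using assms by (induction xs) (simp, metis list.set_intros sorted_simps(2) order_refl)

lemma arrivals_eq_cell_arrivals:
  assumes T: "\<And>i. i \<in> set ks \<Longrightarrow> finite (T i)" "\<And>i. i \<in> set ks \<Longrightarrow> T i \<subseteq> {0<..1}" and N: "0 < N"
    and sep: "\<And>t t' i i'. i \<in> set ks \<Longrightarrow> i' \<in> set ks \<Longrightarrow> t \<in> T i \<Longrightarrow> t' \<in> T i' \<Longrightarrow> t \<noteq> t' \<Longrightarrow>
      1 / real N < \<bar>t - t'\<bar>"
  shows "sort_key snd (concat (map (\<lambda>i. map (Pair i) (sorted_list_of_set (T i))) ks)) =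
    concat (map (cell_arrivals ks T N) [0..<N])" (is "sort_key snd ?xs = ?ys")
proof (rule properties_for_sort_key)
  have filter_cell: "filter (\<lambda>x. t = snd x) (cell_arrivals ks T N k) =
      (if t \<in> cell N k then filter (\<lambda>x. t = snd x) ?xs else [])" for t k
  proof -
    have "filter (\<lambda>x. t = snd x) (cell_arrivals ks T N k) =
      concat (map (\<lambda>i. if t \<in> T i \<inter> cell N k then [(i, t)] else []) ks)"
      unfolding cell_arrivals_def by (rule filter_snd_arrivals) (use T in auto)
    also have "\<dots> = (if t \<in> cell N k
        then concat (map (\<lambda>i. if t \<in> T i then [(i, t)] else []) ks) else [])"
    proof (cases "t \<in> cell N k")
      case False
      then show ?thesis by (subst if_not_P, assumption) (induction ks; auto)
    qed simp
    finally show ?thesis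
      by (simp only: filter_snd_arrivals[of ks T t, OF T(1)])
  qed
  have filter_eq: "filter (\<lambda>x. t = snd x) ?ys = filter (\<lambda>x. t = snd x) ?xs" for t
  proof (cases "0 < t \<and> t \<le> 1")
    case True
    then obtain k where k: "k < N" "t \<in> cell N k"
      using mem_cell_exists[OF N] by blast
    have "filter (\<lambda>x. t = snd x) ?ys =
        concat (map (\<lambda>k. filter (\<lambda>x. t = snd x) (cell_arrivals ks T N k)) [0..<N])"
      by (simp add: filter_concat comp_def)
    also have "\<dots> = filter (\<lambda>x. t = snd x) (cell_arrivals ks T N k)"
    proof (rule concat_map_single)
      fix k' assume "k' \<noteq> k"
      then show "filter (\<lambda>x. t = snd x) (cell_arrivals ks T N k') = []"
        unfolding filter_cell using mem_cell_unique[OF N k(2)] by auto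
    qed (use k in auto)
    finally show ?thesis
      unfolding filter_cell using k(2) by simp
  next
    case False
    then have "filter (\<lambda>x. t = snd x) ?xs = []" "filter (\<lambda>x. t = snd x) ?ys = []"
      using T by (auto simp: filter_empty_conv cell_arrivals_def) (meson greaterThanAtMost_iff subset_iff)+
    then show ?thesis by simp
  qed
  show "mset ?ys = mset ?xs"
  proof (rule multiset_eqI)
    fix x
    show "count (mset ?ys) x = count (mset ?xs) x"
      unfolding count_mset_filter_snd filter_eq ..
  qed
  show "filter (\<lambda>x. snd z = snd x) ?ys = filter (\<lambda>x. snd z = snd x) ?xs" for z
    by (rule filter_eq)
  have fin: "finite (T i \<inter> C)" if "i \<in> set ks" for i C
    using T(1)[OF that] by simp
  have cell: "real k / real N < t \<and> t \<le> real (Suc k) / real N \<and> i \<in> set ks \<and> t \<in> T i"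
    if "(i, t) \<in> set (cell_arrivals ks T N k)" for i t k
    using that fin by (auto simp: cell_arrivals_def)
  have "sorted (map snd (concat (map (cell_arrivals ks T N) [0..<m]))) \<and>
      (\<forall>x\<in>set (concat (map (cell_arrivals ks T N) [0..<m])). snd x \<le> real m / real N)" for m
  proof (induction m)
    case (Suc m)
    have "sorted (map snd (cell_arrivals ks T N m))"
    proof (rule sorted_if_all_equal)
      fix t t' assume "t \<in> set (map snd (cell_arrivals ks T N m))" "t' \<in> set (map snd (cell_arrivals ks T N m))"
      then obtain i i' where ii: "(i, t) \<in> set (cell_arrivals ks T N m)" "(i', t') \<in> set (cell_arrivals ks T N m)"
        by auto
      have "real (Suc m) / real N = real m / real N + 1 / real N"
        by (simp add: add_divide_distrib)
      then have "\<bar>t - t'\<bar> \<le> 1 / real N"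
        using cell[OF ii(1)] cell[OF ii(2)] by (auto simp: abs_le_iff)
      then show "t = t'"
        using sep[of i i' t t'] cell[OF ii(1)] cell[OF ii(2)] by fastforce
    qed
    moreover have "real m / real N \<le> real (Suc m) / real N"
      by (intro divide_right_mono) auto
    ultimately show ?case
      using Suc.IH by (fastforce simp: sorted_append dest: cell)
  qed (simp)
  then show "sorted (map snd ?ys)" by blast
qed

lemma process_const_length: "process (\<lambda>_. f) xs s = process (\<lambda>_. f) (replicate (length xs) ()) s"
  by (induction xs arbitrary: s) (auto cong: bind_pmf_cong)

lemma process_cell_arrivals:
  assumes T: "\<And>i. i \<in> set ks \<Longrightarrow> finite (T i)"
    and K: "\<And>i k t. i \<in> set ks \<Longrightarrow> k < N \<Longrightarrow> real k / real N < t \<Longrightarrow> t \<le> real (Suc k) / real N \<Longrightarrow>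
      K i t = K i (real (Suc k) / real N)"
  shows "process (\<lambda>(i, t). K i t) (concat (map (cell_arrivals ks T N) [0..<N])) s =
    process (\<lambda>(k, i). \<lambda>s. process (\<lambda>_. K i (real (Suc k) / real N))
      (replicate (card (T i \<inter> cell N k)) ()) s)
      (concat (map (\<lambda>k. map (Pair k) ks) [0..<N])) s"
proof -
  have cell: "process (\<lambda>(i, t). K i t) (cell_arrivals ks T N k) s =
    process (\<lambda>(k, i). \<lambda>s. process (\<lambda>_. K i (real (Suc k) / real N))
      (replicate (card (T i \<inter> cell N k)) ()) s) (map (Pair k) ks) s"
    if k: "k \<in> set [0..<N]" for k s
  proof -
    have "process (\<lambda>(i, t). K i t) (cell_arrivals ks T N k) s =
      process (\<lambda>i. process (\<lambda>(i, t). K i t) (map (Pair i) (sorted_list_of_set (T i \<inter> cell N k)))) ks s"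
      unfolding cell_arrivals_def process_concat process_map ..
    also have "\<dots> = process (\<lambda>i s. process (\<lambda>_. K i (real (Suc k) / real N)) (replicate (card (T i \<inter> cell N k)) ()) s) ks s"
    proof (rule process_cong[OF refl])
      fix i s assume i: "i \<in> set ks"
      have fin: "finite (T i \<inter> cell N k)" using T[OF i] by simp
      have "process (\<lambda>(i, t). K i t) (map (Pair i) (sorted_list_of_set (T i \<inter> cell N k))) s =
        process (\<lambda>t. K i t) (sorted_list_of_set (T i \<inter> cell N k)) s"
        by (simp add: process_map)
      also have "\<dots> = process (\<lambda>_. K i (real (Suc k) / real N)) (sorted_list_of_set (T i \<inter> cell N k)) s"
      proof (rule process_cong[OF refl])
        fix t s assume "t \<in> set (sorted_list_of_set (T i \<inter> cell N k))"
        then show "K i t s = K i (real (Suc k) / real N) s"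
          using fin K[OF i, of k t] k by auto
      qed
      also have "\<dots> = process (\<lambda>_. K i (real (Suc k) / real N)) (replicate (card (T i \<inter> cell N k)) ()) s"
        by (subst process_const_length) simp
      finally show "process (\<lambda>(i, t). K i t) (map (Pair i) (sorted_list_of_set (T i \<inter> cell N k))) s = \<dots>" .
    qed
    also have "\<dots> = process (\<lambda>(k, i). \<lambda>s. process (\<lambda>_. K i (real (Suc k) / real N))
        (replicate (card (T i \<inter> cell N k)) ()) s) (map (Pair k) ks) s"
      unfolding process_map by simp
    finally show ?thesis .
  qed
  show ?thesis
    unfolding process_concat process_map[of _ "cell_arrivals ks T N"]
      process_map[of _ "\<lambda>k. map (Pair k) ks"]
    by (rule process_cong[OF refl]) (rule cell)
qed

lemma borel_measurable_PiM_nat: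
  assumes "finite I"
  shows "(R :: ('v \<Rightarrow> nat) \<Rightarrow> real) \<in> borel_measurable (PiM I (\<lambda>_. count_space UNIV))"
  by (subst count_space_PiM_finite) (use assms in auto)

lemma (in prob_space) expectation_process_indep:
  fixes h :: "'s \<Rightarrow> real" and X :: "'v \<Rightarrow> 'a \<Rightarrow> nat"
  assumes S: "finite S" and g: "\<And>v n s. v \<in> set vs \<Longrightarrow> s \<in> S \<Longrightarrow> set_pmf (g v n s) \<subseteq> S"
    and X: "indep_vars (\<lambda>_. count_space UNIV) X (set vs)"
    and p: "\<And>v. v \<in> set vs \<Longrightarrow> distr M (count_space UNIV) (X v) = measure_pmf (p v)"
    and vs: "distinct vs" and s: "s \<in> S"
  shows "(\<integral>\<omega>. mean (process (\<lambda>v. g v (X v \<omega>)) vs s) h \<partial>M) =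
    mean (process (\<lambda>v s. bind_pmf (p v) (\<lambda>n. g v n s)) vs s) h"
  using g X p vs s
proof (induction vs arbitrary: s)
  case Nil
  then show ?case by (simp add: prob_space)
next
  case (Cons v vs)
  note g = Cons.prems(1) and X = Cons.prems(2) and p = Cons.prems(3) and vs = Cons.prems(4) and s = Cons.prems(5)
  have rv: "random_variable (count_space UNIV) (X w)" if "w \<in> set (v # vs)" for w
    using X that unfolding indep_vars_def by blast
  have gS: "set_pmf (process (\<lambda>v. g v (c v)) vs s') \<subseteq> S" if "s' \<in> S" for s' c
    by (rule set_pmf_process) (use g that in auto)
  obtain B where B: "\<And>s. s \<in> S \<Longrightarrow> \<bar>h s\<bar> \<le> B"
    using S by (meson finite_imageI bdd_above_finite bdd_above.unfold imageI finite_surj)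
  define R where "R s' c = mean (process (\<lambda>v. g v (c v)) vs s') h" for s' c
  have R_bound: "\<bar>R s' c\<bar> \<le> B" if "s' \<in> S" for s' c
    unfolding R_def by (rule expectation_abs_le[OF S gS[OF that] B])
  have R_restrict: "R s' (restrict c (set vs)) = R s' c" for s' c
    unfolding R_def
    by (intro arg_cong[where f = "\<lambda>q. mean q h"] process_cong refl) auto
  have iv: "indep_var (PiM {v} (\<lambda>_. count_space UNIV)) (\<lambda>\<omega>. restrict (\<lambda>w. X w \<omega>) {v})
      (PiM (set vs) (\<lambda>_. count_space UNIV)) (\<lambda>\<omega>. restrict (\<lambda>w. X w \<omega>) (set vs))"
    by (rule indep_var_restrict[OF X]) (use vs in auto)
  have prod: "(\<integral>\<omega>. pmf (g v (X v \<omega>) s) s' * R s' (\<lambda>w. X w \<omega>) \<partial>M) =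
      (\<integral>\<omega>. pmf (g v (X v \<omega>) s) s' \<partial>M) * (\<integral>\<omega>. R s' (\<lambda>w. X w \<omega>) \<partial>M)"
    and int: "integrable M (\<lambda>\<omega>. pmf (g v (X v \<omega>) s) s' * R s' (\<lambda>w. X w \<omega>))"
    if s': "s' \<in> S" for s'
  proof -
    define Y1 where "Y1 = (\<lambda>c :: 'v \<Rightarrow> nat. pmf (g v (c v) s) s') \<circ> (\<lambda>\<omega>. restrict (\<lambda>w. X w \<omega>) {v})"
    define Y2 where "Y2 = R s' \<circ> (\<lambda>\<omega>. restrict (\<lambda>w. X w \<omega>) (set vs))"
    have ind: "indep_var borel Y1 borel Y2"
      unfolding Y1_def Y2_def
      by (rule indep_var_compose[OF iv]) (rule borel_measurable_PiM_nat, simp)+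
    have Y: "Y1 = (\<lambda>\<omega>. pmf (g v (X v \<omega>) s) s')" "Y2 = (\<lambda>\<omega>. R s' (\<lambda>w. X w \<omega>))"
      unfolding Y1_def Y2_def comp_def R_restrict by auto
    have m: "Y1 \<in> borel_measurable M" "Y2 \<in> borel_measurable M"
      using ind indep_var_rv1 indep_var_rv2 by auto
    have i1: "integrable M Y1"
      by (rule integrable_const_bound[where B = 1]) (use m Y in \<open>auto simp: pmf_nonneg pmf_le_1\<close>)
    have i2: "integrable M Y2"
      by (rule integrable_const_bound[where B = B]) (use m Y R_bound[OF s'] in auto)
    show "(\<integral>\<omega>. pmf (g v (X v \<omega>) s) s' * R s' (\<lambda>w. X w \<omega>) \<partial>M) =
      (\<integral>\<omega>. pmf (g v (X v \<omega>) s) s' \<partial>M) * (\<integral>\<omega>. R s' (\<lambda>w. X w \<omega>) \<partial>M)"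
      using indep_var_lebesgue_integral[OF ind i1 i2] unfolding Y .
    show "integrable M (\<lambda>\<omega>. pmf (g v (X v \<omega>) s) s' * R s' (\<lambda>w. X w \<omega>))"
      using indep_var_integrable[OF ind i1 i2] unfolding Y .
  qed
  have sup: "set_pmf (bind_pmf (p v) (\<lambda>n. g v n s)) \<subseteq> S"
    using g[of v s] s by auto
  have sub': "set_pmf (process (\<lambda>v s. bind_pmf (p v) (\<lambda>n. g v n s)) vs s') \<subseteq> S" if "s' \<in> S" for s'
  proof (rule set_pmf_process[OF _ that])
    show "set_pmf (bind_pmf (p w) (\<lambda>n. g w n t)) \<subseteq> S" if "w \<in> set vs" "t \<in> S" for w t
      using g[of w t] that by auto
  qed
  have marg: "(\<integral>\<omega>. pmf (g v (X v \<omega>) s) s' \<partial>M) = pmf (bind_pmf (p v) (\<lambda>n. g v n s)) s'" for s'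
  proof -
    have "(\<integral>\<omega>. pmf (g v (X v \<omega>) s) s' \<partial>M) =
        (\<integral>n. pmf (g v n s) s' \<partial>distr M (count_space UNIV) (X v))"
      by (rule integral_distr[symmetric]) (use rv in auto)
    then show ?thesis
      using p[of v] by (simp add: pmf_bind)
  qed
  have IH: "(\<integral>\<omega>. R s' (\<lambda>w. X w \<omega>) \<partial>M) =
      mean (process (\<lambda>v s. bind_pmf (p v) (\<lambda>n. g v n s)) vs s') h" if "s' \<in> S" for s'
    unfolding R_def
  proof (rule Cons.IH)
    show "indep_vars (\<lambda>_. count_space UNIV) X (set vs)"
      by (rule indep_vars_subset[OF X]) auto
  qed (use g p vs that in auto)
  have "(\<integral>\<omega>. mean (process (\<lambda>v. g v (X v \<omega>)) (v # vs) s) h \<partial>M) =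
      (\<integral>\<omega>. (\<Sum>s'\<in>S. pmf (g v (X v \<omega>) s) s' * R s' (\<lambda>w. X w \<omega>)) \<partial>M)"
  proof (rule Bochner_Integration.integral_cong[OF refl])
    fix \<omega>
    have sg: "set_pmf (g v (X v \<omega>) s) \<subseteq> S" using g s by auto
    have "mean (process (\<lambda>v. g v (X v \<omega>)) (v # vs) s) h =
      mean (g v (X v \<omega>) s) (\<lambda>s'. R s' (\<lambda>w. X w \<omega>))"
      unfolding process.simps R_def
    proof (rule expectation_bind_pmf[OF S])
      show "set_pmf (process (\<lambda>v. g v (X v \<omega>)) vs s') \<subseteq> S" if "s' \<in> set_pmf (g v (X v \<omega>) s)" for s'
        by (rule gS) (use sg that in auto)
    qed
    then show "mean (process (\<lambda>v. g v (X v \<omega>)) (v # vs) s) h =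
      (\<Sum>s'\<in>S. pmf (g v (X v \<omega>) s) s' * R s' (\<lambda>w. X w \<omega>))"
      unfolding expectation_finite_support[OF S sg] .
  qed
  also have "\<dots> = (\<Sum>s'\<in>S. \<integral>\<omega>. pmf (g v (X v \<omega>) s) s' * R s' (\<lambda>w. X w \<omega>) \<partial>M)"
    by (rule Bochner_Integration.integral_sum) (rule int)
  also have "\<dots> = (\<Sum>s'\<in>S. pmf (bind_pmf (p v) (\<lambda>n. g v n s)) s' *
      mean (process (\<lambda>v s. bind_pmf (p v) (\<lambda>n. g v n s)) vs s') h)"
    by (rule sum.cong) (simp_all add: prod marg IH)
  also have "\<dots> = mean (process (\<lambda>v s. bind_pmf (p v) (\<lambda>n. g v n s)) (v # vs) s) h"
    unfolding process.simps expectation_finite_support[OF S sup, symmetric]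
  proof (rule expectation_bind_pmf[OF S, symmetric])
    show "set_pmf (process (\<lambda>v s. bind_pmf (p v) (\<lambda>n. g v n s)) vs s') \<subseteq> S"
      if "s' \<in> set_pmf (bind_pmf (p v) (\<lambda>n. g v n s))" for s'
      by (rule sub') (use sup that in auto)
  qed
  finally show ?case .
qed

lemma process_bind_poisson_eq_cell_kernel:
  "process (\<lambda>(k, i) s. bind_pmf (poisson_pmf (l i * h)) (\<lambda>n. process (\<lambda>_. F i k) (replicate n ()) s))
    (concat (map (\<lambda>k. map (Pair k) ks) xs)) s =
   process (\<lambda>k. cell_kernel l ks h (\<lambda>i. F i k)) xs s"
  unfolding process_concat process_map[of _ "\<lambda>k. map (Pair k) ks"]
proof (rule process_cong[OF refl])
  fix k s
  show "process (\<lambda>(k, i) s. bind_pmf (poisson_pmf (l i * h)) (\<lambda>n. process (\<lambda>_. F i k) (replicate n ()) s))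
    (map (Pair k) ks) s = cell_kernel l ks h (\<lambda>i. F i k) s"
    unfolding cell_kernel_def process_map by (simp add: poisson_kernel_def[abs_def])
qed

lemma eventually_separated:
  assumes "finite U" and N: "filterlim N at_top sequentially"
  shows "\<forall>\<^sub>F n :: nat in sequentially. \<forall>t\<in>U. \<forall>t'\<in>U. t \<noteq> t' \<longrightarrow> 1 / real (N n) < \<bar>t - t' :: real\<bar>"
proof -
  have "\<forall>\<^sub>F n in sequentially. t \<noteq> t' \<longrightarrow> 1 / real (N n) < \<bar>t - t' :: real\<bar>" for t t'
  proof (cases "t = t'")
    case False
    have "filterlim (\<lambda>n. real (N n)) at_top sequentially"
      by (rule filterlim_compose[OF filterlim_real_sequentially N])
    then have "(\<lambda>n. 1 / real (N n)) \<longlonglongrightarrow> 0"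
      by (intro real_tendsto_divide_at_top) auto
    then have "\<forall>\<^sub>F n in sequentially. 1 / real (N n) < \<bar>t - t'\<bar>"
      by (rule order_tendstoD) (use False in auto)
    then show ?thesis by simp
  qed simp
  then show ?thesis
    using assms(1) by (intro eventually_ball_finite ballI)
qed

locale poisson_types = prob_space M for M :: "'w measure" +
  fixes ks :: "'i list" and l :: "'i \<Rightarrow> real" and A :: "'i \<Rightarrow> 'w \<Rightarrow> real set"
  assumes distinct_types: "distinct ks"
    and rate_pos: "\<And>i. i \<in> set ks \<Longrightarrow> 0 < l i"
    and poisson: "\<And>i. i \<in> set ks \<Longrightarrow> poisson_process M (l i) (A i)"
    and indep: "indep_sets (\<lambda>i. process_algebra M (A i)) (set ks)"
begin

lemma finite_arrivals: "i \<in> set ks \<Longrightarrow> \<omega> \<in> space M \<Longrightarrow> finite (A i \<omega>)"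
  and arrivals_subset: "i \<in> set ks \<Longrightarrow> \<omega> \<in> space M \<Longrightarrow> A i \<omega> \<subseteq> {0<..1}"
  using poisson unfolding poisson_process_def by blast+

definition cell_count :: "nat \<Rightarrow> nat \<times> 'i \<Rightarrow> 'w \<Rightarrow> nat" where
  "cell_count N = (\<lambda>(k, i). arrival_count (A i) (real k / real N) (real (Suc k) / real N))"

lemma cell_bounds:
  assumes "k < N"
  shows "0 \<le> real k / real N" "real k / real N < real (Suc k) / real N" "real (Suc k) / real N \<le> 1"
  using assms by (auto simp: divide_simps)

lemma cell_count_measurable:
  assumes "k < N" "i \<in> set ks"
  shows "cell_count N (k, i) \<in> measurable M (count_space UNIV)"
  using poisson[OF assms(2)] cell_bounds[OF assms(1)] unfolding poisson_process_def cell_count_def by auto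

lemma cell_count_distr:
  assumes "k < N" "i \<in> set ks"
  shows "distr M (count_space UNIV) (cell_count N (k, i)) = measure_pmf (poisson_pmf (l i * (1 / real N)))"
proof -
  have "distr M (count_space UNIV) (cell_count N (k, i)) =
      measure_pmf (poisson_pmf (l i * (real (Suc k) / real N - real k / real N)))"
    using poisson[OF assms(2)] cell_bounds[OF assms(1)] unfolding poisson_process_def cell_count_def by auto
  also have "real (Suc k) / real N - real k / real N = 1 / real N"
    by (simp add: diff_divide_distrib[symmetric])
  finally show ?thesis .
qed

lemma cell_counts_indep_single:
  assumes N: "0 < N" and i: "i \<in> set ks"
  shows "indep_vars (\<lambda>_. count_space UNIV) (\<lambda>k. cell_count N (k, i)) {..<N}"
proof -
  define \<tau> where "\<tau> k = min 1 (real k / real N)" for k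
  have "mono \<tau>"
    unfolding \<tau>_def using N by (intro monoI min.mono) (auto simp: divide_right_mono)
  then have "indep_vars (\<lambda>_. count_space UNIV) (\<lambda>k. arrival_count (A i) (\<tau> k) (\<tau> (Suc k))) {..<N}"
  proof -
    have "mono \<tau> \<and> 0 \<le> \<tau> 0 \<and> \<tau> N \<le> 1"
      using \<open>mono \<tau>\<close> by (simp add: \<tau>_def)
    then show ?thesis
      using poisson[OF i] unfolding poisson_process_def by blast
  qed
  moreover have "arrival_count (A i) (\<tau> k) (\<tau> (Suc k)) = cell_count N (k, i)" if "k < N" for k
    using cell_bounds[OF that] by (simp add: \<tau>_def cell_count_def min_def)
  ultimately show ?thesis
    by (subst indep_vars_cong[where I = "{..<N}" and J = "{..<N}" and M' = "\<lambda>_. count_space UNIV" and N' = "\<lambda>_. count_space UNIV"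
        and Y = "\<lambda>k. arrival_count (A i) (\<tau> k) (\<tau> (Suc k))"]) auto
qed

lemma sigma_algebra_process_algebra: "sigma_algebra (space M) (process_algebra M (A i))"
  unfolding process_algebra_def by (rule sigma_algebra_sigma_sets) auto

lemma cell_count_vimage_in_process_algebra:
  assumes "k < N"
  shows "cell_count N (k, i) -` B \<inter> space M \<in> process_algebra M (A i)"
proof -
  interpret sigma_algebra "space M" "process_algebra M (A i)"
    by (rule sigma_algebra_process_algebra)
  have "cell_count N (k, i) -` B \<inter> space M = (\<Union>n\<in>B. {\<omega> \<in> space M. cell_count N (k, i) \<omega> = n})"
    by auto
  also have "\<dots> \<in> process_algebra M (A i)"
  proof (rule countable_UN'')
    fix n
    have "{\<omega> \<in> space M. arrival_count (A i) (real k / real N) (real (Suc k) / real N) \<omega> = n}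
      \<in> {{\<omega> \<in> space M. arrival_count (A i) s t \<omega> = n} | s t n. 0 \<le> s \<and> s \<le> t \<and> t \<le> 1}"
      using cell_bounds[OF assms] by (blast intro: less_imp_le)
    then show "{\<omega> \<in> space M. cell_count N (k, i) \<omega> = n} \<in> process_algebra M (A i)"
      unfolding cell_count_def process_algebra_def by (auto intro: sigma_sets.Basic)
  qed auto
  finally show ?thesis .
qed

lemma cell_counts_indep:
  assumes N: "0 < N"
  shows "indep_vars (\<lambda>_. count_space UNIV) (cell_count N) ({..<N} \<times> set ks)"
  unfolding indep_vars_def2
proof (intro conjI ballI indep_setsI)
  fix v assume "v \<in> {..<N} \<times> set ks"
  then show rv: "random_variable (count_space UNIV) (cell_count N v)"
    using cell_count_measurable by auto
  then show "{cell_count N v -` B \<inter> space M |B. B \<in> sets (count_space UNIV)} \<subseteq> events"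
    by (auto intro: measurable_sets)
next
  fix E J
  assume J: "J \<noteq> {}" "J \<subseteq> {..<N} \<times> set ks" "finite J"
    and E: "\<forall>j\<in>J. E j \<in> {cell_count N j -` B \<inter> space M |B. B \<in> sets (count_space UNIV)}"
  define Jk where "Jk i = {k. (k, i) \<in> J}" for i
  have Jk: "Jk i \<subseteq> {..<N}" "finite (Jk i)" for i
    using J unfolding Jk_def by (auto intro: finite_subset[of _ "{..<N}"])
  have JS: "J = (\<lambda>(i, k). (k, i)) ` (SIGMA i:snd ` J. Jk i)"
    unfolding Jk_def by force
  have I: "snd ` J \<subseteq> set ks" "snd ` J \<noteq> {}" "finite (snd ` J)"
    using J by auto
  have ne: "Jk i \<noteq> {}" if "i \<in> snd ` J" for i
    using that unfolding Jk_def by auto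
  have inner: "prob (\<Inter>k\<in>Jk i. E (k, i)) = (\<Prod>k\<in>Jk i. prob (E (k, i)))" if i: "i \<in> snd ` J" for i
  proof (rule indep_setsD)
    show "indep_sets (\<lambda>k. {cell_count N (k, i) -` B \<inter> space M |B. B \<in> sets (count_space UNIV)}) {..<N}"
      using cell_counts_indep_single[OF N, of i] i I unfolding indep_vars_def2 by auto
  qed (use Jk ne[OF i] E in \<open>auto simp: Jk_def\<close>)
  have alg: "(\<Inter>k\<in>Jk i. E (k, i)) \<in> process_algebra M (A i)" if i: "i \<in> snd ` J" for i
  proof -
    interpret sigma_algebra "space M" "process_algebra M (A i)"
      by (rule sigma_algebra_process_algebra)
    show ?thesis
    proof (rule finite_INT[OF Jk(2) ne[OF i]])
      fix k assume "k \<in> Jk i"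
      then have "(k, i) \<in> J" "k < N"
        using J(2) by (auto simp: Jk_def)
      then show "E (k, i) \<in> process_algebra M (A i)"
        using E cell_count_vimage_in_process_algebra[of k N i] by force
    qed
  qed
  have "(\<Inter>j\<in>J. E j) = (\<Inter>i\<in>snd ` J. \<Inter>k\<in>Jk i. E (k, i))"
    unfolding Jk_def by force
  then have "prob (\<Inter>j\<in>J. E j) = prob (\<Inter>i\<in>snd ` J. \<Inter>k\<in>Jk i. E (k, i))"
    by simp
  also have "\<dots> = (\<Prod>i\<in>snd ` J. prob (\<Inter>k\<in>Jk i. E (k, i)))"
    by (rule indep_setsD[OF indep]) (use I alg in auto)
  also have "\<dots> = (\<Prod>i\<in>snd ` J. \<Prod>k\<in>Jk i. prob (E (k, i)))"
    by (rule prod.cong) (auto simp: inner)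
  also have "\<dots> = (\<Prod>(i, k)\<in>(SIGMA i:snd ` J. Jk i). prob (E (k, i)))"
    by (rule prod.Sigma) (use I Jk in auto)
  also have "\<dots> = (\<Prod>j\<in>J. prob (E j))"
  proof -
    have "(\<Prod>j\<in>(\<lambda>(i, k). (k, i)) ` (SIGMA i:snd ` J. Jk i). prob (E j)) =
        (\<Prod>(i, k)\<in>(SIGMA i:snd ` J. Jk i). prob (E (k, i)))"
      by (subst prod.reindex) (auto simp: inj_on_def intro!: prod.cong)
    then show ?thesis
      unfolding JS[symmetric] by simp
  qed
  finally show "prob (\<Inter>j\<in>J. E j) = (\<Prod>j\<in>J. prob (E j))" .
qed

definition discretized :: "('i \<Rightarrow> real \<Rightarrow> 's \<Rightarrow> 's pmf) \<Rightarrow> nat \<Rightarrow> 's \<Rightarrow> ('s \<Rightarrow> real) \<Rightarrow> 'w \<Rightarrow> real" where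
  "discretized K N s h \<omega> = mean
    (process (\<lambda>v s. process (\<lambda>_. K (snd v) (real (Suc (fst v)) / real N)) (replicate (cell_count N v \<omega>) ()) s)
      (concat (map (\<lambda>k. map (Pair k) ks) [0..<N])) s) h"

lemma discretized_measurable: "discretized K N s h \<in> borel_measurable M"
proof -
  let ?vs = "concat (map (\<lambda>k. map (Pair k) ks) [0..<N])"
  define R where "R c = mean
    (process (\<lambda>v s. process (\<lambda>_. K (snd v) (real (Suc (fst v)) / real N)) (replicate (c v) ()) s) ?vs s) h" for c
  have "discretized K N s h = R \<circ> (\<lambda>\<omega>. \<lambda>v\<in>{..<N} \<times> set ks. cell_count N v \<omega>)"
    unfolding discretized_def R_def comp_def
    by (intro ext arg_cong[where f = "\<lambda>q. mean q h"] process_cong refl) auto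
  moreover have "(\<lambda>\<omega>. \<lambda>v\<in>{..<N} \<times> set ks. cell_count N v \<omega>) \<in>
      measurable M (PiM ({..<N} \<times> set ks) (\<lambda>_. count_space UNIV))"
    by (rule measurable_restrict) (use cell_count_measurable in auto)
  moreover have "R \<in> borel_measurable (PiM ({..<N} \<times> set ks) (\<lambda>_. count_space UNIV))"
    by (rule borel_measurable_PiM_nat) auto
  ultimately show ?thesis
    using measurable_comp by metis
qed

lemma integral_discretized:
  assumes S: "finite S" and K: "\<And>i t s. i \<in> set ks \<Longrightarrow> s \<in> S \<Longrightarrow> set_pmf (K i t s) \<subseteq> S"
    and s: "s \<in> S" and N: "0 < N"
  shows "(\<integral>\<omega>. discretized K N s h \<omega> \<partial>M) = mean
    (process (\<lambda>k. cell_kernel l ks (1 / real N) (\<lambda>i. K i (real (Suc k) / real N))) [0..<N] s) h"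
proof -
  let ?vs = "concat (map (\<lambda>k. map (Pair k) ks) [0..<N])"
  define g where "g v n s = process (\<lambda>_. K (snd v) (real (Suc (fst v)) / real N)) (replicate n ()) s" for v n s
  have vs: "set ?vs = {..<N} \<times> set ks" by auto
  have "(\<integral>\<omega>. mean (process (\<lambda>v. g v (cell_count N v \<omega>)) ?vs s) h \<partial>M) =
    mean (process (\<lambda>v s. bind_pmf (poisson_pmf (l (snd v) * (1 / real N))) (\<lambda>n. g v n s)) ?vs s) h"
  proof (rule expectation_process_indep[OF S])
    show "set_pmf (g v n s) \<subseteq> S" if "v \<in> set ?vs" "s \<in> S" for v n s
      unfolding g_def
    proof (rule set_pmf_process[OF _ that(2)])
      show "set_pmf (K (snd v) (real (Suc (fst v)) / real N) t) \<subseteq> S" if "t \<in> S" for t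
        by (rule K) (use that \<open>v \<in> set ?vs\<close> in auto)
    qed
    show "indep_vars (\<lambda>_. count_space UNIV) (cell_count N) (set ?vs)"
      unfolding vs by (rule cell_counts_indep[OF N])
    show "distr M (count_space UNIV) (cell_count N v) = measure_pmf (poisson_pmf (l (snd v) * (1 / real N)))"
      if "v \<in> set ?vs" for v
      using that cell_count_distr unfolding vs by (cases v) auto
    show "distinct ?vs"
    proof -
      have "distinct (concat (map (\<lambda>k. map (Pair k) ks) xs))" if "distinct xs" for xs :: "nat list"
        using that distinct_types by (induction xs) (auto simp: distinct_map inj_on_def)
      then show ?thesis by simp
    qed
  qed (rule s)
  then show ?thesis
    unfolding discretized_def g_def
    using process_bind_poisson_eq_cell_kernel[of l "1 / real N" "\<lambda>i k. K i (real (Suc k) / real N)" ks "[0..<N]" s]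
    by (simp add: case_prod_beta' del: map_concat)
qed

end

context poisson_types begin

definition driven :: "('i \<Rightarrow> real \<Rightarrow> 's \<Rightarrow> 's pmf) \<Rightarrow> 's \<Rightarrow> ('s \<Rightarrow> real) \<Rightarrow> 'w \<Rightarrow> real" where
  "driven K s h \<omega> = mean (process (\<lambda>(i, t). K i t)
    (sort_key snd (concat (map (\<lambda>i. map (Pair i) (sorted_list_of_set (A i \<omega>))) ks))) s) h"

lemma discretized_eventually_eq:
  assumes N: "filterlim N at_top sequentially" "\<And>n. 0 < N n"
    and K: "\<And>n i k t. i \<in> set ks \<Longrightarrow> k < N n \<Longrightarrow> real k / real (N n) < t \<Longrightarrow> t \<le> real (Suc k) / real (N n) \<Longrightarrow>
      K i t = K i (real (Suc k) / real (N n))"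
    and w: "\<omega> \<in> space M"
  shows "\<forall>\<^sub>F n in sequentially. discretized K (N n) s h \<omega> = driven K s h \<omega>"
proof -
  have "finite (\<Union>i\<in>set ks. A i \<omega>)"
    using finite_arrivals[OF _ w] by auto
  from eventually_separated[OF this N(1)] show ?thesis
  proof eventually_elim
    case (elim n)
    have eq: "sort_key snd (concat (map (\<lambda>i. map (Pair i) (sorted_list_of_set (A i \<omega>))) ks)) =
        concat (map (cell_arrivals ks (\<lambda>i. A i \<omega>) (N n)) [0..<N n])"
    proof (rule arrivals_eq_cell_arrivals[OF _ _ N(2)])
      show "1 / real (N n) < \<bar>t - t'\<bar>" if "i \<in> set ks" "i' \<in> set ks" "t \<in> A i \<omega>" "t' \<in> A i' \<omega>" "t \<noteq> t'" for t t' i i'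
        using elim that by blast
    qed (use finite_arrivals arrivals_subset w in auto)
    have "process (\<lambda>(i, t). K i t) (concat (map (cell_arrivals ks (\<lambda>i. A i \<omega>) (N n)) [0..<N n])) s =
      process (\<lambda>(k, i). \<lambda>s. process (\<lambda>_. K i (real (Suc k) / real (N n)))
        (replicate (card (A i \<omega> \<inter> cell (N n) k)) ()) s)
        (concat (map (\<lambda>k. map (Pair k) ks) [0..<N n])) s"
    proof (rule process_cell_arrivals)
      show "finite (A i \<omega>)" if "i \<in> set ks" for i
        by (rule finite_arrivals[OF that w])
    qed (rule K)
    then show ?case
      unfolding discretized_def driven_def eq
      by (simp add: cell_count_def arrival_count_def case_prod_beta')
  qed
qed

lemma
  assumes S: "finite S" and K: "\<And>i t s. i \<in> set ks \<Longrightarrow> s \<in> S \<Longrightarrow> set_pmf (K i t s) \<subseteq> S" and s: "s \<in> S"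
    and N: "filterlim N at_top sequentially" "\<And>n. 0 < N n"
    and step: "\<And>n i k t. i \<in> set ks \<Longrightarrow> k < N n \<Longrightarrow> real k / real (N n) < t \<Longrightarrow> t \<le> real (Suc k) / real (N n) \<Longrightarrow>
      K i t = K i (real (Suc k) / real (N n))"
  shows integrable_driven: "integrable M (driven K s h)"
    and discretized_chain_tendsto: "(\<lambda>n. mean (process (\<lambda>k. cell_kernel l ks (1 / real (N n))
      (\<lambda>i. K i (real (Suc k) / real (N n)))) [0..<N n] s) h) \<longlonglongrightarrow> (\<integral>\<omega>. driven K s h \<omega> \<partial>M)"
proof -
  obtain B where B: "\<And>s. s \<in> S \<Longrightarrow> \<bar>h s\<bar> \<le> B"
    using S by (meson finite_imageI bdd_above_finite bdd_above.unfold imageI finite_surj)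
  have lim: "(\<lambda>n. discretized K (N n) s h \<omega>) \<longlonglongrightarrow> driven K s h \<omega>" if "\<omega> \<in> space M" for \<omega>
    by (rule tendsto_eventually) (rule discretized_eventually_eq[where N = N and K = K, OF N _ that], rule step)
  have m: "driven K s h \<in> borel_measurable M"
    by (rule borel_measurable_LIMSEQ_real[of M "\<lambda>n. discretized K (N n) s h"])
      (rule lim, assumption, rule discretized_measurable)
  have b: "\<bar>driven K s h \<omega>\<bar> \<le> B" if "\<omega> \<in> space M" for \<omega>
    unfolding driven_def
  proof (rule expectation_abs_le[OF S set_pmf_process[OF _ s] B])
    have fin: "finite (A i \<omega>)" if "i \<in> set ks" for i
      by (rule finite_arrivals) fact+
    show "set_pmf ((case a of (i, t) \<Rightarrow> K i t) s') \<subseteq> S"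
      if "a \<in> set (sort_key snd (concat (map (\<lambda>i. map (Pair i) (sorted_list_of_set (A i \<omega>))) ks)))" "s' \<in> S" for a s'
      using that K by auto
  qed
  have bd: "\<bar>discretized K N' s h \<omega>\<bar> \<le> B" for N' \<omega>
    unfolding discretized_def
  proof (rule expectation_abs_le[OF S set_pmf_process[OF _ s] B])
    show "set_pmf (process (\<lambda>_. K (snd v) (real (Suc (fst v)) / real N')) (replicate (cell_count N' v \<omega>) ()) s') \<subseteq> S"
      if "v \<in> set (concat (map (\<lambda>k. map (Pair k) ks) [0..<N']))" "s' \<in> S" for v s'
    proof (rule set_pmf_process[OF _ that(2)])
      show "set_pmf (K (snd v) (real (Suc (fst v)) / real N') t) \<subseteq> S" if "t \<in> S" for t
        by (rule K) (use that \<open>v \<in> _\<close> in auto)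
    qed
  qed
  show "integrable M (driven K s h)"
    by (rule integrable_const_bound[where B = B]) (use m b in auto)
  have "(\<lambda>n. \<integral>\<omega>. discretized K (N n) s h \<omega> \<partial>M) \<longlonglongrightarrow> (\<integral>\<omega>. driven K s h \<omega> \<partial>M)"
    by (rule integral_dominated_convergence[where w = "\<lambda>_. B"])
      (use m lim discretized_measurable bd in auto)
  then show "(\<lambda>n. mean (process (\<lambda>k. cell_kernel l ks (1 / real (N n))
      (\<lambda>i. K i (real (Suc k) / real (N n)))) [0..<N n] s) h) \<longlonglongrightarrow> (\<integral>\<omega>. driven K s h \<omega> \<partial>M)"
    using integral_discretized[where K = K, OF S K s N(2)] by simp
qed

end

section \<open>Proposal rates and value functions\<close>

locale two_class =
  fixes H :: "('r, 'j) osm" and x :: "'r \<Rightarrow> 'j \<Rightarrow> real"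
  assumes valid: "valid_osm H" and two_class: "two_class_matching H x"
begin

lemma finite_on_types: "finite (on_types H)"
  and finite_offline: "finite (offline H)"
  and finite_edges: "finite (edges H)"
  and rate_pos: "r \<in> on_types H \<Longrightarrow> 0 < rate H r"
  using valid finite_subset[of "edges H" "on_types H \<times> offline H"] unfolding valid_osm_def by auto

lemma x_cases: "r \<in> on_types H \<Longrightarrow> j \<in> offline H \<Longrightarrow> x r j = 0 \<or> x r j = rate H r / 2 \<or> x r j = rate H r"
  and sum_row: "r \<in> on_types H \<Longrightarrow> (\<Sum>j\<in>offline H. x r j) = rate H r"
  and sum_col: "j \<in> offline H \<Longrightarrow> (\<Sum>r\<in>on_types H. x r j) = 1"
  and x_off_edges: "(r, j) \<notin> edges H \<Longrightarrow> x r j = 0"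
  and first_class_load: "j \<in> offline H \<Longrightarrow> (\<Sum>r\<in>first_class_types H x. x r j) \<le> 1 - ln 2"
  using two_class unfolding two_class_matching_def by auto

lemma edges_subset: "edges H \<subseteq> on_types H \<times> offline H"
  using valid unfolding valid_osm_def by auto

lemma x_nonneg: "0 \<le> x r j"
proof (cases "(r, j) \<in> edges H")
  case True
  then have "r \<in> on_types H" "j \<in> offline H" using edges_subset by auto
  then show ?thesis using x_cases[of r j] rate_pos[of r] by auto
qed (simp add: x_off_edges)

lemma finite_neighbors: "finite (neighbors H x r)"
  using finite_offline unfolding neighbors_def by simp

lemma neighbors_first_class:
  assumes "r \<in> first_class_types H x"
  shows "\<exists>j. neighbors H x r = {j} \<and> j \<in> offline H \<and> x r j = rate H r"
proof -
  obtain j where j: "r \<in> on_types H" "j \<in> offline H" "x r j = rate H r"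
    using assms unfolding first_class_types_def by auto
  have "(\<Sum>k\<in>offline H - {j}. x r k) = 0"
    using sum_row[OF j(1)] j finite_offline by (simp add: sum_diff1)
  then have "\<forall>k\<in>offline H - {j}. x r k = 0"
    using finite_offline x_nonneg by (simp add: sum_nonneg_eq_0_iff)
  then have "neighbors H x r = {j}"
    unfolding neighbors_def using j rate_pos[OF j(1)] by force
  then show ?thesis using j by blast
qed

lemma neighbors_second_class:
  assumes r: "r \<in> on_types H" "r \<notin> first_class_types H x"
  shows "card (neighbors H x r) = 2" "j \<in> neighbors H x r \<Longrightarrow> x r j = rate H r / 2"
proof -
  have half: "x r j = rate H r / 2" if "j \<in> neighbors H x r" for j
    using that x_cases[OF r(1), of j] r unfolding neighbors_def first_class_types_def by auto
  have "rate H r = (\<Sum>j\<in>neighbors H x r. x r j)"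
    unfolding sum_row[OF r(1), symmetric] neighbors_def
    by (rule sum.mono_neutral_right) (use finite_offline x_nonneg in \<open>auto simp: not_less intro: antisym\<close>)
  also have "\<dots> = real (card (neighbors H x r)) * (rate H r / 2)"
    by (simp only: sum.cong[OF refl half] sum_constant)
  finally show "card (neighbors H x r) = 2"
    using rate_pos[OF r(1)] by (simp add: field_simps)
  show "j \<in> neighbors H x r \<Longrightarrow> x r j = rate H r / 2" by (rule half)
qed

lemma neighbors_nonempty:
  assumes "r \<in> on_types H"
  shows "neighbors H x r \<noteq> {}"
  using neighbors_first_class[of r] neighbors_second_class(1)[OF assms] by (cases "r \<in> first_class_types H x") auto

lemma neighbors_edges: "j \<in> neighbors H x r \<Longrightarrow> (r, j) \<in> edges H"
  using x_off_edges[of r j] unfolding neighbors_def by (auto intro: ccontr)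

lemma not_neighbor: "j \<in> offline H \<Longrightarrow> j \<notin> neighbors H x r \<Longrightarrow> x r j = 0"
  using x_nonneg[of r j] unfolding neighbors_def by auto

lemma neighbors_subset: "neighbors H x r \<subseteq> offline H"
  unfolding neighbors_def by auto

definition early_rate :: "'r \<Rightarrow> 'j \<Rightarrow> real" where
  "early_rate r j = (if r \<in> first_class_types H x then x r j else 0)"

definition late_rate :: "('r \<times> 'j) set \<Rightarrow> 'r \<Rightarrow> 'j \<Rightarrow> real" where
  "late_rate m1 r j =
    (if r \<in> first_class_types H x \<or> card (neighbors H x r - snd ` m1) \<noteq> 1 then x r j
     else if j \<in> neighbors H x r - snd ` m1 then rate H r else 0)"

definition generator :: "('r \<Rightarrow> 'j \<Rightarrow> real) \<Rightarrow> (('r \<times> 'j) set \<Rightarrow> real) \<Rightarrow> ('r \<times> 'j) set \<Rightarrow> real" where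
  "generator a g m = (\<Sum>r\<in>on_types H. \<Sum>j\<in>offline H. a r j * (g (try_match r j m) - g m))"

lemma generator_term_single:
  fixes a :: "'r \<Rightarrow> 'j \<Rightarrow> real"
  assumes "j \<in> offline H" "\<And>k. k \<in> offline H \<Longrightarrow> k \<noteq> j \<Longrightarrow> a r k = 0"
  shows "(\<Sum>k\<in>offline H. a r k * (g (try_match r k m) - g m)) = a r j * (g (try_match r j m) - g m)"
proof -
  have "(\<Sum>k\<in>offline H. a r k * (g (try_match r k m) - g m)) =
      (\<Sum>k\<in>{j}. a r k * (g (try_match r k m) - g m))"
  proof (rule sum.mono_neutral_right)
    show "\<forall>k\<in>offline H - {j}. a r k * (g (try_match r k m) - g m) = 0"
      using assms(2) by simp
  qed (use finite_offline assms(1) in auto)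
  then show ?thesis by simp
qed

lemma first_class_match_term:
  assumes "r \<in> first_class_types H x"
  shows "rate H r * (g (try_match r (the_elem (neighbors H x r)) m) - g m) =
    (\<Sum>j\<in>offline H. x r j * (g (try_match r j m) - g m))"
proof -
  obtain j where j: "neighbors H x r = {j}" "j \<in> offline H" "x r j = rate H r"
    using neighbors_first_class[OF assms] by blast
  have "x r k = 0" if "k \<in> offline H" "k \<noteq> j" for k
    using not_neighbor[OF that(1), of r] j that by auto
  then show ?thesis
    using generator_term_single[OF j(2), of x r g m] j by simp
qed

lemma suggest_term:
  fixes g :: "('r \<times> 'j) set \<Rightarrow> real"
  assumes "r \<in> on_types H" "r \<notin> first_class_types H x"
  shows "rate H r * (mean (suggest H x r m) g - g m) =
    (\<Sum>j\<in>offline H. x r j * (g (try_match r j m) - g m))"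
proof -
  have "mean (suggest H x r m) g = (\<Sum>j\<in>neighbors H x r. g (try_match r j m)) / 2"
    unfolding suggest_def using neighbors_second_class(1)[OF assms] neighbors_nonempty[OF assms(1)] finite_neighbors
    by (simp add: integral_pmf_of_set)
  then have "rate H r * (mean (suggest H x r m) g - g m) =
      rate H r / 2 * (\<Sum>j\<in>neighbors H x r. g (try_match r j m) - g m)"
    using neighbors_second_class(1)[OF assms] by (simp add: sum_subtractf field_simps)
  also have "\<dots> = (\<Sum>j\<in>neighbors H x r. x r j * (g (try_match r j m) - g m))"
    unfolding sum_distrib_left
    by (rule sum.cong[OF refl]) (simp only: neighbors_second_class(2)[OF assms])
  also have "\<dots> = (\<Sum>j\<in>offline H. x r j * (g (try_match r j m) - g m))"
    by (rule sum.mono_neutral_left) (use finite_offline neighbors_subset not_neighbor in auto)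
  finally show ?thesis .
qed

lemma generator_serve_early:
  fixes g :: "('r \<times> 'j) set \<Rightarrow> real"
  shows "(\<Sum>r\<in>on_types H. rate H r * (mean (serve_early t0 H x t r m) g - g m)) =
    generator (if t \<le> t0 then early_rate else x) g m"
  unfolding generator_def
proof (rule sum.cong[OF refl])
  fix r assume "r \<in> on_types H"
  then show "rate H r * (mean (serve_early t0 H x t r m) g - g m) =
      (\<Sum>j\<in>offline H. (if t \<le> t0 then early_rate else x) r j * (g (try_match r j m) - g m))"
    by (auto simp: serve_early_def early_rate_def first_class_match_term suggest_term)
qed

lemma generator_serve_late:
  fixes g :: "('r \<times> 'j) set \<Rightarrow> real"
  shows "(\<Sum>r\<in>on_types H. rate H r * (mean (serve_late m1 H x r m) g - g m)) =
    generator (late_rate m1) g m"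
  unfolding generator_def
proof (rule sum.cong[OF refl])
  fix r assume r: "r \<in> on_types H"
  show "rate H r * (mean (serve_late m1 H x r m) g - g m) =
      (\<Sum>j\<in>offline H. late_rate m1 r j * (g (try_match r j m) - g m))"
  proof (cases "r \<notin> first_class_types H x \<and> card (neighbors H x r - snd ` m1) = 1")
    case True
    then obtain j where j: "neighbors H x r - snd ` m1 = {j}"
      using card_1_singletonE by blast
    then have jo: "j \<in> offline H" using neighbors_subset by blast
    have "late_rate m1 r k = 0" if "k \<noteq> j" for k
      unfolding late_rate_def using True j that by simp
    then have "(\<Sum>k\<in>offline H. late_rate m1 r k * (g (try_match r k m) - g m)) =
        late_rate m1 r j * (g (try_match r j m) - g m)"
      by (intro generator_term_single[OF jo]) auto
    moreover have "late_rate m1 r j = rate H r"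
      unfolding late_rate_def using True j by auto
    ultimately show ?thesis
      using True j by (simp add: serve_late_def)
  next
    case False
    then show ?thesis
      using r by (auto simp: serve_late_def late_rate_def first_class_match_term suggest_term)
  qed
qed

definition free :: "'j set \<Rightarrow> ('r \<times> 'j) set \<Rightarrow> real" where
  "free S m = of_bool (S \<inter> snd ` m = {})"

definition matched :: "'r \<Rightarrow> 'j \<Rightarrow> ('r \<times> 'j) set \<Rightarrow> real" where
  "matched r j m = of_bool ((r, j) \<in> m)"

lemma free_try_match: "free S (try_match r j m) = free S m * of_bool (j \<notin> S)"
  unfolding free_def try_match_def by auto

lemma matched_try_match: "matched r0 j0 (try_match r j m) = matched r0 j0 m + of_bool (r = r0 \<and> j = j0) * free {j0} m"
  unfolding matched_def free_def try_match_def by force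

lemma generator_add: "generator a (\<lambda>m. f m + g m) m = generator a f m + generator a g m"
  unfolding generator_def by (simp add: sum.distrib[symmetric] algebra_simps)

lemma generator_cmult: "generator a (\<lambda>m. c * g m) m = c * generator a g m"
  unfolding generator_def by (simp add: sum_distrib_left algebra_simps)

lemma generator_sum: "generator a (\<lambda>m. \<Sum>i\<in>I. g i m) m = (\<Sum>i\<in>I. generator a (g i) m)"
proof -
  have "generator a (\<lambda>m. \<Sum>i\<in>I. g i m) m =
      (\<Sum>r\<in>on_types H. \<Sum>j\<in>offline H. \<Sum>i\<in>I. a r j * (g i (try_match r j m) - g i m))"
    unfolding generator_def by (simp add: sum_subtractf[symmetric] sum_distrib_left)
  also have "\<dots> = (\<Sum>i\<in>I. \<Sum>r\<in>on_types H. \<Sum>j\<in>offline H. a r j * (g i (try_match r j m) - g i m))"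
    by (subst sum.swap, subst (2) sum.swap, subst sum.swap) (simp add: sum.swap[of _ I])
  finally show ?thesis unfolding generator_def .
qed

lemma generator_free:
  assumes "S \<subseteq> offline H"
  shows "generator a (free S) m = - free S m * (\<Sum>j\<in>S. \<Sum>r\<in>on_types H. a r j)"
proof -
  have "generator a (free S) m = (\<Sum>r\<in>on_types H. \<Sum>j\<in>offline H. - free S m * (of_bool (j \<in> S) * a r j))"
    unfolding generator_def free_try_match by (intro sum.cong refl) auto
  also have "\<dots> = - free S m * (\<Sum>r\<in>on_types H. \<Sum>j\<in>offline H. of_bool (j \<in> S) * a r j)"
    by (simp add: sum_distrib_left sum_negf)
  also have "(\<Sum>r\<in>on_types H. \<Sum>j\<in>offline H. of_bool (j \<in> S) * a r j) = (\<Sum>r\<in>on_types H. \<Sum>j\<in>S. a r j)"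
  proof (rule sum.cong[OF refl])
    fix r
    have "(\<Sum>j\<in>offline H. of_bool (j \<in> S) * a r j) = (\<Sum>j\<in>S. of_bool (j \<in> S) * a r j)"
      by (rule sum.mono_neutral_right) (use finite_offline assms in auto)
    then show "(\<Sum>j\<in>offline H. of_bool (j \<in> S) * a r j) = (\<Sum>j\<in>S. a r j)" by simp
  qed
  finally show ?thesis by (simp add: sum.swap[of _ S])
qed

lemma generator_matched:
  assumes "r0 \<in> on_types H" "j0 \<in> offline H"
  shows "generator a (matched r0 j0) m = a r0 j0 * free {j0} m"
proof -
  have "generator a (matched r0 j0) m =
      (\<Sum>r\<in>on_types H. \<Sum>j\<in>offline H. if r = r0 then if j = j0 then a r j * free {j0} m else 0 else 0)"
    unfolding generator_def matched_try_match by (intro sum.cong refl) auto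
  also have "\<dots> = (\<Sum>r\<in>on_types H. if r = r0 then a r0 j0 * free {j0} m else 0)"
    using finite_offline assms(2) by (intro sum.cong refl) auto
  also have "\<dots> = a r0 j0 * free {j0} m"
    using finite_on_types assms(1) by simp
  finally show ?thesis .
qed

end

context two_class begin

lemma second_class_neighbors_pair:
  assumes r: "r \<in> on_types H" "r \<notin> first_class_types H x" and j: "j \<in> neighbors H x r"
  shows "\<exists>k. neighbors H x r = {j, k} \<and> k \<noteq> j \<and> k \<in> offline H"
proof -
  obtain a b where "neighbors H x r = {a, b}" "a \<noteq> b"
    using neighbors_second_class(1)[OF r] by (auto simp: card_2_iff)
  then show ?thesis
    using j neighbors_subset[of r] by (cases "j = a") auto
qed

definition load :: "'j \<Rightarrow> real" where
  "load j = (\<Sum>r\<in>on_types H. early_rate r j)"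

definition second_types :: "'j \<Rightarrow> 'r set" where
  "second_types j = {r \<in> on_types H. r \<notin> first_class_types H x \<and> 0 < x r j}"

definition other :: "'j \<Rightarrow> 'r \<Rightarrow> 'j" where
  "other j r = the_elem (neighbors H x r - {j})"

lemma other:
  assumes "j \<in> offline H" "r \<in> second_types j"
  shows "neighbors H x r = {j, other j r}" "other j r \<noteq> j" "other j r \<in> offline H" "x r j = rate H r / 2"
    "r \<in> on_types H" "r \<notin> first_class_types H x"
proof -
  have r: "r \<in> on_types H" "r \<notin> first_class_types H x" and j: "j \<in> neighbors H x r"
    using assms unfolding second_types_def neighbors_def by auto
  obtain k where k: "neighbors H x r = {j, k}" "k \<noteq> j" "k \<in> offline H"
    using second_class_neighbors_pair[OF r j] by blast
  then have "other j r = k"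
    unfolding other_def by (simp add: insert_Diff_if)
  then show "neighbors H x r = {j, other j r}" "other j r \<noteq> j" "other j r \<in> offline H"
    using k by auto
  show "x r j = rate H r / 2" by (rule neighbors_second_class(2)[OF r j])
  show "r \<in> on_types H" "r \<notin> first_class_types H x" by fact+
qed

lemma finite_second_types: "finite (second_types j)"
  unfolding second_types_def using finite_on_types by simp

lemma load_nonneg: "0 \<le> load j"
  unfolding load_def early_rate_def by (intro sum_nonneg) (simp add: x_nonneg)

lemma load_le:
  assumes "j \<in> offline H"
  shows "load j \<le> 1 / 3"
proof -
  have "load j = (\<Sum>r\<in>first_class_types H x. x r j)"
    unfolding load_def early_rate_def first_class_types_def
    by (rule sum.mono_neutral_cong_right) (use finite_on_types in auto)
  also have "\<dots> \<le> 1 - ln 2" by (rule first_class_load[OF assms])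
  also have "\<dots> \<le> 1 / 3" using ln2_ge_two_thirds by simp
  finally show ?thesis .
qed

lemma sum_split_first_class:
  fixes f :: "'r \<Rightarrow> real"
  assumes "\<And>r. r \<in> on_types H \<Longrightarrow> r \<notin> first_class_types H x \<Longrightarrow> x r j = 0 \<Longrightarrow> f r = 0"
    and "\<And>r. r \<in> first_class_types H x \<Longrightarrow> f r = x r j"
  shows "(\<Sum>r\<in>on_types H. f r) = load j + (\<Sum>r\<in>second_types j. f r)"
proof -
  have "(\<Sum>r\<in>on_types H. f r) = (\<Sum>r\<in>on_types H. early_rate r j + (if r \<in> second_types j then f r else 0))"
  proof (rule sum.cong[OF refl])
    fix r assume "r \<in> on_types H"
    then show "f r = early_rate r j + (if r \<in> second_types j then f r else 0)"
      using assms x_nonneg[of r j] unfolding early_rate_def second_types_def by (auto simp: less_le)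
  qed
  also have "\<dots> = load j + (\<Sum>r\<in>on_types H. if r \<in> second_types j then f r else 0)"
    unfolding load_def by (simp add: sum.distrib)
  also have "(\<Sum>r\<in>on_types H. if r \<in> second_types j then f r else 0) = (\<Sum>r\<in>second_types j. f r)"
    by (rule sum.mono_neutral_cong_right) (use finite_on_types in \<open>auto simp: second_types_def\<close>)
  finally show ?thesis .
qed

lemma sum_second_types:
  assumes "j \<in> offline H"
  shows "(\<Sum>r\<in>second_types j. x r j) = 1 - load j"
  using sum_split_first_class[of j "\<lambda>r. x r j"] sum_col[OF assms] by simp

definition conflict :: "'j \<Rightarrow> ('r \<times> 'j) set \<Rightarrow> real" where
  "conflict j m1 = (\<Sum>r\<in>second_types j. x r j * (1 - free {other j r} m1))"

lemma late_rate_second: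
  assumes "j \<in> offline H" "r \<in> second_types j" "free {j} m1 = 1"
  shows "late_rate m1 r j = x r j * (2 - free {other j r} m1)"
proof -
  note o = other[OF assms(1,2)]
  have j: "j \<notin> snd ` m1" using assms(3) unfolding free_def by (auto split: if_splits)
  show ?thesis
  proof (cases "other j r \<in> snd ` m1")
    case True
    then have n: "neighbors H x r - snd ` m1 = {j}" using o j by auto
    have "free {other j r} m1 = 0" using True unfolding free_def by auto
    then show ?thesis using n o by (simp add: late_rate_def)
  next
    case False
    then have n: "neighbors H x r - snd ` m1 = {j, other j r}" using o j by auto
    have "free {other j r} m1 = 1" using False unfolding free_def by auto
    then show ?thesis using n o by (simp add: late_rate_def)
  qed
qed

lemma late_rate_sum:
  assumes "j \<in> offline H" "free {j} m1 = 1"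
  shows "(\<Sum>r\<in>on_types H. late_rate m1 r j) = 1 + conflict j m1"
proof -
  have "(\<Sum>r\<in>on_types H. late_rate m1 r j) = load j + (\<Sum>r\<in>second_types j. late_rate m1 r j)"
  proof (rule sum_split_first_class)
    fix r assume r: "r \<in> on_types H" "r \<notin> first_class_types H x" "x r j = 0"
    then have "j \<notin> neighbors H x r" unfolding neighbors_def by auto
    then show "late_rate m1 r j = 0" using r unfolding late_rate_def by auto
  qed (simp add: late_rate_def)
  also have "(\<Sum>r\<in>second_types j. late_rate m1 r j) =
      (\<Sum>r\<in>second_types j. x r j) + conflict j m1"
    unfolding conflict_def sum.distrib[symmetric]
    by (rule sum.cong[OF refl]) (simp add: late_rate_second[OF assms(1) _ assms(2)] algebra_simps)
  finally show ?thesis using sum_second_types[OF assms(1)] by simp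
qed

lemma late_rate_nonneg: "0 \<le> late_rate m1 r j"
proof -
  have "0 \<le> rate H r" if "j \<in> neighbors H x r"
    using neighbors_edges[OF that] edges_subset rate_pos[of r] by auto
  then show ?thesis unfolding late_rate_def using x_nonneg by auto
qed

text \<open>The exact reward per unit of proposal rate is \<open>\<integral>\<^sub>0\<^sup>\<tau> exp (- (1 + Z) s) ds\<close>; \<open>late_profile\<close> replaces
  \<open>exp (- Z s)\<close> by \<open>1 - Z s\<close>.\<close>

definition late_profile :: "real \<Rightarrow> real \<Rightarrow> real" where
  "late_profile \<tau> Z = 1 - exp (- \<tau>) - Z * (1 - (1 + \<tau>) * exp (- \<tau>))"

definition late_value :: "'r \<Rightarrow> 'j \<Rightarrow> real \<Rightarrow> ('r \<times> 'j) set \<Rightarrow> ('r \<times> 'j) set \<Rightarrow> real" where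
  "late_value r0 j0 t m1 m = matched r0 j0 m +
     (free {j0} m1 * late_rate m1 r0 j0 * late_profile (1 - t) (conflict j0 m1)) * free {j0} m"

definition late_value_deriv :: "'r \<Rightarrow> 'j \<Rightarrow> real \<Rightarrow> ('r \<times> 'j) set \<Rightarrow> ('r \<times> 'j) set \<Rightarrow> real" where
  "late_value_deriv r0 j0 t m1 m = (free {j0} m1 * late_rate m1 r0 j0 *
     (- (exp (- (1 - t)) - conflict j0 m1 * ((1 - t) * exp (- (1 - t)))))) * free {j0} m"

lemma late_value_has_deriv:
  "((\<lambda>t. late_value r0 j0 t m1 m) has_real_derivative late_value_deriv r0 j0 t m1 m) (at t)"
  unfolding late_value_def late_value_deriv_def late_profile_def
  by (auto intro!: derivative_eq_intros simp: algebra_simps)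

lemma late_value_subsolution:
  assumes e: "r0 \<in> on_types H" "j0 \<in> offline H" and t: "t \<le> 1"
  shows "0 \<le> late_value_deriv r0 j0 t m1 m + generator (late_rate m1) (late_value r0 j0 t m1) m"
proof -
  define Z where "Z = conflict j0 m1"
  define \<tau> where "\<tau> = 1 - t"
  define \<rho> where "\<rho> = late_rate m1 r0 j0"
  have gen: "generator (late_rate m1) (late_value r0 j0 t m1) m = \<rho> * free {j0} m
      - (free {j0} m1 * \<rho> * late_profile \<tau> Z) * (free {j0} m * (\<Sum>r\<in>on_types H. late_rate m1 r j0))"
    unfolding late_value_def generator_add generator_cmult generator_matched[OF e]
    using generator_free[of "{j0}" "late_rate m1" m] e by (simp add: Z_def \<tau>_def \<rho>_def)
  have \<rho>: "0 \<le> \<rho>" unfolding \<rho>_def by (rule late_rate_nonneg)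
  have f: "free {j0} m \<ge> 0" unfolding free_def by simp
  show ?thesis
  proof (cases "free {j0} m1 = 1")
    case False
    then have "free {j0} m1 = 0" unfolding free_def by auto
    then show ?thesis
      unfolding gen late_value_deriv_def using \<rho> f by simp
  next
    case True
    have "late_value_deriv r0 j0 t m1 m + generator (late_rate m1) (late_value r0 j0 t m1) m =
        \<rho> * free {j0} m * (Z\<^sup>2 * (1 - (1 + \<tau>) * exp (- \<tau>)))"
      unfolding gen late_value_deriv_def late_rate_sum[OF e(2) True] late_profile_def True
        Z_def[symmetric] \<tau>_def[symmetric] \<rho>_def[symmetric]
      by (simp add: algebra_simps power2_eq_square)
    moreover have "(1 + \<tau>) * exp (- \<tau>) \<le> 1"
      using exp_ge_add_one_self[of \<tau>] by (simp add: exp_minus divide_simps)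
    ultimately show ?thesis
      using \<rho> f by simp
  qed
qed

text \<open>For an edge \<open>(r0, j0)\<close> and proposal rates \<open>a\<close>, the coefficient of each indicator \<open>free {j0, l}\<close> decays
  at the total proposal rate at \<open>j0\<close> and \<open>l\<close>, so that this part of \<open>early_value\<close> solves the backward
  equation exactly. The coefficient of \<open>free {j0}\<close> carries the reward collected up to time \<open>b\<close>.\<close>

definition early_value ::
    "('r \<Rightarrow> 'j \<Rightarrow> real) \<Rightarrow> 'r \<Rightarrow> 'j \<Rightarrow> real \<Rightarrow> (real \<Rightarrow> real) \<Rightarrow> ('r \<Rightarrow> real) \<Rightarrow> real \<Rightarrow> ('r \<times> 'j) set \<Rightarrow> real" where
  "early_value a r0 j0 b \<alpha> c t m = matched r0 j0 m + \<alpha> t * free {j0} m +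
     (\<Sum>r\<in>second_types j0. (c r * exp (- ((\<Sum>j\<in>{j0, other j0 r}. \<Sum>q\<in>on_types H. a q j) * (b - t)))) *
        free {j0, other j0 r} m)"

definition early_value_deriv ::
    "('r \<Rightarrow> 'j \<Rightarrow> real) \<Rightarrow> 'r \<Rightarrow> 'j \<Rightarrow> real \<Rightarrow> (real \<Rightarrow> real) \<Rightarrow> ('r \<Rightarrow> real) \<Rightarrow> real \<Rightarrow> ('r \<times> 'j) set \<Rightarrow> real" where
  "early_value_deriv a r0 j0 b \<alpha>' c t m = \<alpha>' t * free {j0} m +
     (\<Sum>r\<in>second_types j0. (c r * exp (- ((\<Sum>j\<in>{j0, other j0 r}. \<Sum>q\<in>on_types H. a q j) * (b - t)))
        * (\<Sum>j\<in>{j0, other j0 r}. \<Sum>q\<in>on_types H. a q j)) * free {j0, other j0 r} m)"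

lemma early_value_has_deriv:
  assumes "(\<alpha> has_real_derivative \<alpha>' t) (at t)"
  shows "((\<lambda>t. early_value a r0 j0 b \<alpha> c t m) has_real_derivative early_value_deriv a r0 j0 b \<alpha>' c t m) (at t)"
  unfolding early_value_def early_value_deriv_def
  by (rule derivative_eq_intros assms refl | simp)+ (simp only: mult.commute mult.left_commute)

lemma early_value_subsolution:
  assumes e: "r0 \<in> on_types H" "j0 \<in> offline H"
    and \<alpha>: "\<alpha> t * (\<Sum>q\<in>on_types H. a q j0) \<le> \<alpha>' t + a r0 j0"
  shows "0 \<le> early_value_deriv a r0 j0 b \<alpha>' c t m + generator a (early_value a r0 j0 b \<alpha> c t) m"
proof -
  have s: "generator a (free {j0, other j0 r}) m =
      - free {j0, other j0 r} m * (\<Sum>j\<in>{j0, other j0 r}. \<Sum>q\<in>on_types H. a q j)" if "r \<in> second_types j0" for r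
    by (rule generator_free) (use other[OF e(2) that] e in auto)
  have g0: "generator a (free {j0}) m = - free {j0} m * (\<Sum>q\<in>on_types H. a q j0)"
    using generator_free[of "{j0}" a m] e by simp
  have "early_value_deriv a r0 j0 b \<alpha>' c t m + generator a (early_value a r0 j0 b \<alpha> c t) m =
      (\<alpha>' t + a r0 j0 - \<alpha> t * (\<Sum>q\<in>on_types H. a q j0)) * free {j0} m"
    unfolding early_value_def early_value_deriv_def generator_add generator_cmult generator_sum
      generator_matched[OF e] g0
    by (simp add: s algebra_simps sum.distrib[symmetric] del: sum.insert cong: sum.cong)
  then show ?thesis
    using \<alpha> by (simp add: free_def)
qed

end

lemma exp_minus_bounds_7_10: "(4965 / 10000) \<le> exp (- 7 / 10 :: real)" "exp (- 7 / 10 :: real) \<le> (4967 / 10000)"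
proof -
  obtain t :: real where t: "\<bar>t\<bar> \<le> \<bar>- 7 / 10\<bar>"
    "exp (- 7 / 10) = (\<Sum>m<8. (- 7 / 10) ^ m / fact m) + exp t / fact 8 * (- 7 / 10) ^ 8"
    using Maclaurin_exp_le[of "- 7 / 10 :: real" 8] by blast
  have "exp t \<le> exp 1" using t(1) by simp
  then have "exp t \<le> 3" using exp_le by linarith
  then have r: "0 \<le> exp t / fact 8 * (- 7 / 10) ^ 8" "exp t / fact 8 * (- 7 / 10) ^ 8 \<le> 3 / fact 8 * (7 / 10) ^ 8"
    by (auto simp: fact_numeral)
  have s: "(\<Sum>m<8. (- 7 / 10) ^ m / fact m :: real) = 1 - 7/10 + 49/200 - 343/6000 + 2401/240000 - 16807/12000000
      + 117649/720000000 - 823543/50400000000"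
    by (simp add: numeral_eq_Suc fact_numeral)
  have R: "3 / fact 8 * (7 / 10) ^ 8 \<le> (1 / 20000 :: real)"
    by (simp add: fact_numeral power_divide)
  show "(4965 / 10000) \<le> exp (- 7 / 10 :: real)" "exp (- 7 / 10 :: real) \<le> (4967 / 10000)"
    unfolding t(2) s using r R by linarith+
qed

lemma exp_minus_bounds_1_4: "(7788 / 10000) \<le> exp (- 1 / 4 :: real)" "exp (- 1 / 4 :: real) \<le> (7789 / 10000)"
proof -
  obtain t :: real where t: "\<bar>t\<bar> \<le> \<bar>- 1 / 4\<bar>"
    "exp (- 1 / 4) = (\<Sum>m<6. (- 1 / 4) ^ m / fact m) + exp t / fact 6 * (- 1 / 4) ^ 6"
    using Maclaurin_exp_le[of "- 1 / 4 :: real" 6] by blast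
  have "exp t \<le> exp 1" using t(1) by simp
  then have "exp t \<le> 3" using exp_le by linarith
  then have r: "0 \<le> exp t / fact 6 * (- 1 / 4) ^ 6" "exp t / fact 6 * (- 1 / 4) ^ 6 \<le> 3 / fact 6 * (1 / 4) ^ 6"
    by (auto simp: fact_numeral)
  have s: "(\<Sum>m<6. (- 1 / 4) ^ m / fact m :: real) = 1 - 1/4 + 1/32 - 1/384 + 1/6144 - 1/122880"
    by (simp add: numeral_eq_Suc fact_numeral)
  have R: "3 / fact 6 * (1 / 4) ^ 6 \<le> (1 / 20000 :: real)"
    by (simp add: fact_numeral power_divide)
  show "(7788 / 10000) \<le> exp (- 1 / 4 :: real)" "exp (- 1 / 4 :: real) \<le> (7789 / 10000)"
    unfolding t(2) s using r R by linarith+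
qed

text \<open>Here \<open>p\<close> stands for \<open>exp (- 0.7)\<close>, the chance that an offline vertex receives no proposal during
  \<open>(0.05, 0.75]\<close>, \<open>q\<close> for \<open>exp (- 0.25)\<close>, and \<open>y\<close> for the first-class load; the two inequalities are those for
  second-class and first-class edges.\<close>

lemma matching_ratio_bounds:
  fixes p q y :: real
  assumes p: "(4965 / 10000) \<le> p" "p \<le> (4967 / 10000)" and q: "(7788 / 10000) \<le> q" "q \<le> (7789 / 10000)" and y: "0 \<le> y" "y \<le> 1 / 3"
  defines "b \<equiv> 1 - 5 / 4 * q"
  defines "C \<equiv> 1 - q - b * (1 - y)"
  shows "(6549 / 10000) + (67 / 10000) * y \<le> 1 - p + p * (2 * C) + p\<^sup>2 * ((98 / 100) * b * (1 - y) - C)"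
    "(6549 / 10000) + (67 / 10000) * y \<le> 1 / 20 + (1 - p) + p * C + p\<^sup>2 * ((98 / 100) * b * (1 - y))" "0 \<le> C" "0 \<le> b"
proof -
  have b: "(26375 / 1000000) \<le> b" "b \<le> (265 / 10000)" using q by (auto simp: b_def)
  have "b * (1 - y) \<le> (265 / 10000) * (1 - y)" using b y by (intro mult_right_mono) auto
  then have C: "(2211 / 10000) - (265 / 10000) * (1 - y) \<le> C" using q unfolding C_def by linarith
  have C1: "0 \<le> (2211 / 10000) - (265 / 10000) * (1 - y)" using y by simp
  then show C0: "0 \<le> C" using C by (rule order_trans)
  show "0 \<le> b" using b by simp
  have "(4965 / 10000)\<^sup>2 \<le> p\<^sup>2" using p by (intro power_mono) auto
  then have p2: "(2465 / 10000) \<le> p\<^sup>2" by (simp add: power2_eq_square)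
  have "(1 - p)\<^sup>2 \<le> (5035 / 10000)\<^sup>2" using p by (intro power_mono) auto
  then have pp: "(74648 / 100000) \<le> 2 * p - p\<^sup>2" by (simp add: power2_eq_square algebra_simps)
  have T0: "2465 / 10000 * (98 / 100 * (26375 / 1000000) * (1 - y)) \<le> p\<^sup>2 * (98 / 100 * b * (1 - y))"
    using p2 b y by (intro mult_mono mult_nonneg_nonneg) auto
  define T where "T = p\<^sup>2 * (98 / 100 * b * (1 - y))"
  have t: "637 / 100000 * (1 - y) \<le> T" using T0 y unfolding T_def by simp
  define W where "W = (2 * p - p\<^sup>2) * C"
  have "74648 / 100000 * (2211 / 10000 - 265 / 10000 * (1 - y)) \<le> W"
    unfolding W_def using pp C C1 by (intro mult_mono) auto
  then have w: "145265 / 1000000 + 197 / 10000 * y \<le> W" using y by (simp add: field_simps)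
  have "6549 / 10000 + 67 / 10000 * y \<le> 1 - p + W + T"
    using w t p y by simp
  also have "\<dots> = 1 - p + p * (2 * C) + p\<^sup>2 * (98 / 100 * b * (1 - y) - C)"
    unfolding W_def T_def by (simp add: algebra_simps)
  finally show "(6549 / 10000) + (67 / 10000) * y \<le> 1 - p + p * (2 * C) + p\<^sup>2 * ((98 / 100) * b * (1 - y) - C)"
    by simp
  define V where "V = p * C"
  have "4965 / 10000 * (2211 / 10000 - 265 / 10000 * (1 - y)) \<le> V"
    unfolding V_def using p C C1 by (intro mult_mono) auto
  then have v: "96618 / 1000000 + 131 / 10000 * y \<le> V" using y by (simp add: field_simps)
  have "6549 / 10000 + 67 / 10000 * y \<le> 1 / 20 + (1 - p) + V + T"
    using v t p y by simp
  then show "(6549 / 10000) + (67 / 10000) * y \<le> 1 / 20 + (1 - p) + p * C + p\<^sup>2 * ((98 / 100) * b * (1 - y))"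
    unfolding V_def T_def by simp
qed

lemma exp_load_ratio:
  fixes y F :: real
  assumes y: "0 \<le> y" "y \<le> 1 / 3" and F: "(6549 / 10000) + (67 / 10000) * y \<le> F"
  shows "(129 / 200) \<le> exp (- y / 20) * F"
proof -
  have "y * y \<le> 1 / 3 * y" using y by (intro mult_right_mono)
  then have "(129 / 200) \<le> (1 - y / 20) * ((6549 / 10000) + (67 / 10000) * y)"
  proof -
    have "(1 - y / 20) * ((6549 / 10000) + (67 / 10000) * y) =
        6549 / 10000 + 67 / 10000 * y - 6549 / 200000 * y - 67 / 200000 * (y * y)"
      by (simp add: field_simps)
    then show ?thesis using y \<open>y * y \<le> 1 / 3 * y\<close> by linarith
  qed
  also have "\<dots> \<le> exp (- y / 20) * F"
    using y F exp_ge_add_one_self[of "- y / 20"] by (intro mult_mono) auto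
  finally show ?thesis .
qed

context two_class begin

definition late_slope :: real where
  "late_slope = 1 - 5 / 4 * exp (- 1 / 4)"

definition late_base :: "'j \<Rightarrow> real" where
  "late_base j0 = 1 - exp (- 1 / 4) - late_slope * (1 - load j0)"

definition boost :: "'r \<Rightarrow> real" where
  "boost r0 = of_bool (r0 \<notin> first_class_types H x)"

definition mid_coeff :: "'r \<Rightarrow> 'j \<Rightarrow> 'r \<Rightarrow> real" where
  "mid_coeff r0 j0 r = x r0 j0 * (late_slope * x r j0 - of_bool (r = r0) * late_base j0)"

definition mid_alpha :: "'r \<Rightarrow> 'j \<Rightarrow> real \<Rightarrow> real" where
  "mid_alpha r0 j0 t = x r0 j0 * (1 - exp (t - 3 / 4) + exp (t - 3 / 4) * ((1 + boost r0) * late_base j0))"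

definition mid_alpha_deriv :: "'r \<Rightarrow> 'j \<Rightarrow> real \<Rightarrow> real" where
  "mid_alpha_deriv r0 j0 t = x r0 j0 * (- exp (t - 3 / 4) + exp (t - 3 / 4) * ((1 + boost r0) * late_base j0))"

definition initial_coeff :: "'r \<Rightarrow> 'j \<Rightarrow> 'r \<Rightarrow> real" where
  "initial_coeff r0 j0 r = mid_coeff r0 j0 r * (exp (- 7 / 10))\<^sup>2"

definition initial_alpha :: "'r \<Rightarrow> 'j \<Rightarrow> real \<Rightarrow> real" where
  "initial_alpha r0 j0 t = exp (load j0 * (t - 1 / 20)) *
     (early_rate r0 j0 * (1 / 20 - t) + mid_alpha r0 j0 (1 / 20))"

definition initial_alpha_deriv :: "'r \<Rightarrow> 'j \<Rightarrow> real \<Rightarrow> real" where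
  "initial_alpha_deriv r0 j0 t = load j0 * initial_alpha r0 j0 t - exp (load j0 * (t - 1 / 20)) * early_rate r0 j0"

abbreviation "mid_value r0 j0 \<equiv> early_value x r0 j0 (3 / 4) (mid_alpha r0 j0) (mid_coeff r0 j0)"
abbreviation "mid_value_deriv r0 j0 \<equiv> early_value_deriv x r0 j0 (3 / 4) (mid_alpha_deriv r0 j0) (mid_coeff r0 j0)"
abbreviation "initial_value r0 j0 \<equiv> early_value early_rate r0 j0 (1 / 20) (initial_alpha r0 j0) (initial_coeff r0 j0)"
abbreviation "initial_value_deriv r0 j0 \<equiv>
  early_value_deriv early_rate r0 j0 (1 / 20) (initial_alpha_deriv r0 j0) (initial_coeff r0 j0)"

lemma mid_value_has_deriv:
  "((\<lambda>t. mid_value r0 j0 t m) has_real_derivative mid_value_deriv r0 j0 t m) (at t)"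
proof (rule early_value_has_deriv)
  show "(mid_alpha r0 j0 has_real_derivative mid_alpha_deriv r0 j0 t) (at t)"
    unfolding mid_alpha_def[abs_def] mid_alpha_deriv_def
    by (auto intro!: derivative_eq_intros simp: algebra_simps)
qed

lemma initial_value_has_deriv:
  "((\<lambda>t. initial_value r0 j0 t m) has_real_derivative initial_value_deriv r0 j0 t m) (at t)"
proof (rule early_value_has_deriv)
  show "(initial_alpha r0 j0 has_real_derivative initial_alpha_deriv r0 j0 t) (at t)"
    unfolding initial_alpha_def[abs_def] initial_alpha_deriv_def
    by (auto intro!: derivative_eq_intros simp: algebra_simps)
qed

lemma mid_value_subsolution:
  assumes e: "r0 \<in> on_types H" "j0 \<in> offline H"
  shows "0 \<le> mid_value_deriv r0 j0 t m + generator x (mid_value r0 j0 t) m"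
  by (rule early_value_subsolution[OF e])
    (use sum_col[OF e(2)] in \<open>simp add: mid_alpha_def mid_alpha_deriv_def algebra_simps\<close>)

lemma early_rate_nonneg: "0 \<le> early_rate r j"
  unfolding early_rate_def using x_nonneg by simp

lemma initial_value_subsolution:
  assumes e: "r0 \<in> on_types H" "j0 \<in> offline H" and t: "t \<le> 1 / 20"
  shows "0 \<le> initial_value_deriv r0 j0 t m + generator early_rate (initial_value r0 j0 t) m"
proof (rule early_value_subsolution[OF e])
  have "load j0 * (t - 1 / 20) \<le> 0"
    using load_nonneg t by (simp add: mult_le_0_iff)
  then have "exp (load j0 * (t - 1 / 20)) * early_rate r0 j0 \<le> early_rate r0 j0"
    using early_rate_nonneg by (simp add: mult_left_le_one_le)
  then show "initial_alpha r0 j0 t * (\<Sum>q\<in>on_types H. early_rate q j0) \<le>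
      initial_alpha_deriv r0 j0 t + early_rate r0 j0"
    unfolding initial_alpha_deriv_def load_def[symmetric] by (simp add: mult.commute)
qed

lemma sum_other_loads:
  assumes "j0 \<in> offline H" "r \<in> second_types j0"
  shows "(\<Sum>j\<in>{j0, other j0 r}. \<Sum>q\<in>on_types H. a q j) =
    (\<Sum>q\<in>on_types H. a q j0) + (\<Sum>q\<in>on_types H. a q (other j0 r))"
  using other(2)[OF assms] by simp

lemma initial_value_at_early_boundary:
  assumes "j0 \<in> offline H"
  shows "initial_value r0 j0 (1 / 20) m = mid_value r0 j0 (1 / 20) m"
proof -
  have "(exp (- 7 / 10 :: real))\<^sup>2 = exp (- (2 * (3 / 4 - 1 / 20)))"
    by (simp add: power2_eq_square exp_add[symmetric])
  then show ?thesis
    unfolding early_value_def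
    using sum_col[OF assms] sum_col[OF other(3)[OF assms]]
    by (simp add: sum_other_loads[OF assms] initial_alpha_def initial_coeff_def cong: sum.cong)
qed

lemma late_slope_nonneg: "0 \<le> late_slope"
  using exp_minus_bounds_1_4 unfolding late_slope_def by simp

lemma late_base_nonneg: "j0 \<in> offline H \<Longrightarrow> 0 \<le> late_base j0"
  unfolding late_slope_def late_base_def
  by (rule matching_ratio_bounds(3)[OF exp_minus_bounds_7_10 exp_minus_bounds_1_4 load_nonneg load_le])

text \<open>The proposal rate at a second-class edge is boosted by the indicator \<open>\<mu> r0\<close>, which multiplies a profile
  affine in \<open>Z\<close>. Replacing \<open>Z\<close> by its upper bound \<open>1 - load j0\<close> in this product leaves an expression that is
  linear in the indicators \<open>free {j0, l}\<close>.\<close>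

lemma mid_value_le_late_value:
  assumes e: "r0 \<in> on_types H" "j0 \<in> offline H" "0 < x r0 j0"
  shows "mid_value r0 j0 (3 / 4) m \<le> late_value r0 j0 (3 / 4) m m"
proof (cases "free {j0} m = 1")
  case False
  then have z: "free {j0} m = 0" unfolding free_def by auto
  then have "free {j0, k} m = 0" for k unfolding free_def by auto
  then show ?thesis
    unfolding early_value_def late_value_def using z by simp
next
  case True
  define \<mu> where "\<mu> r = 1 - free {other j0 r} m" for r
  define Z where "Z = conflict j0 m"
  have f: "free {j0, k} m = free {k} m" for k
    using True unfolding free_def by (auto split: if_splits)
  have \<mu>: "0 \<le> \<mu> r" "\<mu> r \<le> 1" for r unfolding \<mu>_def free_def by auto
  have fm: "free {j0, other j0 r} m = 1 - \<mu> r" for r unfolding f \<mu>_def by simp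
  have Z: "Z = (\<Sum>r\<in>second_types j0. x r j0 * \<mu> r)"
    unfolding Z_def conflict_def \<mu>_def ..
  have ZX: "Z \<le> 1 - load j0"
    unfolding Z sum_second_types[OF e(2), symmetric]
    by (rule sum_mono) (use \<mu> x_nonneg in \<open>simp add: mult_left_le\<close>)
  have r0: "r0 \<in> second_types j0 \<longleftrightarrow> r0 \<notin> first_class_types H x"
    using e unfolding second_types_def by auto
  have "(\<Sum>r\<in>second_types j0. mid_coeff r0 j0 r * (1 - \<mu> r)) =
      x r0 j0 * (late_slope * (\<Sum>r\<in>second_types j0. x r j0) - late_slope * Z
        - late_base j0 * (\<Sum>r\<in>second_types j0. if r = r0 then 1 - \<mu> r else 0))"
    unfolding mid_coeff_def Z sum_distrib_left sum_subtractf[symmetric]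
    by (rule sum.cong[OF refl]) (simp add: algebra_simps)
  also have "(\<Sum>r\<in>second_types j0. if r = r0 then 1 - \<mu> r else 0) = boost r0 * (1 - \<mu> r0)"
    using finite_second_types r0 by (simp add: boost_def)
  finally have sum: "(\<Sum>r\<in>second_types j0. mid_coeff r0 j0 r * (1 - \<mu> r)) =
      x r0 j0 * (late_slope * (1 - load j0) - late_slope * Z - late_base j0 * (boost r0 * (1 - \<mu> r0)))"
    unfolding sum_second_types[OF e(2)] .
  have "mid_value r0 j0 (3 / 4) m = matched r0 j0 m + x r0 j0 * ((1 + boost r0) * late_base j0)
      + (\<Sum>r\<in>second_types j0. mid_coeff r0 j0 r * (1 - \<mu> r))"
    unfolding early_value_def fm True by (simp add: mid_alpha_def)
  also have "\<dots> = matched r0 j0 m + x r0 j0 * ((late_base j0 + late_slope * (1 - load j0) - late_slope * Z)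
      + boost r0 * \<mu> r0 * late_base j0)"
    unfolding sum by (simp add: algebra_simps)
  also have "\<dots> \<le> matched r0 j0 m + x r0 j0 * ((late_base j0 + late_slope * (1 - load j0) - late_slope * Z)
      + boost r0 * \<mu> r0 * (late_base j0 + late_slope * (1 - load j0) - late_slope * Z))"
  proof -
    have "late_slope * Z \<le> late_slope * (1 - load j0)"
      by (rule mult_left_mono[OF ZX late_slope_nonneg])
    then show ?thesis
      using e(3) \<mu>(1)[of r0] by (intro add_left_mono mult_left_mono mult_nonneg_nonneg) (auto simp: boost_def)
  qed
  also have "late_base j0 + late_slope * (1 - load j0) - late_slope * Z = late_profile (1 / 4) Z"
    unfolding late_base_def late_slope_def late_profile_def by (simp add: algebra_simps)
  also have "matched r0 j0 m + x r0 j0 * (late_profile (1 / 4) Z + boost r0 * \<mu> r0 * late_profile (1 / 4) Z) =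
      late_value r0 j0 (3 / 4) m m"
  proof -
    have "late_rate m r0 j0 = x r0 j0 * (1 + boost r0 * \<mu> r0)"
    proof (cases "r0 \<in> first_class_types H x")
      case True
      then show ?thesis by (simp add: late_rate_def boost_def)
    next
      case False
      then show ?thesis
        using late_rate_second[OF e(2) _ True, of r0] r0 by (simp add: boost_def \<mu>_def)
    qed
    then show ?thesis
      unfolding late_value_def True Z_def[symmetric] by (simp add: algebra_simps)
  qed
  finally show ?thesis .
qed

lemma initial_value_bound:
  assumes e: "r0 \<in> on_types H" "j0 \<in> offline H" "0 < x r0 j0"
  shows "(129 / 200) * x r0 j0 \<le> initial_value r0 j0 0 {}"
proof -
  define p where "p = exp (- 7 / 10 :: real)"
  define y where "y = load j0"
  define \<epsilon> where "\<epsilon> r = exp (- load (other j0 r) / 20)" for r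
  have y: "0 \<le> y" "y \<le> 1 / 3" unfolding y_def using load_nonneg load_le[OF e(2)] by auto
  have \<epsilon>: "(98 / 100) \<le> \<epsilon> r" "\<epsilon> r \<le> 1" if "r \<in> second_types j0" for r
    using exp_ge_add_one_self[of "- load (other j0 r) / 20"] load_le[OF other(3)[OF e(2) that]] load_nonneg[of "other j0 r"]
    unfolding \<epsilon>_def by auto
  have r0: "r0 \<in> second_types j0 \<longleftrightarrow> r0 \<notin> first_class_types H x"
    using e unfolding second_types_def by auto
  note ratio = matching_ratio_bounds[OF exp_minus_bounds_7_10 exp_minus_bounds_1_4 y]
  define F where "F = of_bool (r0 \<in> first_class_types H x) / 20 + (1 - p) + p * ((1 + boost r0) * late_base j0)
    + p\<^sup>2 * ((98 / 100) * late_slope * (1 - y) - boost r0 * late_base j0)"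
  have F: "(6549 / 10000) + (67 / 10000) * y \<le> F"
    using ratio(1,2) unfolding F_def boost_def p_def late_base_def late_slope_def y_def by auto
  have "x r0 j0 * ((98 / 100) * late_slope * (1 - y) - boost r0 * late_base j0) =
     (\<Sum>r\<in>second_types j0. x r0 j0 * (late_slope * x r j0) * (98 / 100) - (if r = r0 then x r0 j0 * late_base j0 else 0))"
  proof -
    have "(\<Sum>r\<in>second_types j0. x r0 j0 * (late_slope * x r j0) * (98 / 100) - (if r = r0 then x r0 j0 * late_base j0 else 0))
      = x r0 j0 * late_slope * (98 / 100) * (\<Sum>r\<in>second_types j0. x r j0)
        - (\<Sum>r\<in>second_types j0. if r = r0 then x r0 j0 * late_base j0 else 0)"
      unfolding sum_subtractf sum_distrib_left by (simp add: algebra_simps)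
    also have "\<dots> = x r0 j0 * late_slope * (98 / 100) * (1 - y) - boost r0 * (x r0 j0 * late_base j0)"
      unfolding sum_second_types[OF e(2)] y_def using finite_second_types r0 by (simp add: boost_def)
    finally show ?thesis by (simp add: algebra_simps)
  qed
  also have "\<dots> \<le> (\<Sum>r\<in>second_types j0. mid_coeff r0 j0 r * \<epsilon> r)"
  proof (rule sum_mono)
    fix r assume r: "r \<in> second_types j0"
    have "x r0 j0 * (late_slope * x r j0) * (98 / 100) \<le> x r0 j0 * (late_slope * x r j0) * \<epsilon> r"
      using \<epsilon>[OF r] x_nonneg late_slope_nonneg by (intro mult_left_mono mult_nonneg_nonneg) auto
    moreover have "x r0 j0 * late_base j0 * \<epsilon> r \<le> x r0 j0 * late_base j0"
      using \<epsilon>[OF r] x_nonneg late_base_nonneg[OF e(2)] by (simp add: mult_left_le)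
    ultimately show "x r0 j0 * (late_slope * x r j0) * (98 / 100) - (if r = r0 then x r0 j0 * late_base j0 else 0)
        \<le> mid_coeff r0 j0 r * \<epsilon> r"
      unfolding mid_coeff_def by (auto simp: algebra_simps)
  qed
  finally have S: "x r0 j0 * ((98 / 100) * late_slope * (1 - y) - boost r0 * late_base j0) \<le>
      (\<Sum>r\<in>second_types j0. mid_coeff r0 j0 r * \<epsilon> r)" .
  have al: "initial_alpha r0 j0 0 = exp (- y / 20) * (x r0 j0 * (of_bool (r0 \<in> first_class_types H x) / 20 + (1 - p)
      + p * ((1 + boost r0) * late_base j0)))"
    unfolding initial_alpha_def mid_alpha_def early_rate_def y_def p_def by (simp add: algebra_simps)
  have "(\<Sum>r\<in>second_types j0. (initial_coeff r0 j0 r *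
      exp (- ((\<Sum>j\<in>{j0, other j0 r}. \<Sum>q\<in>on_types H. early_rate q j) * (1 / 20 - 0)))) * free {j0, other j0 r} {})
    = exp (- y / 20) * p\<^sup>2 * (\<Sum>r\<in>second_types j0. mid_coeff r0 j0 r * \<epsilon> r)"
    unfolding sum_distrib_left
  proof (rule sum.cong[OF refl])
    fix r assume r: "r \<in> second_types j0"
    have "exp (- ((\<Sum>j\<in>{j0, other j0 r}. \<Sum>q\<in>on_types H. early_rate q j) * (1 / 20 - 0))) = exp (- y / 20) * \<epsilon> r"
      unfolding sum_other_loads[OF e(2) r] unfolding load_def[symmetric] y_def \<epsilon>_def
      by (simp add: exp_add[symmetric] algebra_simps add_divide_distrib)
    then show "(initial_coeff r0 j0 r *
      exp (- ((\<Sum>j\<in>{j0, other j0 r}. \<Sum>q\<in>on_types H. early_rate q j) * (1 / 20 - 0)))) * free {j0, other j0 r} {} =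
      exp (- y / 20) * p\<^sup>2 * (mid_coeff r0 j0 r * \<epsilon> r)"
      by (simp add: initial_coeff_def p_def free_def)
  qed
  then have "initial_value r0 j0 0 {} =
      initial_alpha r0 j0 0 + exp (- y / 20) * p\<^sup>2 * (\<Sum>r\<in>second_types j0. mid_coeff r0 j0 r * \<epsilon> r)"
    unfolding early_value_def by (simp add: matched_def free_def)
  also have "\<dots> \<ge> initial_alpha r0 j0 0 +
      exp (- y / 20) * p\<^sup>2 * (x r0 j0 * ((98 / 100) * late_slope * (1 - y) - boost r0 * late_base j0))"
    using S by (intro add_left_mono mult_left_mono) auto
  also have "initial_alpha r0 j0 0 +
      exp (- y / 20) * p\<^sup>2 * (x r0 j0 * ((98 / 100) * late_slope * (1 - y) - boost r0 * late_base j0)) =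
      (exp (- y / 20) * F) * x r0 j0"
    unfolding al F_def by (simp add: algebra_simps)
  finally have "(exp (- y / 20) * F) * x r0 j0 \<le> initial_value r0 j0 0 {}" .
  moreover have "(129 / 200) * x r0 j0 \<le> (exp (- y / 20) * F) * x r0 j0"
    using exp_load_ratio[OF y F] e(3) by (intro mult_right_mono) auto
  ultimately show ?thesis by linarith
qed

end

section \<open>Multistage Suggested Matching as a Markov chain\<close>

lemma filter_sorted_partition:
  fixes f :: "'a \<Rightarrow> 'b :: linorder"
  assumes "sorted (map f xs)"
  shows "xs = filter (\<lambda>x. f x \<le> c) xs @ filter (\<lambda>x. c < f x) xs"
  using assms
proof (induction xs)
  case (Cons x xs)
  show ?case
  proof (cases "f x \<le> c")
    case False
    then have "filter (\<lambda>x. f x \<le> c) xs = []"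
      using Cons.prems by (auto simp: filter_empty_conv)
    then show ?thesis using Cons False by auto
  qed (use Cons in auto)
qed simp

lemma process_image:
  assumes "\<And>a s. a \<in> set as \<Longrightarrow> f a (\<phi> s) = map_pmf \<phi> (g a s)"
  shows "process f as (\<phi> s) = map_pmf \<phi> (process g as s)"
  using assms
proof (induction as arbitrary: s)
  case (Cons a as)
  have "process f (a # as) (\<phi> s) = bind_pmf (g a s) (\<lambda>s'. process f as (\<phi> s'))"
    using Cons.prems[of a s] by (simp add: bind_map_pmf)
  also have "\<dots> = bind_pmf (g a s) (\<lambda>s'. map_pmf \<phi> (process g as s'))"
    by (rule bind_pmf_cong[OF refl], rule Cons.IH, rule Cons.prems) simp
  finally show ?case by (simp add: map_bind_pmf)
qed simp

lemma cell_le_boundary: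
  fixes t :: real
  assumes "real k / real (20 * Suc n) < t" "t \<le> real (Suc k) / real (20 * Suc n)"
  shows "t \<le> real c / 20 \<longleftrightarrow> Suc k \<le> c * Suc n"
proof -
  define N where "N = real (20 * Suc n)"
  have N: "0 < N" unfolding N_def by simp
  have c: "real c / 20 = real (c * Suc n) / N" unfolding N_def by (simp add: field_simps)
  show ?thesis
  proof
    assume "t \<le> real c / 20"
    then have "real k / N < real (c * Suc n) / N"
      using assms(1) unfolding c N_def by linarith
    then have "real k < real (c * Suc n)"
      using N by (simp add: divide_less_cancel)
    then show "Suc k \<le> c * Suc n" by linarith
  next
    assume "Suc k \<le> c * Suc n"
    then have "real (Suc k) / N \<le> real (c * Suc n) / N"
      using N by (intro divide_right_mono) (simp_all del: of_nat_mult of_nat_Suc)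
    then show "t \<le> real c / 20"
      using assms(2) unfolding c N_def by linarith
  qed
qed

lemma grid_le_boundary: "real (Suc k) / real (20 * Suc n) \<le> real c / 20 \<longleftrightarrow> Suc k \<le> c * Suc n"
  by (rule cell_le_boundary) (simp_all add: divide_strict_right_mono)

locale split_two_class = two_class H x for H :: "('i \<times> nat, 'j) osm" and x :: "'i \<times> nat \<Rightarrow> 'j \<Rightarrow> real" +
  fixes G :: "('i, 'j) osm"
  assumes valid_unsplit: "valid_osm G" and split: "split_instance G H"
begin

abbreviation "parts i \<equiv> {r \<in> on_types H. fst r = i}"

lemma finite_parts: "finite (parts i)"
  using finite_on_types by simp

lemma sum_parts: "i \<in> on_types G \<Longrightarrow> (\<Sum>r\<in>parts i. rate H r) = rate G i"
  using split unfolding split_instance_def by blast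

lemma rate_unsplit_pos: "i \<in> on_types G \<Longrightarrow> 0 < rate G i"
  and finite_unsplit: "finite (on_types G)"
  using valid_unsplit unfolding valid_osm_def by auto

lemma fst_on_types: "r \<in> on_types H \<Longrightarrow> fst r \<in> on_types G"
  using split unfolding split_instance_def by blast

lemma pmf_relabel:
  assumes i: "i \<in> on_types G"
  shows "pmf (relabel G H i) r = (if r \<in> parts i then rate H r / rate G i else 0)"
proof -
  define f where "f r = (if r \<in> on_types H \<and> fst r = i then rate H r / rate G i else 0)" for r
  have nonneg: "0 \<le> f r" for r
    unfolding f_def using rate_pos[of r] rate_unsplit_pos[OF i] by auto
  have "(\<Sum>r\<in>parts i. rate H r / rate G i) = 1"
    unfolding sum_divide_distrib[symmetric] sum_parts[OF i] using rate_unsplit_pos[OF i] by simp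
  then have s: "(\<Sum>r\<in>parts i. f r) = 1"
    by (simp add: f_def cong: sum.cong_simp)
  have "(\<integral>\<^sup>+r. ennreal (f r) \<partial>count_space UNIV) = (\<Sum>r\<in>parts i. ennreal (f r))"
    by (rule nn_integral_count_space'[OF finite_parts]) (auto simp: f_def)
  also have "\<dots> = 1"
    using s nonneg by (simp add: sum_ennreal)
  finally have "pmf (embed_pmf f) r = f r"
    by (intro pmf_embed_pmf nonneg)
  then show ?thesis unfolding relabel_def f_def by simp
qed

lemma set_relabel: "i \<in> on_types G \<Longrightarrow> set_pmf (relabel G H i) \<subseteq> parts i"
  by (auto simp: set_pmf_iff pmf_relabel split: if_splits)

text \<open>A state consists of the matching at time \<open>min t t1\<close> and the current matching.\<close>

definition msm_kernel :: "real \<Rightarrow> real \<Rightarrow> 'i \<Rightarrow> real \<Rightarrow> ((('i \<times> nat) \<times> 'j) set \<times> (('i \<times> nat) \<times> 'j) set) \<Rightarrow>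
    ((('i \<times> nat) \<times> 'j) set \<times> (('i \<times> nat) \<times> 'j) set) pmf" where
  "msm_kernel t0 t1 i t = (\<lambda>(m1, m). bind_pmf (relabel G H i) (\<lambda>r.
     if t \<le> t1 then map_pmf (\<lambda>m'. (m', m')) (serve_early t0 H x t r m)
     else map_pmf (Pair m1) (serve_late m1 H x r m)))"

lemma msm_eq_process:
  "msm t0 t1 G H x T = map_pmf snd (process (\<lambda>(i, t). msm_kernel t0 t1 i t) (arrivals G T) ({}, {}))"
proof -
  let ?as = "arrivals G T"
  let ?early = "process (\<lambda>(i, t) m. bind_pmf (relabel G H i) (\<lambda>r. serve_early t0 H x t r m)) (filter (\<lambda>(i, t). t \<le> t1) ?as) {}"
  have as: "?as = filter (\<lambda>(i, t). t \<le> t1) ?as @ filter (\<lambda>(i, t). t1 < t) ?as"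
    using filter_sorted_partition[of snd ?as t1] unfolding arrivals_def by (simp add: case_prod_beta')
  have 1: "process (\<lambda>(i, t). msm_kernel t0 t1 i t) (filter (\<lambda>(i, t). t \<le> t1) ?as) ({}, {}) =
      map_pmf (\<lambda>m. (m, m)) ?early"
    by (rule process_image[where \<phi> = "\<lambda>m. (m, m)"]) (auto simp: msm_kernel_def map_bind_pmf)
  have 2: "process (\<lambda>(i, t). msm_kernel t0 t1 i t) (filter (\<lambda>(i, t). t1 < t) ?as) (m1, m) =
      map_pmf (Pair m1) (process (\<lambda>(i, t) m. bind_pmf (relabel G H i) (\<lambda>r. serve_late m1 H x r m))
        (filter (\<lambda>(i, t). t1 < t) ?as) m)" for m1 m
    by (rule process_image[where \<phi> = "Pair m1"]) (auto simp: msm_kernel_def map_bind_pmf)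
  have "process (\<lambda>(i, t). msm_kernel t0 t1 i t) ?as ({}, {}) =
      bind_pmf ?early (\<lambda>m. process (\<lambda>(i, t). msm_kernel t0 t1 i t) (filter (\<lambda>(i, t). t1 < t) ?as) (m, m))"
    by (subst as, subst process_append) (simp add: 1 bind_map_pmf)
  also have "\<dots> = bind_pmf ?early (\<lambda>m1. map_pmf (Pair m1)
      (process (\<lambda>(i, t) m. bind_pmf (relabel G H i) (\<lambda>r. serve_late m1 H x r m)) (filter (\<lambda>(i, t). t1 < t) ?as) m1))"
    unfolding 2 ..
  finally show ?thesis
    unfolding msm_def Let_def by (simp add: map_bind_pmf pmf.map_comp comp_def)
qed

definition states :: "((('i \<times> nat) \<times> 'j) set \<times> (('i \<times> nat) \<times> 'j) set) set" where
  "states = Pow (edges H) \<times> Pow (edges H)"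

definition early_states :: "((('i \<times> nat) \<times> 'j) set \<times> (('i \<times> nat) \<times> 'j) set) set" where
  "early_states = (\<lambda>m. (m, m)) ` Pow (edges H)"

lemma finite_states: "finite states" "finite early_states"
  unfolding states_def early_states_def using finite_edges by auto

lemma early_states_subset: "early_states \<subseteq> states"
  unfolding states_def early_states_def by auto

lemma try_match_edges: "m \<subseteq> edges H \<Longrightarrow> j \<in> neighbors H x r \<Longrightarrow> try_match r j m \<subseteq> edges H"
  unfolding try_match_def using neighbors_edges by auto

lemma the_elem_neighbors:
  assumes "r \<in> first_class_types H x"
  shows "the_elem (neighbors H x r) \<in> neighbors H x r"
proof -
  obtain j where "neighbors H x r = {j}"
    using neighbors_first_class[OF assms] by blast
  then show ?thesis by simp
qed

lemma set_suggest:
  assumes "r \<in> on_types H" "m \<subseteq> edges H"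
  shows "set_pmf (suggest H x r m) \<subseteq> Pow (edges H)"
proof -
  have "set_pmf (pmf_of_set (neighbors H x r)) = neighbors H x r"
    by (rule set_pmf_of_set[OF neighbors_nonempty[OF assms(1)] finite_neighbors])
  then show ?thesis
    unfolding suggest_def set_map_pmf using try_match_edges[OF assms(2), of _ r] by auto
qed

lemma set_serve_early:
  assumes "r \<in> on_types H" "m \<subseteq> edges H"
  shows "set_pmf (serve_early t0 H x t r m) \<subseteq> Pow (edges H)"
  unfolding serve_early_def
  using try_match_edges[OF assms(2)] the_elem_neighbors[of r] set_suggest[OF assms] assms(2) by auto

lemma set_serve_late:
  assumes "r \<in> on_types H" "m \<subseteq> edges H"
  shows "set_pmf (serve_late m1 H x r m) \<subseteq> Pow (edges H)"
proof -
  have "the_elem (neighbors H x r - snd ` m1) \<in> neighbors H x r" if "card (neighbors H x r - snd ` m1) = 1"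
  proof -
    obtain j where "neighbors H x r - snd ` m1 = {j}"
      using \<open>card (neighbors H x r - snd ` m1) = 1\<close> card_1_singletonE by blast
    then show ?thesis by auto
  qed
  then show ?thesis
    unfolding serve_late_def
    using try_match_edges[OF assms(2)] the_elem_neighbors[of r] set_suggest[OF assms] by auto
qed

lemma set_msm_kernel:
  assumes i: "i \<in> on_types G" and s: "s \<in> states"
  shows "set_pmf (msm_kernel t0 t1 i t s) \<subseteq> states"
proof -
  obtain m1 m where m: "s = (m1, m)" "m1 \<subseteq> edges H" "m \<subseteq> edges H"
    using s unfolding states_def by auto
  have "set_pmf (if t \<le> t1 then map_pmf (\<lambda>m'. (m', m')) (serve_early t0 H x t r m)
     else map_pmf (Pair m1) (serve_late m1 H x r m)) \<subseteq> states" if "r \<in> on_types H" for r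
    using set_serve_early[OF that m(3), of t0 t] set_serve_late[OF that m(3), of m1] m(2)
    unfolding states_def by auto
  then show ?thesis
    using set_relabel[OF i] unfolding msm_kernel_def m(1) prod.case set_bind_pmf by blast
qed

lemma set_msm_kernel_early:
  assumes i: "i \<in> on_types G" and s: "s \<in> early_states" and t: "t \<le> t1"
  shows "set_pmf (msm_kernel t0 t1 i t s) \<subseteq> early_states"
proof -
  obtain m where m: "s = (m, m)" "m \<subseteq> edges H"
    using s unfolding early_states_def by auto
  have "set_pmf (map_pmf (\<lambda>m'. (m', m')) (serve_early t0 H x t r m)) \<subseteq> early_states" if "r \<in> on_types H" for r
    using set_serve_early[OF that m(2), of t0 t] unfolding early_states_def by auto
  then show ?thesis
    using set_relabel[OF i] t unfolding msm_kernel_def m(1) prod.case set_bind_pmf by auto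
qed

lemma distinct_type_list: "distinct (type_list G)" and set_type_list: "set (type_list G) = on_types G"
proof -
  have "\<exists>ks. distinct ks \<and> set ks = on_types G"
    using finite_distinct_list[OF finite_unsplit] by blast
  from someI_ex[OF this] show "distinct (type_list G)" "set (type_list G) = on_types G"
    unfolding type_list_def by auto
qed

lemma drift_relabel:
  fixes g :: "'s \<Rightarrow> real" and serve :: "'i \<times> nat \<Rightarrow> 's pmf"
  assumes fin: "\<And>r. r \<in> on_types H \<Longrightarrow> finite (set_pmf (serve r))"
    and F: "\<And>i. i \<in> on_types G \<Longrightarrow> F i s = bind_pmf (relabel G H i) serve"
  shows "drift (rate G) (type_list G) F g s =
    (\<Sum>r\<in>on_types H. rate H r * (mean (serve r) g - g s))"
proof -
  have 1: "rate G i * (mean (F i s) g - g s) =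
      (\<Sum>r\<in>parts i. rate H r * (mean (serve r) g - g s))" if i: "i \<in> on_types G" for i
  proof -
    have "mean (F i s) g =
        (\<Sum>r\<in>parts i. pmf (relabel G H i) r *\<^sub>R mean (serve r) g)"
      unfolding F[OF i] by (rule pmf_expectation_bind) (use finite_parts set_relabel[OF i] fin in auto)
    also have "\<dots> = (\<Sum>r\<in>parts i. rate H r * mean (serve r) g) / rate G i"
      unfolding sum_divide_distrib by (rule sum.cong) (auto simp: pmf_relabel[OF i])
    finally have "rate G i * mean (F i s) g =
        (\<Sum>r\<in>parts i. rate H r * mean (serve r) g)"
      using rate_unsplit_pos[OF i] by simp
    moreover have "rate G i * g s = (\<Sum>r\<in>parts i. rate H r * g s)"
      unfolding sum_parts[OF i, symmetric] by (simp add: sum_distrib_right)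
    ultimately show ?thesis
      by (simp add: right_diff_distrib sum_subtractf)
  qed
  have "drift (rate G) (type_list G) F g s = (\<Sum>i\<in>on_types G. rate G i * (mean (F i s) g - g s))"
    unfolding drift_def using distinct_type_list set_type_list by (simp add: sum_list_distinct_conv_sum_set)
  also have "\<dots> = (\<Sum>i\<in>on_types G. \<Sum>r\<in>parts i. rate H r * (mean (serve r) g - g s))"
    by (rule sum.cong) (auto simp: 1)
  also have "\<dots> = (\<Sum>r\<in>on_types H. rate H r * (mean (serve r) g - g s))"
    by (rule sum.group) (use finite_on_types finite_unsplit fst_on_types in auto)
  finally show ?thesis .
qed

lemma finite_set_serve: "r \<in> on_types H \<Longrightarrow> finite (set_pmf (serve_early t0 H x t r m))"
  "r \<in> on_types H \<Longrightarrow> finite (set_pmf (serve_late m1 H x r m))"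
  unfolding serve_early_def serve_late_def suggest_def
  using neighbors_nonempty finite_neighbors by (auto simp: set_pmf_of_set)

lemma drift_early:
  assumes t: "t \<le> t1"
  shows "drift (rate G) (type_list G) (\<lambda>i. msm_kernel t0 t1 i t) (\<lambda>s. g (snd s)) (m1, m) =
    generator (if t \<le> t0 then early_rate else x) g m"
proof -
  have "drift (rate G) (type_list G) (\<lambda>i. msm_kernel t0 t1 i t) (\<lambda>s. g (snd s)) (m1, m) =
    (\<Sum>r\<in>on_types H. rate H r * (mean (map_pmf (\<lambda>m'. (m', m')) (serve_early t0 H x t r m))
      (\<lambda>s. g (snd s)) - g (snd (m1, m))))"
    by (rule drift_relabel) (use finite_set_serve t in \<open>auto simp: msm_kernel_def\<close>)
  then show ?thesis
    using generator_serve_early[of t0 t m g] by simp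
qed

lemma drift_late:
  assumes t: "t1 < t"
  shows "drift (rate G) (type_list G) (\<lambda>i. msm_kernel t0 t1 i t) (\<lambda>s. g (fst s) (snd s)) (m1, m) =
    generator (late_rate m1) (g m1) m"
proof -
  have "drift (rate G) (type_list G) (\<lambda>i. msm_kernel t0 t1 i t) (\<lambda>s. g (fst s) (snd s)) (m1, m) =
    (\<Sum>r\<in>on_types H. rate H r * (mean (map_pmf (Pair m1) (serve_late m1 H x r m))
      (\<lambda>s. g (fst s) (snd s)) - g (fst (m1, m)) (snd (m1, m))))"
    by (rule drift_relabel) (use finite_set_serve t in \<open>auto simp: msm_kernel_def\<close>)
  then show ?thesis
    using generator_serve_late[of m1 m "g m1"] by simp
qed

end

context two_class begin

lemma continuous_on_value_derivs:
  "continuous_on T (\<lambda>t. initial_value_deriv r0 j0 t m)"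
  "continuous_on T (\<lambda>t. mid_value_deriv r0 j0 t m)"
  "continuous_on T (\<lambda>t. late_value_deriv r0 j0 t m1 m)"
  unfolding early_value_deriv_def initial_alpha_deriv_def initial_alpha_def mid_alpha_deriv_def late_value_deriv_def
  by (intro continuous_intros)+

end

context split_two_class begin

lemma msm_kernel_cong:
  assumes "t \<le> t1 \<longleftrightarrow> t' \<le> t1" "t \<le> t0 \<longleftrightarrow> t' \<le> t0"
  shows "msm_kernel t0 t1 i t = msm_kernel t0 t1 i t'"
  unfolding msm_kernel_def serve_early_def assms ..

abbreviation "serve_arrival \<equiv> msm_kernel (1 / 20) (3 / 4)"

lemma kernel_grid:
  assumes "real k / real (20 * Suc n) < t" "t \<le> real (Suc k) / real (20 * Suc n)"
  shows "serve_arrival i t = serve_arrival i (real (Suc k) / real (20 * Suc n))"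
proof (rule msm_kernel_cong)
  have *: "t \<le> b \<longleftrightarrow> real (Suc k) / real (20 * Suc n) \<le> b" if "b = real c / 20" for b c
    unfolding that cell_le_boundary[OF assms] grid_le_boundary ..
  show "t \<le> 3 / 4 \<longleftrightarrow> real (Suc k) / real (20 * Suc n) \<le> 3 / 4" by (rule *[of _ 15]) simp
  show "t \<le> 1 / 20 \<longleftrightarrow> real (Suc k) / real (20 * Suc n) \<le> 1 / 20" by (rule *[of _ 1]) simp
qed

lemma initial_chain:
  assumes e: "r0 \<in> on_types H" "j0 \<in> offline H" and \<epsilon>: "0 < \<epsilon>"
  shows "\<exists>d>0. \<forall>h xs s. 0 < h \<longrightarrow> h < d \<longrightarrow> real (length xs) * h = 1 / 20 - 0 \<longrightarrow> s \<in> early_states \<longrightarrow>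
    initial_value r0 j0 0 (snd s) - \<epsilon> \<le> mean
      (process (\<lambda>_ :: nat. cell_kernel (rate G) (type_list G) h (\<lambda>i. serve_arrival i (1 / 20))) xs s)
      (\<lambda>s. initial_value r0 j0 (1 / 20) (snd s))"
proof (rule cell_chain_subsolution[where V' = "\<lambda>t s. initial_value_deriv r0 j0 t (snd s)"])
  show "finite early_states" by (rule finite_states)
  show "set_pmf (serve_arrival i (1 / 20) s) \<subseteq> early_states" if "i \<in> set (type_list G)" "s \<in> early_states" for i s
    using set_msm_kernel_early[of i s "1 / 20" "3 / 4"] that set_type_list by simp
  show "0 < rate G i" if "i \<in> set (type_list G)" for i
    using that rate_unsplit_pos set_type_list by simp
  show "0 \<le> initial_value_deriv r0 j0 t (snd s) +
      drift (rate G) (type_list G) (\<lambda>i. serve_arrival i (1 / 20)) (\<lambda>s. initial_value r0 j0 t (snd s)) s"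
    if "t \<in> {0..1 / 20}" "s \<in> early_states" for t s
    using initial_value_subsolution[OF e, of t "snd s"] that
      drift_early[of "1 / 20" "3 / 4" "1 / 20" "initial_value r0 j0 t" "fst s" "snd s"] by simp
qed (use \<epsilon> in \<open>auto intro: initial_value_has_deriv continuous_on_value_derivs\<close>)

lemma mid_chain:
  assumes e: "r0 \<in> on_types H" "j0 \<in> offline H" and \<epsilon>: "0 < \<epsilon>"
  shows "\<exists>d>0. \<forall>h xs s. 0 < h \<longrightarrow> h < d \<longrightarrow> real (length xs) * h = 3 / 4 - 1 / 20 \<longrightarrow> s \<in> early_states \<longrightarrow>
    mid_value r0 j0 (1 / 20) (snd s) - \<epsilon> \<le> mean
      (process (\<lambda>_ :: nat. cell_kernel (rate G) (type_list G) h (\<lambda>i. serve_arrival i (3 / 4))) xs s)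
      (\<lambda>s. mid_value r0 j0 (3 / 4) (snd s))"
proof (rule cell_chain_subsolution[where V' = "\<lambda>t s. mid_value_deriv r0 j0 t (snd s)"])
  show "finite early_states" by (rule finite_states)
  show "set_pmf (serve_arrival i (3 / 4) s) \<subseteq> early_states" if "i \<in> set (type_list G)" "s \<in> early_states" for i s
    using set_msm_kernel_early[of i s "3 / 4" "3 / 4"] that set_type_list by simp
  show "0 < rate G i" if "i \<in> set (type_list G)" for i
    using that rate_unsplit_pos set_type_list by simp
  show "0 \<le> mid_value_deriv r0 j0 t (snd s) +
      drift (rate G) (type_list G) (\<lambda>i. serve_arrival i (3 / 4)) (\<lambda>s. mid_value r0 j0 t (snd s)) s"
    if "t \<in> {1 / 20..3 / 4}" "s \<in> early_states" for t s
    using mid_value_subsolution[OF e, of t "snd s"] that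
      drift_early[of "3 / 4" "3 / 4" "1 / 20" "mid_value r0 j0 t" "fst s" "snd s"] by simp
qed (use \<epsilon> in \<open>auto intro: mid_value_has_deriv continuous_on_value_derivs\<close>)

lemma late_chain:
  assumes e: "r0 \<in> on_types H" "j0 \<in> offline H" and \<epsilon>: "0 < \<epsilon>"
  shows "\<exists>d>0. \<forall>h xs s. 0 < h \<longrightarrow> h < d \<longrightarrow> real (length xs) * h = 1 - 3 / 4 \<longrightarrow> s \<in> states \<longrightarrow>
    late_value r0 j0 (3 / 4) (fst s) (snd s) - \<epsilon> \<le> mean
      (process (\<lambda>_ :: nat. cell_kernel (rate G) (type_list G) h (\<lambda>i. serve_arrival i 1)) xs s)
      (\<lambda>s. late_value r0 j0 1 (fst s) (snd s))"
proof (rule cell_chain_subsolution[where V' = "\<lambda>t s. late_value_deriv r0 j0 t (fst s) (snd s)"])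
  show "finite states" by (rule finite_states)
  show "set_pmf (serve_arrival i 1 s) \<subseteq> states" if "i \<in> set (type_list G)" "s \<in> states" for i s
    using set_msm_kernel[of i s "1 / 20" "3 / 4" 1] that set_type_list by simp
  show "0 < rate G i" if "i \<in> set (type_list G)" for i
    using that rate_unsplit_pos set_type_list by simp
  show "0 \<le> late_value_deriv r0 j0 t (fst s) (snd s) +
      drift (rate G) (type_list G) (\<lambda>i. serve_arrival i 1) (\<lambda>s. late_value r0 j0 t (fst s) (snd s)) s"
    if "t \<in> {3 / 4..1}" "s \<in> states" for t s
    using late_value_subsolution[OF e, of t "fst s" "snd s"] that
      drift_late[of "3 / 4" 1 "1 / 20" "late_value r0 j0 t" "fst s" "snd s"] by simp
qed (use \<epsilon> in \<open>auto intro: late_value_has_deriv continuous_on_value_derivs\<close>)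

lemma grid_chain_split:
  fixes h :: real
  assumes h: "h = 1 / real (20 * Suc n)"
  shows "process (\<lambda>k. cell_kernel (rate G) (type_list G) h (\<lambda>i. serve_arrival i (real (Suc k) / real (20 * Suc n))))
      [0..<20 * Suc n] s =
    bind_pmf (process (\<lambda>_. cell_kernel (rate G) (type_list G) h (\<lambda>i. serve_arrival i (1 / 20))) [0..<Suc n] s)
    (\<lambda>s. bind_pmf (process (\<lambda>_. cell_kernel (rate G) (type_list G) h (\<lambda>i. serve_arrival i (3 / 4))) [Suc n..<15 * Suc n] s)
    (process (\<lambda>_. cell_kernel (rate G) (type_list G) h (\<lambda>i. serve_arrival i 1)) [15 * Suc n..<20 * Suc n]))"
proof -
  let ?Q = "\<lambda>k. cell_kernel (rate G) (type_list G) h (\<lambda>i. serve_arrival i (real (Suc k) / real (20 * Suc n)))"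
  let ?P = "\<lambda>t _ :: nat. cell_kernel (rate G) (type_list G) h (\<lambda>i. serve_arrival i t)"
  have K: "serve_arrival i (real (Suc k) / real (20 * Suc n)) = serve_arrival i (if Suc k \<le> Suc n then 1 / 20
      else if Suc k \<le> 15 * Suc n then 3 / 4 else 1)" for i k
  proof (rule msm_kernel_cong)
    have *: "real (Suc k) / real (20 * Suc n) \<le> b \<longleftrightarrow> Suc k \<le> c * Suc n" if "b = real c / 20" for b c
      unfolding that grid_le_boundary ..
    have "real (Suc k) / real (20 * Suc n) \<le> 3 / 4 \<longleftrightarrow> Suc k \<le> 15 * Suc n" by (rule *) simp
    then show "real (Suc k) / real (20 * Suc n) \<le> 3 / 4 \<longleftrightarrow> (if Suc k \<le> Suc n then 1 / 20
      else if Suc k \<le> 15 * Suc n then 3 / 4 else 1) \<le> (3 / 4 :: real)" by auto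
    have "real (Suc k) / real (20 * Suc n) \<le> 1 / 20 \<longleftrightarrow> Suc k \<le> 1 * Suc n" by (rule *) simp
    then show "real (Suc k) / real (20 * Suc n) \<le> 1 / 20 \<longleftrightarrow> (if Suc k \<le> Suc n then 1 / 20
      else if Suc k \<le> 15 * Suc n then 3 / 4 else 1) \<le> (1 / 20 :: real)" by auto
  qed
  have 1: "process ?Q [0..<Suc n] = process (?P (1 / 20)) [0..<Suc n]"
    by (rule ext, rule process_cong[OF refl]) (simp only: K, auto)
  have 2: "process ?Q [Suc n..<15 * Suc n] = process (?P (3 / 4)) [Suc n..<15 * Suc n]"
    by (rule ext, rule process_cong[OF refl]) (simp only: K, auto)
  have 3: "process ?Q [15 * Suc n..<20 * Suc n] = process (?P 1) [15 * Suc n..<20 * Suc n]"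
    by (rule ext, rule process_cong[OF refl]) (simp only: K, auto)
  have "[0..<20 * Suc n] = [0..<Suc n] @ [Suc n..<15 * Suc n] @ [15 * Suc n..<20 * Suc n]"
    using upt_add_eq_append[of 0 "Suc n" "19 * Suc n"] upt_add_eq_append[of "Suc n" "15 * Suc n" "5 * Suc n"]
    by (simp del: upt_Suc)
  moreover have "process ?Q (xs @ ys) = (\<lambda>s. bind_pmf (process ?Q xs s) (process ?Q ys))" for xs ys
    by (rule ext) (rule process_append)
  ultimately show ?thesis
    by (simp only: 1 2 3)
qed

end

context split_two_class begin

lemma grid_chain_lower_bound:
  assumes e: "r0 \<in> on_types H" "j0 \<in> offline H" "0 < x r0 j0" and \<epsilon>: "0 < \<epsilon>"
  shows "\<forall>\<^sub>F n in sequentially. 129 / 200 * x r0 j0 - 3 * \<epsilon> \<le> mean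
    (process (\<lambda>k. cell_kernel (rate G) (type_list G) (1 / real (20 * Suc n))
      (\<lambda>i. serve_arrival i (real (Suc k) / real (20 * Suc n)))) [0..<20 * Suc n] ({}, {}))
    (\<lambda>s. matched r0 j0 (snd s))"
proof -
  let ?Q = "\<lambda>h t (_ :: nat). cell_kernel (rate G) (type_list G) h (\<lambda>i. serve_arrival i t)"
  obtain d1 where d1: "0 < d1" "\<forall>h xs s. 0 < h \<longrightarrow> h < d1 \<longrightarrow> real (length xs) * h = 1 / 20 - 0 \<longrightarrow> s \<in> early_states \<longrightarrow>
    initial_value r0 j0 0 (snd s) - \<epsilon> \<le> mean (process (?Q h (1 / 20)) xs s)
      (\<lambda>s. initial_value r0 j0 (1 / 20) (snd s))"
    using initial_chain[OF e(1,2) \<epsilon>] by (elim exE conjE) (rule that)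
  obtain d2 where d2: "0 < d2" "\<forall>h xs s. 0 < h \<longrightarrow> h < d2 \<longrightarrow> real (length xs) * h = 3 / 4 - 1 / 20 \<longrightarrow> s \<in> early_states \<longrightarrow>
    mid_value r0 j0 (1 / 20) (snd s) - \<epsilon> \<le> mean (process (?Q h (3 / 4)) xs s)
      (\<lambda>s. mid_value r0 j0 (3 / 4) (snd s))"
    using mid_chain[OF e(1,2) \<epsilon>] by (elim exE conjE) (rule that)
  obtain d3 where d3: "0 < d3" "\<forall>h xs s. 0 < h \<longrightarrow> h < d3 \<longrightarrow> real (length xs) * h = 1 - 3 / 4 \<longrightarrow> s \<in> states \<longrightarrow>
    late_value r0 j0 (3 / 4) (fst s) (snd s) - \<epsilon> \<le> mean (process (?Q h 1) xs s)
      (\<lambda>s. late_value r0 j0 1 (fst s) (snd s))"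
    using late_chain[OF e(1,2) \<epsilon>] by (elim exE conjE) (rule that)
  have "(\<lambda>n. 1 / real (20 * Suc n)) \<longlonglongrightarrow> 0"
    by real_asymp
  then have "\<forall>\<^sub>F n in sequentially. 1 / real (20 * Suc n) < min d1 (min d2 d3)"
    by (rule order_tendstoD) (use d1 d2 d3 in auto)
  then show ?thesis
  proof eventually_elim
    case (elim n)
    define h where "h = 1 / real (20 * Suc n)"
    have h: "0 < h" "h < d1" "h < d2" "h < d3"
      using elim unfolding h_def by auto
    have len: "real (length [0..<Suc n]) * h = 1 / 20 - 0"
      "real (length [Suc n..<15 * Suc n]) * h = 3 / 4 - 1 / 20"
      "real (length [15 * Suc n..<20 * Suc n]) * h = 1 - 3 / 4"
      unfolding h_def by (simp_all add: field_simps of_nat_diff)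
    define P1 where "P1 = process (?Q h (1 / 20)) [0..<Suc n]"
    define P2 where "P2 = process (?Q h (3 / 4)) [Suc n..<15 * Suc n]"
    define P3 where "P3 = process (?Q h 1) [15 * Suc n..<20 * Suc n]"
    have in_type: "i \<in> on_types G" if "i \<in> set (type_list G)" for i
      using that set_type_list by simp
    have sP1: "set_pmf (P1 s) \<subseteq> early_states" if "s \<in> early_states" for s
      unfolding P1_def by (intro set_pmf_process set_pmf_cell_kernel set_msm_kernel_early in_type that) auto
    have sP2: "set_pmf (P2 s) \<subseteq> early_states" if "s \<in> early_states" for s
      unfolding P2_def by (intro set_pmf_process set_pmf_cell_kernel set_msm_kernel_early in_type that) auto
    have sP3: "set_pmf (P3 s) \<subseteq> states" if "s \<in> states" for s
      unfolding P3_def by (intro set_pmf_process set_pmf_cell_kernel set_msm_kernel in_type that) auto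
    have b3: "mid_value r0 j0 (3 / 4) (snd s) - \<epsilon> \<le> mean (P3 s) (\<lambda>s. matched r0 j0 (snd s))"
      if s: "s \<in> early_states" for s
    proof -
      have "mid_value r0 j0 (3 / 4) (snd s) \<le> late_value r0 j0 (3 / 4) (fst s) (snd s)"
        using mid_value_le_late_value[OF e] s unfolding early_states_def by auto
      moreover have "late_value r0 j0 (3 / 4) (fst s) (snd s) - \<epsilon> \<le> mean (P3 s)
          (\<lambda>s. late_value r0 j0 1 (fst s) (snd s))"
        unfolding P3_def by (rule d3(2)[rule_format]) (use h len s early_states_subset in auto)
      moreover have "late_value r0 j0 1 m1 m = matched r0 j0 m" for m1 m
        unfolding late_value_def late_profile_def by simp
      ultimately show ?thesis by simp
    qed
    have b2: "initial_value r0 j0 (1 / 20) (snd s) - 2 * \<epsilon> \<le>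
        mean (bind_pmf (P2 s) P3) (\<lambda>s. matched r0 j0 (snd s))" if s: "s \<in> early_states" for s
    proof -
      have "mean (P2 s) (\<lambda>s. mid_value r0 j0 (3 / 4) (snd s)) - \<epsilon> \<le>
          mean (bind_pmf (P2 s) P3) (\<lambda>s. matched r0 j0 (snd s))"
      proof (rule expectation_bind_ge[OF finite_states(2) finite_states(1) sP2[OF s] _ b3])
        show "set_pmf (P3 s) \<subseteq> states" if "s \<in> early_states" for s
          by (rule sP3) (use that early_states_subset in auto)
      qed
      moreover have "mid_value r0 j0 (1 / 20) (snd s) - \<epsilon> \<le>
          mean (P2 s) (\<lambda>s. mid_value r0 j0 (3 / 4) (snd s))"
        unfolding P2_def by (rule d2(2)[rule_format]) (use h len s in auto)
      ultimately show ?thesis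
        unfolding initial_value_at_early_boundary[OF e(2)] by simp
    qed
    have s0: "({}, {}) \<in> early_states" unfolding early_states_def by auto
    have "mean (P1 ({}, {})) (\<lambda>s. initial_value r0 j0 (1 / 20) (snd s)) - 2 * \<epsilon> \<le>
        mean (bind_pmf (P1 ({}, {})) (\<lambda>s. bind_pmf (P2 s) P3)) (\<lambda>s. matched r0 j0 (snd s))"
    proof (rule expectation_bind_ge[OF finite_states(2) finite_states(1) sP1[OF s0] _ b2])
      show "set_pmf (bind_pmf (P2 s) P3) \<subseteq> states" if "s \<in> early_states" for s
      proof -
        have "set_pmf (P3 t) \<subseteq> states" if "t \<in> set_pmf (P2 s)" for t
          by (rule sP3) (use that sP2[OF \<open>s \<in> early_states\<close>] early_states_subset in auto)
        then show ?thesis by (simp add: UN_least)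
      qed
    qed
    moreover have "initial_value r0 j0 0 {} - \<epsilon> \<le>
        mean (P1 ({}, {})) (\<lambda>s. initial_value r0 j0 (1 / 20) (snd s))"
      unfolding P1_def using d1(2)[rule_format, OF h(1,2) len(1) s0] by simp
    moreover have "129 / 200 * x r0 j0 \<le> initial_value r0 j0 0 {}"
      using initial_value_bound[OF e] by simp
    ultimately show ?case
      unfolding h_def[symmetric] using grid_chain_split[OF h_def, of "({}, {})"]
      unfolding h_def[symmetric] P1_def P2_def P3_def by simp
  qed
qed

lemma
  assumes arr: "poisson_arrivals M G A" and e: "r0 \<in> on_types H" "j0 \<in> offline H"
  shows integrable_msm_matched: "integrable M (\<lambda>\<omega>.
      mean (msm (1 / 20) (3 / 4) G H x (\<lambda>i. A i \<omega>)) (matched r0 j0))"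
    and msm_matched_probability: "129 / 200 * x r0 j0 \<le>
      (\<integral>\<omega>. mean (msm (1 / 20) (3 / 4) G H x (\<lambda>i. A i \<omega>)) (matched r0 j0) \<partial>M)"
proof -
  interpret prob_space M using arr unfolding poisson_arrivals_def by simp
  interpret poisson_types M "type_list G" "rate G" A
    by unfold_locales (use arr set_type_list distinct_type_list rate_unsplit_pos in \<open>auto simp: poisson_arrivals_def\<close>)
  let ?f = "\<lambda>\<omega>. mean (msm (1 / 20) (3 / 4) G H x (\<lambda>i. A i \<omega>)) (matched r0 j0)"
  have f: "?f = driven serve_arrival ({}, {}) (\<lambda>s. matched r0 j0 (snd s))"
    unfolding driven_def msm_eq_process arrivals_def by simp
  have N: "filterlim (\<lambda>n. 20 * Suc n) at_top sequentially" "\<And>n. 0 < 20 * Suc n"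
    by (rule filterlim_subseq) (auto simp: strict_mono_def)
  have K: "set_pmf (serve_arrival i t s) \<subseteq> states" if "i \<in> set (type_list G)" "s \<in> states" for i t s
    using that set_msm_kernel set_type_list by blast
  have s0: "({}, {}) \<in> states" unfolding states_def by simp
  show int: "integrable M ?f"
    unfolding f by (rule integrable_driven[where K = serve_arrival and N = "\<lambda>n. 20 * Suc n", OF finite_states(1) K s0 N])
      (assumption | rule kernel_grid)+
  have lim: "(\<lambda>n. mean
    (process (\<lambda>k. cell_kernel (rate G) (type_list G) (1 / real (20 * Suc n))
      (\<lambda>i. serve_arrival i (real (Suc k) / real (20 * Suc n)))) [0..<20 * Suc n] ({}, {}))
    (\<lambda>s. matched r0 j0 (snd s))) \<longlonglongrightarrow> (\<integral>\<omega>. ?f \<omega> \<partial>M)"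
    unfolding f by (rule discretized_chain_tendsto[where K = serve_arrival and N = "\<lambda>n. 20 * Suc n", OF finite_states(1) K s0 N])
      (assumption | rule kernel_grid)+
  show "129 / 200 * x r0 j0 \<le> (\<integral>\<omega>. ?f \<omega> \<partial>M)"
  proof (cases "x r0 j0 = 0")
    case True
    have "0 \<le> (\<integral>\<omega>. ?f \<omega> \<partial>M)"
      by (intro integral_nonneg_AE AE_I2) (auto simp: matched_def intro!: integral_nonneg_AE)
    then show ?thesis using True by simp
  next
    case False
    then have "0 < x r0 j0" using x_nonneg[of r0 j0] by simp
    show ?thesis
    proof (rule field_le_epsilon)
      fix \<epsilon> :: real assume "0 < \<epsilon>"
      then have "0 < \<epsilon> / 3" by simp
      have "129 / 200 * x r0 j0 - 3 * (\<epsilon> / 3) \<le> (\<integral>\<omega>. ?f \<omega> \<partial>M)"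
        by (rule tendsto_lowerbound[OF lim grid_chain_lower_bound[OF e \<open>0 < x r0 j0\<close> \<open>0 < \<epsilon> / 3\<close>]]) simp
      then show "129 / 200 * x r0 j0 \<le> (\<integral>\<omega>. ?f \<omega> \<partial>M) + \<epsilon>" by simp
    qed
  qed
qed

lemma set_msm:
  assumes "\<And>i. i \<in> on_types G \<Longrightarrow> finite (T i)"
  shows "set_pmf (msm t0 t1 G H x T) \<subseteq> Pow (edges H)"
proof -
  have "set_pmf (process (\<lambda>(i, t). msm_kernel t0 t1 i t) (arrivals G T) ({}, {})) \<subseteq> states"
  proof (rule set_pmf_process)
    show "set_pmf ((case a of (i, t) \<Rightarrow> msm_kernel t0 t1 i t) s) \<subseteq> states"
      if "a \<in> set (arrivals G T)" "s \<in> states" for a s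
    proof -
      obtain i t where a: "a = (i, t)" by (cases a)
      have "i \<in> on_types G"
        using that(1) set_type_list assms unfolding a arrivals_def by auto
      from set_msm_kernel[OF this that(2)] show ?thesis unfolding a by simp
    qed
  qed (simp add: states_def)
  then have "snd ` set_pmf (process (\<lambda>(i, t). msm_kernel t0 t1 i t) (arrivals G T) ({}, {})) \<subseteq> snd ` states"
    by (rule image_mono)
  also have "\<dots> \<subseteq> Pow (edges H)"
    unfolding states_def by auto
  finally show ?thesis
    unfolding msm_eq_process set_map_pmf .
qed

lemma msm_expected_weight_lower_bound:
  assumes arr: "poisson_arrivals M G A"
  shows "129 / 200 * frac_weight H x \<le> msm_expected_weight (1 / 20) (3 / 4) G H x M A"
proof -
  interpret prob_space M using arr unfolding poisson_arrivals_def by simp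
  let ?p = "\<lambda>\<omega>. msm (1 / 20) (3 / 4) G H x (\<lambda>i. A i \<omega>)"
  have w: "0 \<le> weight H r j" if "(r, j) \<in> edges H" for r j
    using that valid unfolding valid_osm_def by auto
  have eq: "mean (?p \<omega>) (matched_weight H) =
      (\<Sum>(r, j)\<in>edges H. weight H r j * mean (?p \<omega>) (matched r j))" if "\<omega> \<in> space M" for \<omega>
  proof -
    have fin: "finite (A i \<omega>)" if "i \<in> on_types G" for i
      using arr that \<open>\<omega> \<in> space M\<close> unfolding poisson_arrivals_def poisson_process_def by blast
    have sub: "set_pmf (?p \<omega>) \<subseteq> Pow (edges H)" by (rule set_msm[OF fin])
    have int: "integrable (measure_pmf (?p \<omega>)) f" for f :: "_ \<Rightarrow> real"
      by (rule integrable_finite_support[OF _ sub]) (use finite_edges in simp)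
    have "mean (?p \<omega>) (matched_weight H) =
        mean (?p \<omega>) (\<lambda>m. \<Sum>(r, j)\<in>edges H. weight H r j * matched r j m)"
    proof (rule integral_cong_AE)
      show "AE m in measure_pmf (?p \<omega>). matched_weight H m = (\<Sum>(r, j)\<in>edges H. weight H r j * matched r j m)"
        unfolding AE_measure_pmf_iff
      proof
        fix m assume "m \<in> set_pmf (?p \<omega>)"
        then have "m \<subseteq> edges H" using sub by auto
        then show "matched_weight H m = (\<Sum>(r, j)\<in>edges H. weight H r j * matched r j m)"
          unfolding matched_weight_def matched_def
          by (intro sum.mono_neutral_cong_left) (use finite_edges in auto)
      qed
    qed auto
    also have "\<dots> = (\<Sum>(r, j)\<in>edges H. weight H r j * mean (?p \<omega>) (matched r j))"
      unfolding case_prod_beta' by (subst Bochner_Integration.integral_sum) (auto intro: int)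
    finally show ?thesis .
  qed
  have "129 / 200 * frac_weight H x = (\<Sum>(r, j)\<in>edges H. weight H r j * (129 / 200 * x r j))"
    unfolding frac_weight_def by (simp add: sum_distrib_left case_prod_beta' algebra_simps)
  also have "\<dots> \<le> (\<Sum>(r, j)\<in>edges H. weight H r j * (\<integral>\<omega>. mean (?p \<omega>) (matched r j) \<partial>M))"
  proof (rule sum_mono)
    fix v assume v: "v \<in> edges H"
    then obtain r j where rj: "v = (r, j)" "r \<in> on_types H" "j \<in> offline H" using edges_subset by auto
    show "(case v of (r, j) \<Rightarrow> weight H r j * (129 / 200 * x r j)) \<le>
      (case v of (r, j) \<Rightarrow> weight H r j * (\<integral>\<omega>. mean (?p \<omega>) (matched r j) \<partial>M))"
      unfolding rj(1) prod.case
      by (rule mult_left_mono[OF msm_matched_probability[OF arr rj(2,3)]]) (use w v rj(1) in simp)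
  qed
  also have "\<dots> = (\<integral>\<omega>. (\<Sum>(r, j)\<in>edges H. weight H r j * mean (?p \<omega>) (matched r j)) \<partial>M)"
    unfolding case_prod_beta'
    by (subst Bochner_Integration.integral_sum)
      (use integrable_msm_matched[OF arr] edges_subset in auto)
  also have "\<dots> = msm_expected_weight (1 / 20) (3 / 4) G H x M A"
    unfolding msm_expected_weight_def by (rule Bochner_Integration.integral_cong) (auto simp: eq)
  finally show ?thesis .
qed

end

section \<open>The offline optimum and the linear program\<close>

lemma poisson_mean:
  assumes l: "0 < l"
  shows "integrable (measure_pmf (poisson_pmf l)) real" "mean (poisson_pmf l) real = l"
proof -
  have "(\<lambda>n. l ^ n / fact n) sums exp l"
    using exp_converges[of l] by (simp add: divide_inverse mult.commute)
  then have "(\<lambda>n. (l * exp (- l)) * (l ^ n / fact n)) sums ((l * exp (- l)) * exp l)"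
    by (rule sums_mult)
  then have "(\<lambda>n. real (Suc n) * pmf (poisson_pmf l) (Suc n)) sums l"
    using l by (simp add: exp_minus field_simps del: of_nat_Suc)
  then have s: "(\<lambda>n. real n * pmf (poisson_pmf l) n) sums l"
    by (subst (asm) sums_Suc_iff) simp
  have "(\<integral>\<^sup>+n. ennreal (real n) \<partial>measure_pmf (poisson_pmf l)) =
      (\<integral>\<^sup>+n. ennreal (real n * pmf (poisson_pmf l) n) \<partial>count_space UNIV)"
    by (simp add: nn_integral_measure_pmf ennreal_mult mult.commute)
  also have "\<dots> = ennreal l"
    unfolding nn_integral_count_space_nat by (rule suminf_ennreal_eq[OF _ s]) simp
  finally have nn: "(\<integral>\<^sup>+n. ennreal (real n) \<partial>measure_pmf (poisson_pmf l)) = ennreal l" .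
  show "integrable (measure_pmf (poisson_pmf l)) real"
    by (rule integrableI_nonneg) (use nn in auto)
  show "mean (poisson_pmf l) real = l"
    using nn l by (subst integral_eq_nn_integral) auto
qed

text \<open>Only the number of arrivals of each type matters for the optimum; choosing an optimal edge set as a
  function of these counts makes the choice measurable.\<close>

definition degree_feasible :: "('i, 'j) osm \<Rightarrow> ('i \<Rightarrow> nat) \<Rightarrow> ('i \<times> 'j) set \<Rightarrow> bool" where
  "degree_feasible G c y \<longleftrightarrow> y \<subseteq> edges G \<and> (\<forall>i\<in>on_types G. card {j. (i, j) \<in> y} \<le> c i) \<and>
     (\<forall>j. card {i. (i, j) \<in> y} \<le> 1)"

definition edge_weight :: "('i, 'j) osm \<Rightarrow> ('i \<times> 'j) set \<Rightarrow> real" where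
  "edge_weight G y = (\<Sum>(i, j)\<in>y. weight G i j)"

definition best_edges :: "('i, 'j) osm \<Rightarrow> ('i \<Rightarrow> nat) \<Rightarrow> ('i \<times> 'j) set" where
  "best_edges G c = (SOME y. degree_feasible G c y \<and> (\<forall>y'. degree_feasible G c y' \<longrightarrow> edge_weight G y' \<le> edge_weight G y))"

lemma best_edges:
  assumes "valid_osm G"
  shows "degree_feasible G c (best_edges G c)"
    "degree_feasible G c y \<Longrightarrow> edge_weight G y \<le> edge_weight G (best_edges G c)"
proof -
  have fe: "finite (edges G)"
    using assms finite_subset[of "edges G" "on_types G \<times> offline G"] unfolding valid_osm_def by auto
  let ?F = "{y. degree_feasible G c y}"
  have fin: "finite ?F"
    by (rule finite_subset[of _ "Pow (edges G)"]) (use fe in \<open>auto simp: degree_feasible_def\<close>)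
  have "{} \<in> ?F" unfolding degree_feasible_def by simp
  then have "Max (edge_weight G ` ?F) \<in> edge_weight G ` ?F"
    using fin by (intro Max_in) auto
  then obtain y0 where "y0 \<in> ?F" "Max (edge_weight G ` ?F) = edge_weight G y0" by auto
  moreover have "edge_weight G y' \<le> Max (edge_weight G ` ?F)" if "y' \<in> ?F" for y'
    using fin that by (intro Max_ge) auto
  ultimately have "\<exists>y. degree_feasible G c y \<and> (\<forall>y'. degree_feasible G c y' \<longrightarrow> edge_weight G y' \<le> edge_weight G y)"
    by auto
  from someI_ex[OF this]
  show "degree_feasible G c (best_edges G c)"
    "degree_feasible G c y \<Longrightarrow> edge_weight G y \<le> edge_weight G (best_edges G c)"
    unfolding best_edges_def by blast+
qed

lemma matching_edges_degree_feasible: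
  assumes T: "\<And>i. i \<in> on_types G \<Longrightarrow> finite (T i)" and G: "valid_osm G" and m: "is_matching G T m"
  defines "y \<equiv> (\<lambda>((i, t), j). (i, j)) ` m"
  shows "degree_feasible G (\<lambda>i. card (T i)) y" "(\<Sum>((i, t), j)\<in>m. weight G i j) = edge_weight G y"
proof -
  have sub: "(i, t) \<in> online_vertices G T \<and> (i, j) \<in> edges G" if "((i, t), j) \<in> m" for i t j
    using m that unfolding is_matching_def by auto
  have fe: "finite (edges G)"
    using G finite_subset[of "edges G" "on_types G \<times> offline G"] unfolding valid_osm_def by auto
  have injs: "inj_on snd m" and injf: "inj_on fst m"
    using m unfolding is_matching_def by auto
  have "inj_on (\<lambda>((i, t), j). (i, j)) m"
    using injs unfolding inj_on_def by (metis (mono_tags, lifting) case_prod_beta' snd_conv)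
  then show "(\<Sum>((i, t), j)\<in>m. weight G i j) = edge_weight G y"
    unfolding y_def edge_weight_def by (subst sum.reindex) (auto intro!: sum.cong)
  show "degree_feasible G (\<lambda>i. card (T i)) y"
    unfolding degree_feasible_def
  proof (intro conjI ballI allI)
    show "y \<subseteq> edges G" unfolding y_def using sub by auto
    then have fy: "finite y" using fe finite_subset by blast
    show "card {j. (i, j) \<in> y} \<le> card (T i)" if i: "i \<in> on_types G" for i
    proof -
      let ?mi = "{e \<in> m. fst (fst e) = i}"
      have tm: "fst ` ?mi \<subseteq> {i} \<times> T i"
        using sub unfolding online_vertices_def by fastforce
      have ft: "finite ({i} \<times> T i)" using T[OF i] by simp
      have inj: "inj_on fst ?mi" by (rule inj_on_subset[OF injf]) auto
      then have fm: "finite ?mi" using finite_subset[OF tm ft] finite_imageD by blast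
      have "{j. (i, j) \<in> y} = snd ` ?mi"
        unfolding y_def by force
      then have "card {j. (i, j) \<in> y} \<le> card ?mi"
        using card_image_le[OF fm] by simp
      also have "\<dots> = card (fst ` ?mi)" by (rule card_image[OF inj, symmetric])
      also have "\<dots> \<le> card ({i} \<times> T i)" by (rule card_mono[OF ft tm])
      finally show ?thesis by (simp add: card_cartesian_product)
    qed
    show "card {i. (i, j) \<in> y} \<le> 1" for j
    proof -
      have "finite {i. (i, j) \<in> y}"
        by (rule finite_subset[of _ "fst ` y"]) (use fy in force)+
      moreover have "i = i'" if "(i, j) \<in> y" "(i', j) \<in> y" for i i'
        using that injs unfolding y_def inj_on_def by force
      ultimately show ?thesis by (simp add: card_le_Suc0_iff_eq)
    qed
  qed
qed

lemma offline_opt_le_best_edges: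
  assumes T: "\<And>i. i \<in> on_types G \<Longrightarrow> finite (T i)" and G: "valid_osm G"
    and c: "\<And>i. i \<in> on_types G \<Longrightarrow> c i = card (T i)"
  shows "offline_opt G T \<le> edge_weight G (best_edges G c)"
proof -
  have fe: "finite (edges G)" and fo: "finite (on_types G)" "finite (offline G)"
    using G finite_subset[of "edges G" "on_types G \<times> offline G"] unfolding valid_osm_def by auto
  let ?W = "\<lambda>m. \<Sum>((i, t), j)\<in>m. weight G i j"
  have "online_vertices G T = Sigma (on_types G) T"
    unfolding online_vertices_def by auto
  then have "finite (online_vertices G T)" using fo T by simp
  then have "finite (Pow (online_vertices G T \<times> offline G))" using fo by simp
  moreover have "{m. is_matching G T m} \<subseteq> Pow (online_vertices G T \<times> offline G)"
    using G unfolding is_matching_def valid_osm_def by auto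
  ultimately have fin: "finite {m. is_matching G T m}" using finite_subset by blast
  have ne: "{} \<in> {m. is_matching G T m}" unfolding is_matching_def by simp
  have "offline_opt G T \<in> ?W ` {m. is_matching G T m}"
    unfolding offline_opt_def by (rule Max_in) (use fin ne in auto)
  then obtain m where m: "is_matching G T m" "offline_opt G T = ?W m" by auto
  let ?y = "(\<lambda>((i, t), j). (i, j)) ` m"
  have "degree_feasible G (\<lambda>i. card (T i)) ?y" "?W m = edge_weight G ?y"
    using matching_edges_degree_feasible[OF T G m(1)] by auto
  moreover from this have "degree_feasible G c ?y"
    unfolding degree_feasible_def using c by simp
  ultimately show ?thesis
    using best_edges(2)[OF G] m(2) by metis
qed

locale poisson_instance = prob_space M for M :: "'w measure" +
  fixes G :: "('i, 'j) osm" and A :: "'i \<Rightarrow> 'w \<Rightarrow> real set"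
  assumes valid: "valid_osm G" and arrivals: "poisson_arrivals M G A"
begin

lemma finite_sets: "finite (on_types G)" "finite (offline G)" "finite (edges G)"
  using valid finite_subset[of "edges G" "on_types G \<times> offline G"] unfolding valid_osm_def by auto

lemma edges_subset: "edges G \<subseteq> on_types G \<times> offline G"
  and rate_pos: "i \<in> on_types G \<Longrightarrow> 0 < rate G i"
  using valid unfolding valid_osm_def by auto

definition count :: "'i \<Rightarrow> 'w \<Rightarrow> nat" where
  "count i = arrival_count (A i) 0 1"

lemma poisson: "i \<in> on_types G \<Longrightarrow> poisson_process M (rate G i) (A i)"
  using arrivals unfolding poisson_arrivals_def by blast

lemma count_eq_card: "i \<in> on_types G \<Longrightarrow> \<omega> \<in> space M \<Longrightarrow> count i \<omega> = card (A i \<omega>)"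
  using poisson[of i] unfolding poisson_process_def count_def arrival_count_def by (metis Int_absorb2)

lemma finite_arrivals: "i \<in> on_types G \<Longrightarrow> \<omega> \<in> space M \<Longrightarrow> finite (A i \<omega>)"
  using poisson[of i] unfolding poisson_process_def by blast

lemma count_measurable: "i \<in> on_types G \<Longrightarrow> count i \<in> measurable M (count_space UNIV)"
  using poisson[of i] unfolding poisson_process_def count_def by auto

lemma count_distr: "i \<in> on_types G \<Longrightarrow> distr M (count_space UNIV) (count i) = measure_pmf (poisson_pmf (rate G i))"
proof -
  assume "i \<in> on_types G"
  then have "distr M (count_space UNIV) (count i) = measure_pmf (poisson_pmf (rate G i * (1 - 0)))"
    using poisson[of i] unfolding poisson_process_def count_def by auto
  then show ?thesis by simp
qed

definition chosen :: "'w \<Rightarrow> ('i \<times> 'j) set" where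
  "chosen \<omega> = best_edges G (\<lambda>i\<in>on_types G. count i \<omega>)"

lemma chosen_feasible: "degree_feasible G (\<lambda>i. count i \<omega>) (chosen \<omega>)"
  using best_edges(1)[OF valid, of "\<lambda>i\<in>on_types G. count i \<omega>"] unfolding chosen_def degree_feasible_def by auto

lemma chosen_subset: "chosen \<omega> \<subseteq> edges G"
  using chosen_feasible unfolding degree_feasible_def by blast

definition opt_frac :: "'i \<Rightarrow> 'j \<Rightarrow> real" where
  "opt_frac i j = (\<integral>\<omega>. of_bool ((i, j) \<in> chosen \<omega>) \<partial>M)"

lemma chosen_integrable: "integrable M (\<lambda>\<omega>. of_bool (e \<in> chosen \<omega>) :: real)"
proof (rule integrable_const_bound[where B = 1])
  let ?R = "\<lambda>c. of_bool (e \<in> best_edges G c) :: real"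
  have "(\<lambda>\<omega>. \<lambda>i\<in>on_types G. count i \<omega>) \<in> measurable M (PiM (on_types G) (\<lambda>_. count_space UNIV))"
    by (rule measurable_restrict) (rule count_measurable)
  moreover have "?R \<in> borel_measurable (PiM (on_types G) (\<lambda>_. count_space UNIV))"
    by (rule borel_measurable_PiM_nat[OF finite_sets(1)])
  ultimately show "(\<lambda>\<omega>. of_bool (e \<in> chosen \<omega>) :: real) \<in> borel_measurable M"
    unfolding chosen_def by (rule measurable_compose)
qed auto

lemma offline_opt_integral_le: "(\<integral>\<omega>. offline_opt G (\<lambda>i. A i \<omega>) \<partial>M) \<le> frac_weight G opt_frac"
proof -
  have w: "0 \<le> weight G i j" if "(i, j) \<in> edges G" for i j
    using that valid unfolding valid_osm_def by auto
  have "(\<integral>\<omega>. offline_opt G (\<lambda>i. A i \<omega>) \<partial>M) \<le>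
      (\<integral>\<omega>. (\<Sum>e\<in>edges G. weight G (fst e) (snd e) * of_bool (e \<in> chosen \<omega>)) \<partial>M)"
  proof (rule integral_mono')
    show "integrable M (\<lambda>\<omega>. \<Sum>e\<in>edges G. weight G (fst e) (snd e) * of_bool (e \<in> chosen \<omega>))"
      by (intro Bochner_Integration.integrable_sum integrable_mult_right chosen_integrable)
    show "0 \<le> (\<Sum>e\<in>edges G. weight G (fst e) (snd e) * of_bool (e \<in> chosen \<omega>))" for \<omega>
      by (rule sum_nonneg) (use w in auto)
    fix \<omega> assume \<omega>: "\<omega> \<in> space M"
    have "offline_opt G (\<lambda>i. A i \<omega>) \<le> edge_weight G (chosen \<omega>)"
      unfolding chosen_def
      by (rule offline_opt_le_best_edges[OF _ valid]) (use finite_arrivals \<omega> count_eq_card in auto)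
    also have "\<dots> = (\<Sum>e\<in>edges G. weight G (fst e) (snd e) * of_bool (e \<in> chosen \<omega>))"
      unfolding edge_weight_def case_prod_beta'
      by (rule sum.mono_neutral_cong_left) (use finite_sets chosen_subset in auto)
    finally show "offline_opt G (\<lambda>i. A i \<omega>) \<le> \<dots>" .
  qed
  also have "\<dots> = (\<Sum>e\<in>edges G. weight G (fst e) (snd e) * (\<integral>\<omega>. of_bool (e \<in> chosen \<omega>) \<partial>M))"
    by (subst Bochner_Integration.integral_sum) (auto intro!: integrable_mult_right chosen_integrable)
  finally show ?thesis
    unfolding frac_weight_def opt_frac_def by (simp add: case_prod_beta')
qed

lemma sum_opt_frac:
  assumes "finite S"
  shows "(\<Sum>e\<in>S. opt_frac (f e) (g e)) = (\<integral>\<omega>. (\<Sum>e\<in>S. of_bool ((f e, g e) \<in> chosen \<omega>)) \<partial>M)"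
    "integrable M (\<lambda>\<omega>. (\<Sum>e\<in>S. of_bool ((f e, g e) \<in> chosen \<omega>)) :: real)"
  unfolding opt_frac_def by (auto intro!: chosen_integrable Bochner_Integration.integral_sum[symmetric])

lemma row_sum: 
  assumes i: "i \<in> on_types G"
  shows "(\<Sum>j\<in>offline G. opt_frac i j) \<le> rate G i"
proof -
  have mean: "integrable M (\<lambda>\<omega>. real (count i \<omega>))" "(\<integral>\<omega>. real (count i \<omega>) \<partial>M) = rate G i"
    using poisson_mean[OF rate_pos[OF i]] unfolding count_distr[OF i, symmetric]
    by (simp_all add: integrable_distr_eq[OF count_measurable[OF i]] integral_distr[OF count_measurable[OF i]])
  have "(\<Sum>j\<in>offline G. opt_frac i j) \<le> (\<integral>\<omega>. real (count i \<omega>) \<partial>M)"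
    unfolding sum_opt_frac(1)[OF finite_sets(2)]
  proof (rule integral_mono[OF sum_opt_frac(2)[OF finite_sets(2)] mean(1)])
    fix \<omega>
    have "{j. (i, j) \<in> chosen \<omega>} = {j \<in> offline G. (i, j) \<in> chosen \<omega>}"
      using chosen_subset edges_subset by auto
    moreover have "card {j. (i, j) \<in> chosen \<omega>} \<le> count i \<omega>"
      using chosen_feasible i unfolding degree_feasible_def by blast
    ultimately show "(\<Sum>j\<in>offline G. of_bool ((i, j) \<in> chosen \<omega>)) \<le> real (count i \<omega>)"
      using finite_sets(2) by (simp add: sum_of_bool_eq Collect_conj_eq)
  qed
  then show ?thesis unfolding mean(2) .
qed

lemma chosen_column:
  fixes j :: 'j and \<omega> :: 'w
  assumes "S \<subseteq> on_types G"
  shows "(\<Sum>i\<in>S. of_bool ((i, j) \<in> chosen \<omega>)) \<le> (1 :: real)"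
proof -
  have fin: "finite {i. (i, j) \<in> chosen \<omega>}"
    by (rule finite_subset[OF _ finite_sets(1)]) (use chosen_subset edges_subset in auto)
  have "card (S \<inter> {i. (i, j) \<in> chosen \<omega>}) \<le> card {i. (i, j) \<in> chosen \<omega>}"
    by (rule card_mono[OF fin]) auto
  also have "\<dots> \<le> 1" using chosen_feasible unfolding degree_feasible_def by blast
  finally show ?thesis
    using finite_subset[OF assms finite_sets(1)] by (simp add: sum_of_bool_eq)
qed

lemma column_sum: "(\<Sum>i\<in>on_types G. opt_frac i j) \<le> 1"
proof -
  have "(\<Sum>i\<in>on_types G. opt_frac i j) \<le> (\<integral>\<omega>. 1 \<partial>M)"
    unfolding sum_opt_frac(1)[OF finite_sets(1)]
    by (rule integral_mono[OF sum_opt_frac(2)[OF finite_sets(1)]]) (use chosen_column in auto)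
  then show ?thesis by (simp add: prob_space)
qed

lemma prob_no_arrivals:
  assumes S: "S \<subseteq> on_types G" "S \<noteq> {}"
  shows "prob (\<Inter>i\<in>S. {\<omega> \<in> space M. count i \<omega> = 0}) = exp (- (\<Sum>i\<in>S. rate G i))"
proof -
  have fin: "finite S" using S finite_sets finite_subset by blast
  have "prob (\<Inter>i\<in>S. {\<omega> \<in> space M. count i \<omega> = 0}) = (\<Prod>i\<in>S. prob {\<omega> \<in> space M. count i \<omega> = 0})"
  proof (rule indep_setsD[OF _ S(1) S(2) fin])
    show "indep_sets (\<lambda>i. process_algebra M (A i)) (on_types G)"
      using arrivals unfolding poisson_arrivals_def by blast
    show "\<forall>i\<in>S. {\<omega> \<in> space M. count i \<omega> = 0} \<in> process_algebra M (A i)"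
    proof
      fix i
      have "{\<omega> \<in> space M. arrival_count (A i) 0 1 \<omega> = 0}
        \<in> {{\<omega> \<in> space M. arrival_count (A i) s t \<omega> = n} | s t n. 0 \<le> s \<and> s \<le> t \<and> t \<le> 1}"
        by force
      then show "{\<omega> \<in> space M. count i \<omega> = 0} \<in> process_algebra M (A i)"
        unfolding count_def process_algebra_def by (rule sigma_sets.Basic)
    qed
  qed
  also have "\<dots> = (\<Prod>i\<in>S. exp (- rate G i))"
  proof (rule prod.cong[OF refl])
    fix i assume "i \<in> S"
    then have i: "i \<in> on_types G" using S by auto
    have "prob {\<omega> \<in> space M. count i \<omega> = 0} = measure (distr M (count_space UNIV) (count i)) {0}"
      by (subst measure_distr[OF count_measurable[OF i]]) (auto intro!: arg_cong[where f = prob])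
    then show "prob {\<omega> \<in> space M. count i \<omega> = 0} = exp (- rate G i)"
      unfolding count_distr[OF i] using rate_pos[OF i] by (simp add: measure_pmf_single)
  qed
  also have "\<dots> = exp (- (\<Sum>i\<in>S. rate G i))"
    using fin by (simp add: exp_sum sum_negf[symmetric])
  finally show ?thesis .
qed

lemma column_subset_sum:
  assumes S: "S \<subseteq> on_types G" "S \<noteq> {}"
  shows "(\<Sum>i\<in>S. opt_frac i j) \<le> 1 - exp (- (\<Sum>i\<in>S. rate G i))"
proof -
  have fin: "finite S" using S finite_sets finite_subset by blast
  let ?N = "\<Inter>i\<in>S. {\<omega> \<in> space M. count i \<omega> = 0}"
  have N: "?N \<in> events"
  proof (rule sets.finite_INT[OF fin S(2)])
    fix i assume "i \<in> S"
    then have "count i -` {0} \<inter> space M \<in> events"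
      using S count_measurable by (intro measurable_sets[where A = "count_space UNIV"]) auto
    then show "{\<omega> \<in> space M. count i \<omega> = 0} \<in> events"
      by (simp add: vimage_def Int_def conj_commute)
  qed
  have "(\<Sum>i\<in>S. opt_frac i j) \<le> (\<integral>\<omega>. 1 - indicator ?N \<omega> \<partial>M)"
    unfolding sum_opt_frac(1)[OF fin]
  proof (rule integral_mono[OF sum_opt_frac(2)[OF fin]])
    show "integrable M (\<lambda>\<omega>. 1 - indicator ?N \<omega> :: real)"
      using N by (intro Bochner_Integration.integrable_diff) (auto simp: emeasure_eq_measure)
    fix \<omega>
    show "(\<Sum>i\<in>S. of_bool ((i, j) \<in> chosen \<omega>)) \<le> (1 - indicator ?N \<omega> :: real)"
    proof (cases "\<omega> \<in> ?N")
      case True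
      have "(i, j) \<notin> chosen \<omega>" if i: "i \<in> S" for i
      proof
        assume a: "(i, j) \<in> chosen \<omega>"
        have "finite {j. (i, j) \<in> chosen \<omega>}"
          by (rule finite_subset[OF _ finite_sets(2)]) (use chosen_subset edges_subset in auto)
        then have "0 < card {j. (i, j) \<in> chosen \<omega>}" using a by (auto simp: card_gt_0_iff)
        moreover have "card {j. (i, j) \<in> chosen \<omega>} \<le> count i \<omega>"
          using chosen_feasible i S unfolding degree_feasible_def by blast
        moreover have "count i \<omega> = 0" using True i by auto
        ultimately show False by simp
      qed
      then show ?thesis using True by simp
    next
      case False
      then show ?thesis using chosen_column[OF S(1)] by simp
    qed
  qed
  also have "\<dots> = 1 - prob ?N"
    using N by (subst Bochner_Integration.integral_diff) (auto simp: emeasure_eq_measure prob_space)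
  finally show ?thesis unfolding prob_no_arrivals[OF S] .
qed

lemma opt_frac_feasible: "jl_feasible G opt_frac"
  unfolding jl_feasible_def
proof (intro conjI allI ballI impI)
  show "0 \<le> opt_frac i j" for i j
    unfolding opt_frac_def by (rule integral_nonneg_AE) auto
  show "opt_frac i j = 0" if "(i, j) \<notin> edges G" for i j
  proof -
    have "(i, j) \<notin> chosen \<omega>" for \<omega> using chosen_subset that by auto
    then show ?thesis unfolding opt_frac_def by simp
  qed
  show "(\<Sum>j\<in>offline G. opt_frac i j) \<le> rate G i" if "i \<in> on_types G" for i
    by (rule row_sum[OF that])
  show "(\<Sum>i\<in>on_types G. opt_frac i j) \<le> 1" for j by (rule column_sum)
  show "(\<Sum>i\<in>on_types G. max 0 (2 * opt_frac i j - rate G i)) \<le> 1 - ln 2" for j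
  proof -
    define S where "S = {i \<in> on_types G. 0 < 2 * opt_frac i j - rate G i}"
    define L where "L = (\<Sum>i\<in>S. rate G i)"
    have "(\<Sum>i\<in>on_types G. max 0 (2 * opt_frac i j - rate G i)) = (\<Sum>i\<in>S. 2 * opt_frac i j - rate G i)"
      by (rule sum.mono_neutral_cong_right) (use finite_sets in \<open>auto simp: S_def\<close>)
    also have "\<dots> = 2 * (\<Sum>i\<in>S. opt_frac i j) - L"
      unfolding L_def by (simp add: sum_subtractf sum_distrib_left)
    also have "\<dots> \<le> 1 - ln 2"
    proof (cases "S = {}")
      case True
      then show ?thesis using ln_2_less_1 by (simp add: L_def)
    next
      case False
      have "S \<subseteq> on_types G" unfolding S_def by auto
      from column_subset_sum[OF this False, of j]
      have "2 * (\<Sum>i\<in>S. opt_frac i j) \<le> 2 - exp (ln 2 - L)"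
        unfolding L_def by (simp add: exp_diff exp_minus field_simps)
      moreover have "1 + (ln 2 - L) \<le> exp (ln 2 - L)" by (rule exp_ge_add_one_self)
      ultimately show ?thesis by linarith
    qed
    finally show ?thesis .
  qed
qed

end

lemma expected_offline_opt_le:
  assumes "valid_osm G" "jl_optimal G x" "poisson_arrivals M G A"
  shows "(\<integral>\<omega>. offline_opt G (\<lambda>i. A i \<omega>) \<partial>M) \<le> frac_weight G x"
proof -
  interpret prob_space M using assms(3) unfolding poisson_arrivals_def by blast
  interpret poisson_instance M G A by unfold_locales fact+
  show ?thesis
    using offline_opt_integral_le opt_frac_feasible assms(2) unfolding jl_optimal_def by force
qed

lemma poisson_arrivals_dummy_extension:
  assumes ext: "dummy_extension G G'" and arr: "poisson_arrivals M G' A"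
  shows "poisson_arrivals M G (\<lambda>i. A (Orig i))"
proof -
  interpret prob_space M using arr unfolding poisson_arrivals_def by blast
  have T: "Orig ` on_types G \<subseteq> on_types G'" and r: "\<And>i. i \<in> on_types G \<Longrightarrow> rate G' (Orig i) = rate G i"
    using ext unfolding dummy_extension_def by auto
  have ind: "indep_sets (\<lambda>i. process_algebra M (A i)) (on_types G')"
    using arr unfolding poisson_arrivals_def by blast
  have "indep_sets (\<lambda>i. process_algebra M (A (Orig i))) (on_types G)"
  proof (rule indep_setsI)
    show "process_algebra M (A (Orig i)) \<subseteq> events" if "i \<in> on_types G" for i
      using ind T that unfolding indep_sets_def by auto
    fix E J assume J: "J \<noteq> {}" "J \<subseteq> on_types G" "finite J" "\<forall>j\<in>J. E j \<in> process_algebra M (A (Orig j))"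
    define E' where "E' k = (case k of Orig i \<Rightarrow> E i | Dummy _ \<Rightarrow> {})" for k
    have "prob (\<Inter>k\<in>Orig ` J. E' k) = (\<Prod>k\<in>Orig ` J. prob (E' k))"
      by (rule indep_setsD[OF ind]) (use J T in \<open>auto simp: E'_def\<close>)
    then show "prob (\<Inter>j\<in>J. E j) = (\<Prod>j\<in>J. prob (E j))"
      by (simp add: E'_def prod.reindex inj_on_def)
  qed
  then show ?thesis
    using arr T r unfolding poisson_arrivals_def by (metis image_subset_iff)
qed

lemma jl_optimal_exists:
  fixes G :: "('i, 'j) osm"
  assumes G: "valid_osm G"
  shows "\<exists>x. jl_optimal G x"
proof -
  have fe: "finite (edges G)" and fo: "finite (on_types G)" "finite (offline G)"
    and sub: "edges G \<subseteq> on_types G \<times> offline G" and r: "\<And>i. i \<in> on_types G \<Longrightarrow> 0 < rate G i"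
    using G finite_subset[of "edges G" "on_types G \<times> offline G"] unfolding valid_osm_def by auto
  define K where "K = {f :: 'i \<times> 'j \<Rightarrow> real. jl_feasible G (\<lambda>i j. f (i, j))}"
  define Q where "Q = PiE UNIV (\<lambda>e. if e \<in> edges G then {0..1 :: real} else {0})"
  have "compactin (product_topology (\<lambda>_. euclidean) UNIV) Q"
    unfolding Q_def compactin_PiE by (auto simp: compactin_euclidean_iff)
  then have Q: "compact Q"
    unfolding euclidean_product_topology compactin_euclidean_iff .
  have coord: "continuous_on UNIV (\<lambda>f :: 'i \<times> 'j \<Rightarrow> real. f e)" for e
    by (rule continuous_on_product_coordinates)
  have closed: "closed K"
    unfolding K_def jl_feasible_def Ball_def
    by (intro closed_Collect_conj closed_Collect_all closed_Collect_imp open_Collect_const closed_Collect_le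
        closed_Collect_eq continuous_on_const continuous_on_sum continuous_on_max continuous_on_diff
        continuous_on_mult coord)
  have "K \<subseteq> Q"
  proof
    fix f assume f: "f \<in> K"
    have "f (i, j) \<le> 1" if "(i, j) \<in> edges G" for i j
    proof -
      have ij: "i \<in> on_types G" "j \<in> offline G" using that sub by auto
      have "f (i, j) \<le> (\<Sum>i\<in>on_types G. f (i, j))"
        by (rule member_le_sum[where f = "\<lambda>i. f (i, j)"]) (use ij f fo in \<open>auto simp: K_def jl_feasible_def\<close>)
      also have "\<dots> \<le> 1" using f ij by (auto simp: K_def jl_feasible_def)
      finally show ?thesis .
    qed
    then show "f \<in> Q" using f unfolding Q_def K_def jl_feasible_def by (auto simp: PiE_def)
  qed
  then have "compact K"
    using closed Q by (metis compact_Int_closed inf.absorb_iff2)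
  moreover have "(\<lambda>_. 0) \<in> K"
  proof -
    have "(\<Sum>i\<in>on_types G. max 0 (2 * 0 - rate G i)) = 0"
      by (rule sum.neutral) (use r in \<open>auto intro: less_imp_le\<close>)
    then show ?thesis
      unfolding K_def jl_feasible_def using r ln_2_less_1 by (auto intro: less_imp_le)
  qed
  moreover have "continuous_on K (\<lambda>f. frac_weight G (\<lambda>i j. f (i, j)))"
    unfolding frac_weight_def case_prod_beta'
    by (intro continuous_intros continuous_on_subset[OF coord]) auto
  ultimately obtain f where f: "f \<in> K" "\<And>g. g \<in> K \<Longrightarrow> frac_weight G (\<lambda>i j. g (i, j)) \<le> frac_weight G (\<lambda>i j. f (i, j))"
    using continuous_attains_sup[of K "\<lambda>f. frac_weight G (\<lambda>i j. f (i, j))"] by blast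
  have "frac_weight G x' \<le> frac_weight G (\<lambda>i j. f (i, j))" if "jl_feasible G x'" for x'
    using f(2)[of "\<lambda>(i, j). x' i j"] that by (simp add: K_def)
  then have "jl_optimal G (\<lambda>i j. f (i, j))"
    using f(1) unfolding jl_optimal_def K_def by simp
  then show ?thesis by blast
qed

section \<open>Existence of the preprocessed instance\<close>

definition saturated :: "('i, 'j) osm \<Rightarrow> ('i \<Rightarrow> 'j \<Rightarrow> real) \<Rightarrow> bool" where
  "saturated G x \<longleftrightarrow>
     (\<forall>i j. 0 \<le> x i j) \<and> (\<forall>i j. (i, j) \<notin> edges G \<longrightarrow> x i j = 0) \<and>
     (\<forall>i\<in>on_types G. (\<Sum>j\<in>offline G. x i j) = rate G i) \<and>
     (\<forall>j\<in>offline G. (\<Sum>i\<in>on_types G. x i j) = 1) \<and>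
     (\<forall>j\<in>offline G. (\<Sum>i\<in>on_types G. max 0 (2 * x i j - rate G i)) \<le> 1 - ln 2)"

definition overlap :: "real \<Rightarrow> real \<Rightarrow> real \<Rightarrow> real \<Rightarrow> real" where
  "overlap lo hi s t = max 0 (min hi t - max lo s)"

lemma overlap_commute: "overlap lo hi s t = overlap s t lo hi"
  unfolding overlap_def by (simp add: min.commute max.commute)

lemma sum_overlap:
  assumes "\<And>b. v b \<le> v (Suc b)" "v 0 \<le> lo" "lo \<le> hi" "hi \<le> v n"
  shows "(\<Sum>b<n. overlap lo hi (v b) (v (Suc b))) = hi - lo"
proof -
  define clamp where "clamp t = max lo (min hi t)" for t
  have "overlap lo hi (v b) (v (Suc b)) = clamp (v (Suc b)) - clamp (v b)" for b
    using assms(1)[of b] assms(3) unfolding overlap_def clamp_def by (auto simp: min_def max_def)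
  then have "(\<Sum>b<n. overlap lo hi (v b) (v (Suc b))) = clamp (v n) - clamp (v 0)"
    by (simp add: sum_lessThan_telescope[of "\<lambda>b. clamp (v b)"])
  also have "\<dots> = hi - lo"
    using assms unfolding clamp_def by (simp add: min_def max_def)
  finally show ?thesis .
qed

text \<open>Lay the shares \<open>y\<^sub>0, \<dots>, y\<^sub>n\<^sub>-\<^sub>1\<close> of total length \<open>l\<close> side by side on a circle of length \<open>l\<close>. The entry
  \<open>q a b\<close> is the length of the set of points of the first half circle that lie in the \<open>a\<close>-th share while
  their antipode lies in the \<open>b\<close>-th share.\<close>

lemma antipodal_coupling:
  fixes y :: "nat \<Rightarrow> real"
  assumes y: "\<And>a. 0 \<le> y a" and l: "(\<Sum>a<n. y a) = l"
  shows "\<exists>q. (\<forall>a b. 0 \<le> q a b) \<and> (\<forall>a<n. (\<Sum>b<n. q a b) + (\<Sum>b<n. q b a) = y a) \<and>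
    (\<forall>a<n. 2 * q a a = max 0 (2 * y a - l)) \<and> (\<Sum>a<n. \<Sum>b<n. q a b) = l / 2"
proof -
  define h where "h = l / 2"
  define c where "c a = (\<Sum>b<a. y b)" for a
  define u where "u a = min (c a) h" for a
  define v where "v a = max 0 (c a - h)" for a
  define q where "q a b = overlap (u a) (u (Suc a)) (v b) (v (Suc b))" for a b
  have c: "c 0 = 0" "c n = l" "c (Suc a) = c a + y a" for a
    using l by (simp_all add: c_def)
  have c0: "0 \<le> c a" for a unfolding c_def by (intro sum_nonneg y)
  have cl: "c a \<le> l" if "a \<le> n" for a
    unfolding c_def l[symmetric] by (rule sum_mono2) (use that y in auto)
  have h: "0 \<le> h" unfolding h_def l[symmetric] by (simp add: sum_nonneg y)
  have u: "u 0 = 0" "u n = h" "u a \<le> u (Suc a)" "0 \<le> u a" "u a \<le> h" for a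
    using h y[of a] c0[of a] c by (auto simp: u_def h_def)
  have v: "v 0 = 0" "v n = h" "v a \<le> v (Suc a)" "0 \<le> v a" for a
    using h y[of a] c by (auto simp: v_def h_def)
  have vh: "v a \<le> h" if "a \<le> n" for a
    unfolding v_def by (rule max.boundedI) (use cl[OF that] h in \<open>auto simp: h_def\<close>)
  have uv: "u a + v a = c a" for a unfolding u_def v_def by auto
  have row: "(\<Sum>b<n. q a b) = u (Suc a) - u a" for a
    unfolding q_def by (rule sum_overlap) (use u v in auto)
  have col: "(\<Sum>a<n. q a b) = v (Suc b) - v b" if "b < n" for b
    unfolding q_def overlap_commute[of "u _"] by (rule sum_overlap) (use u v vh[of "Suc b"] that in auto)
  have diag: "2 * q a a = max 0 (2 * y a - l)" if "a < n" for a
  proof -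
    have "c a + y a \<le> 2 * h" using cl[of "Suc a"] that c(3) unfolding h_def by simp
    then have "q a a = max 0 (y a - h)"
      using c0[of a] y[of a] h unfolding q_def overlap_def u_def v_def c(3) by (auto simp: min_def max_def)
    then show ?thesis unfolding h_def by (auto simp: max_def)
  qed
  show ?thesis
  proof (intro exI[of _ q] conjI allI impI)
    show "0 \<le> q a b" for a b unfolding q_def overlap_def by simp
    show "(\<Sum>b<n. q a b) + (\<Sum>b<n. q b a) = y a" if "a < n" for a
      unfolding row col[OF that] using uv[of a] uv[of "Suc a"] c(3)[of a] by linarith
    show "2 * q a a = max 0 (2 * y a - l)" if "a < n" for a by (rule diag[OF that])
    show "(\<Sum>a<n. \<Sum>b<n. q a b) = l / 2"
      unfolding row sum_lessThan_telescope u by (simp add: h_def)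
  qed
qed

lemma split_saturated:
  fixes G :: "('i, 'j) osm"
  assumes G: "valid_osm G" and x: "saturated G x"
  shows "\<exists>H z. split_instance G H \<and> two_class_matching H z \<and> frac_weight H z = frac_weight G x"
proof -
  have fe: "finite (edges G)" and fo: "finite (on_types G)" "finite (offline G)"
    and sub: "edges G \<subseteq> on_types G \<times> offline G" and r: "\<And>i. i \<in> on_types G \<Longrightarrow> 0 < rate G i"
    and w: "\<And>i j. (i, j) \<in> edges G \<Longrightarrow> 0 \<le> weight G i j"
    using G finite_subset[of "edges G" "on_types G \<times> offline G"] unfolding valid_osm_def by auto
  have x0: "\<And>i j. 0 \<le> x i j" and xe: "\<And>i j. (i, j) \<notin> edges G \<Longrightarrow> x i j = 0"
    and rows: "\<And>i. i \<in> on_types G \<Longrightarrow> (\<Sum>j\<in>offline G. x i j) = rate G i"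
    and cols: "\<And>j. j \<in> offline G \<Longrightarrow> (\<Sum>i\<in>on_types G. x i j) = 1"
    and jl: "\<And>j. j \<in> offline G \<Longrightarrow> (\<Sum>i\<in>on_types G. max 0 (2 * x i j - rate G i)) \<le> 1 - ln 2"
    using x unfolding saturated_def by auto
  obtain js where js: "distinct js" "set js = offline G"
    using finite_distinct_list[OF fo(2)] by blast
  define n where "n = length js"
  have nth: "js ! a \<in> offline G" if "a < n" for a
    using nth_mem[of a js] that unfolding n_def js(2) by simp
  have index: "\<exists>c<n. j = js ! c" if "j \<in> offline G" for j
    using that in_set_conv_nth[of j js] unfolding n_def js(2) by auto
  have nth_eq: "js ! a = js ! b \<longleftrightarrow> a = b" if "a < n" "b < n" for a b
    using that nth_eq_iff_index_eq[OF js(1)] unfolding n_def by simp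
  have sum_js: "(\<Sum>j\<in>offline G. f j) = (\<Sum>a<n. f (js ! a))" for f :: "'j \<Rightarrow> real"
  proof -
    have "bij_betw (nth js) {..<n} (offline G)"
      unfolding js(2)[symmetric] n_def by (rule bij_betw_nth[OF js(1)]) auto
    then show ?thesis by (rule sum.reindex_bij_betw[symmetric])
  qed
  have "\<forall>i\<in>on_types G. \<exists>q. (\<forall>a b. 0 \<le> q a b) \<and> (\<forall>a<n. (\<Sum>b<n. q a b) + (\<Sum>b<n. q b a) = x i (js ! a)) \<and>
    (\<forall>a<n. 2 * q a a = max 0 (2 * x i (js ! a) - rate G i)) \<and> (\<Sum>a<n. \<Sum>b<n. q a b) = rate G i / 2"
  proof
    fix i assume "i \<in> on_types G"
    then have "(\<Sum>a<n. x i (js ! a)) = rate G i" using rows sum_js[of "x i"] by simp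
    from antipodal_coupling[of "\<lambda>a. x i (js ! a)", OF x0 this]
    show "\<exists>q. (\<forall>a b. 0 \<le> q a b) \<and> (\<forall>a<n. (\<Sum>b<n. q a b) + (\<Sum>b<n. q b a) = x i (js ! a)) \<and>
      (\<forall>a<n. 2 * q a a = max 0 (2 * x i (js ! a) - rate G i)) \<and> (\<Sum>a<n. \<Sum>b<n. q a b) = rate G i / 2" .
  qed
  then obtain q where q: "\<forall>i\<in>on_types G. (\<forall>a b. 0 \<le> q i a b) \<and>
    (\<forall>a<n. (\<Sum>b<n. q i a b) + (\<Sum>b<n. q i b a) = x i (js ! a)) \<and>
    (\<forall>a<n. 2 * q i a a = max 0 (2 * x i (js ! a) - rate G i)) \<and> (\<Sum>a<n. \<Sum>b<n. q i a b) = rate G i / (2 :: real)"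
    by (rule bchoice[THEN exE]) (rule that)
  have q0: "0 \<le> q i a b" if "i \<in> on_types G" for i a b using q that by blast
  have qx: "(\<Sum>b<n. q i a b) + (\<Sum>b<n. q i b a) = x i (js ! a)" if "i \<in> on_types G" "a < n" for i a
    using q that by blast
  have qd: "2 * q i a a = max 0 (2 * x i (js ! a) - rate G i)" if "i \<in> on_types G" "a < n" for i a
    using q that by blast
  have qs: "(\<Sum>a<n. \<Sum>b<n. q i a b) = rate G i / 2" if "i \<in> on_types G" for i
    using q that by blast
  define \<alpha> where "\<alpha> r = fst (prod_decode (snd r))" for r :: "'i \<times> nat"
  define \<beta> where "\<beta> r = snd (prod_decode (snd r))" for r :: "'i \<times> nat"
  define Q where "Q r = q (fst r) (\<alpha> r) (\<beta> r)" for r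
  define I where "I = {r. fst r \<in> on_types G \<and> \<alpha> r < n \<and> \<beta> r < n \<and> 0 < Q r}"
  define H where "H = \<lparr>on_types = I, offline = offline G, edges = {(r, j). r \<in> I \<and> (fst r, j) \<in> edges G},
    rate = (\<lambda>r. 2 * Q r), weight = (\<lambda>r j. weight G (fst r) j)\<rparr>"
  define z where "z r j = (if r \<in> I then Q r * (of_bool (j = js ! \<alpha> r) + of_bool (j = js ! \<beta> r)) else 0)" for r j
  have H: "on_types H = I" "offline H = offline G" "edges H = {(r, j). r \<in> I \<and> (fst r, j) \<in> edges G}"
    "rate H = (\<lambda>r. 2 * Q r)" "weight H = (\<lambda>r j. weight G (fst r) j)"
    unfolding H_def by simp_all
  have I_sub: "I \<subseteq> (\<lambda>(i, a, b). (i, prod_encode (a, b))) ` (on_types G \<times> {..<n} \<times> {..<n})"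
  proof
    fix r assume "r \<in> I"
    then have "(fst r, \<alpha> r, \<beta> r) \<in> on_types G \<times> {..<n} \<times> {..<n}" unfolding I_def by auto
    moreover have "r = (\<lambda>(i, a, b). (i, prod_encode (a, b))) (fst r, \<alpha> r, \<beta> r)"
      unfolding \<alpha>_def \<beta>_def by simp
    ultimately show "r \<in> (\<lambda>(i, a, b). (i, prod_encode (a, b))) ` (on_types G \<times> {..<n} \<times> {..<n})" by blast
  qed
  have fI: "finite I" by (rule finite_subset[OF I_sub]) (use fo in auto)
  have sum_parts: "(\<Sum>r\<in>{r \<in> I. fst r = i}. Q r * f (\<alpha> r) (\<beta> r)) = (\<Sum>a<n. \<Sum>b<n. q i a b * f a b)"
    if i: "i \<in> on_types G" for i and f :: "nat \<Rightarrow> nat \<Rightarrow> real"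
  proof -
    let ?e = "\<lambda>(a, b). (i, prod_encode (a, b))"
    have inj: "inj_on ?e ({..<n} \<times> {..<n})" by (auto simp: inj_on_def)
    have "(\<Sum>r\<in>{r \<in> I. fst r = i}. Q r * f (\<alpha> r) (\<beta> r)) = (\<Sum>r\<in>?e ` ({..<n} \<times> {..<n}). Q r * f (\<alpha> r) (\<beta> r))"
    proof (rule sum.mono_neutral_left)
      show "{r \<in> I. fst r = i} \<subseteq> ?e ` ({..<n} \<times> {..<n})" using I_sub by auto
      show "\<forall>r\<in>?e ` ({..<n} \<times> {..<n}) - {r \<in> I. fst r = i}. Q r * f (\<alpha> r) (\<beta> r) = 0"
        using i q0[OF i] by (auto simp: I_def Q_def \<alpha>_def \<beta>_def not_less intro: antisym)
    qed auto
    also have "\<dots> = (\<Sum>(a, b)\<in>{..<n} \<times> {..<n}. q i a b * f a b)"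
      unfolding sum.reindex[OF inj] by (auto simp: Q_def \<alpha>_def \<beta>_def intro!: sum.cong)
    finally show ?thesis by (simp add: sum.cartesian_product)
  qed
  have z_col: "(\<Sum>r\<in>{r \<in> I. fst r = i}. z r j) = x i j" if i: "i \<in> on_types G" and j: "j \<in> offline G" for i j
  proof -
    obtain c where c: "c < n" "j = js ! c" using index[OF j] by blast
    have "(\<Sum>r\<in>{r \<in> I. fst r = i}. z r j) =
        (\<Sum>r\<in>{r \<in> I. fst r = i}. Q r * (of_bool (\<alpha> r = c) + of_bool (\<beta> r = c)))"
      by (rule sum.cong) (use nth_eq c in \<open>auto simp: z_def I_def\<close>)
    also have "\<dots> = (\<Sum>a<n. \<Sum>b<n. q i a b * (of_bool (a = c) + of_bool (b = c)))"
      by (rule sum_parts[OF i])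
    also have "\<dots> = (\<Sum>a<n. \<Sum>b<n. q i a b * of_bool (a = c)) + (\<Sum>a<n. \<Sum>b<n. q i a b * of_bool (b = c))"
      by (simp add: distrib_left sum.distrib)
    also have "(\<Sum>a<n. \<Sum>b<n. q i a b * of_bool (a = c)) = (\<Sum>b<n. q i c b)"
      by (subst sum.swap) (use c in \<open>simp add: of_bool_def if_distrib[of "\<lambda>t. _ * t"] cong: if_cong\<close>)
    also have "(\<Sum>a<n. \<Sum>b<n. q i a b * of_bool (b = c)) = (\<Sum>a<n. q i a c)"
      using c by (simp add: of_bool_def if_distrib[of "\<lambda>t. _ * t"] cong: if_cong)
    finally show ?thesis using qx[OF i c(1)] c(2) by simp
  qed
  have z_diag: "(\<Sum>r\<in>{r \<in> I. fst r = i}. of_bool (\<alpha> r = \<beta> r) * z r j) = max 0 (2 * x i j - rate G i)"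
    if i: "i \<in> on_types G" and j: "j \<in> offline G" for i j
  proof -
    obtain c where c: "c < n" "j = js ! c" using index[OF j] by blast
    have "(\<Sum>r\<in>{r \<in> I. fst r = i}. of_bool (\<alpha> r = \<beta> r) * z r j) =
        (\<Sum>r\<in>{r \<in> I. fst r = i}. Q r * (2 * of_bool (\<alpha> r = c \<and> \<beta> r = c)))"
      by (rule sum.cong) (use nth_eq c in \<open>auto simp: z_def I_def\<close>)
    also have "\<dots> = (\<Sum>a<n. \<Sum>b<n. q i a b * (2 * of_bool (a = c \<and> b = c)))"
      by (rule sum_parts[OF i])
    also have "\<dots> = (\<Sum>a<n. if a = c then 2 * q i c c else 0)"
      by (rule sum.cong[OF refl]) (use c in \<open>simp add: of_bool_def if_distrib[of "\<lambda>t. _ * t"] cong: if_cong\<close>)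
    also have "\<dots> = 2 * q i c c" using c by simp
    finally show ?thesis using qd[OF i c(1)] c(2) by simp
  qed
  have sum_I: "(\<Sum>r\<in>I. f r) = (\<Sum>i\<in>on_types G. \<Sum>r\<in>{r \<in> I. fst r = i}. f r)" for f :: "_ \<Rightarrow> real"
    by (rule sum.group[symmetric]) (use fI fo in \<open>auto simp: I_def\<close>)
  have z_off: "z r j = 0" if "(r, j) \<notin> edges H" for r j
  proof (rule ccontr)
    assume nz: "z r j \<noteq> 0"
    then have rI: "r \<in> I" and j: "j = js ! \<alpha> r \<or> j = js ! \<beta> r" unfolding z_def by (auto split: if_splits)
    define i where "i = fst r"
    have i: "i \<in> on_types G" and ab: "\<alpha> r < n" "\<beta> r < n" "0 < q i (\<alpha> r) (\<beta> r)"
      using rI unfolding I_def Q_def i_def by auto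
    have 1: "q i (\<alpha> r) (\<beta> r) \<le> (\<Sum>b<n. q i (\<alpha> r) b)"
      by (rule member_le_sum) (use ab q0[OF i] in auto)
    have 2: "q i (\<alpha> r) (\<beta> r) \<le> (\<Sum>a<n. q i a (\<beta> r))"
      by (rule member_le_sum[where f = "\<lambda>a. q i a (\<beta> r)"]) (use ab q0[OF i] in auto)
    have nn: "0 \<le> (\<Sum>b<n. q i b (\<alpha> r))" "0 \<le> (\<Sum>b<n. q i (\<beta> r) b)"
      using q0[OF i] by (auto intro: sum_nonneg)
    have "0 < x i j"
      using j qx[OF i ab(1)] qx[OF i ab(2)] 1 2 nn ab(3) by auto
    then have "(i, j) \<in> edges G" using xe by (metis less_irrefl)
    then show False using that rI unfolding H i_def by simp
  qed
  have z_cases: "z r j \<in> {0, Q r, 2 * Q r}" for r j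
    unfolding z_def by auto
  have z_nonneg: "0 \<le> z r j" for r j
    unfolding z_def I_def by auto
  have "split_instance G H"
    unfolding split_instance_def
  proof (intro conjI ballI allI)
    show "valid_osm H"
      unfolding valid_osm_def H using fI fo sub w by (auto simp: I_def)
    show "fst ` on_types H = on_types G"
    proof
      show "fst ` on_types H \<subseteq> on_types G" unfolding H I_def by auto
      show "on_types G \<subseteq> fst ` on_types H"
      proof
        fix i assume i: "i \<in> on_types G"
        have "\<exists>a<n. \<exists>b<n. 0 < q i a b"
        proof (rule ccontr)
          assume "\<not> (\<exists>a<n. \<exists>b<n. 0 < q i a b)"
          then have "q i a b \<le> 0" if "a < n" "b < n" for a b
            using that by (meson not_less)
          then have "(\<Sum>a<n. \<Sum>b<n. q i a b) \<le> 0" by (intro sum_nonpos) auto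
          then show False using qs[OF i] r[OF i] by simp
        qed
        then obtain a b where "a < n" "b < n" "0 < q i a b" by blast
        then have "(i, prod_encode (a, b)) \<in> I" using i unfolding I_def Q_def \<alpha>_def \<beta>_def by simp
        then show "i \<in> fst ` on_types H" unfolding H by force
      qed
    qed
    show "offline H = offline G" by (rule H)
    show "(\<Sum>r\<in>{r \<in> on_types H. fst r = i}. rate H r) = rate G i" if i: "i \<in> on_types G" for i
      using sum_parts[OF i, of "\<lambda>_ _. 2"] qs[OF i] unfolding H
      by (simp add: sum_distrib_right[symmetric] mult.commute[of 2])
  qed (auto simp: H)
  moreover have "two_class_matching H z"
    unfolding two_class_matching_def
  proof (intro conjI ballI allI impI)
    show "z r j = 0" if "(r, j) \<notin> edges H" for r j by (rule z_off[OF that])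
    show "(\<Sum>j\<in>offline H. z r j) = rate H r" if "r \<in> on_types H" for r
    proof -
      have rI: "r \<in> I" using that H by simp
      have "(\<Sum>j\<in>offline G. z r j) = (\<Sum>j\<in>offline G. (if j = js ! \<alpha> r then Q r else 0) + (if j = js ! \<beta> r then Q r else 0))"
        using rI by (intro sum.cong) (auto simp: z_def)
      also have "\<dots> = 2 * Q r"
        using rI nth fo unfolding I_def by (simp add: sum.distrib)
      finally show ?thesis unfolding H .
    qed
    show "(\<Sum>r\<in>on_types H. z r j) = 1" if "j \<in> offline H" for j
      using that cols z_col unfolding H sum_I by simp
    show "z r j \<in> {0, rate H r / 2, rate H r}" for r j
      using z_cases[of r j] unfolding H by auto
    show "(\<Sum>r\<in>first_class_types H z. z r j) \<le> 1 - ln 2" if j: "j \<in> offline H" for j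
    proof -
      have "(\<Sum>r\<in>first_class_types H z. z r j) \<le> (\<Sum>r\<in>I. of_bool (\<alpha> r = \<beta> r) * z r j)"
      proof -
        have first: "r \<in> I \<and> \<alpha> r = \<beta> r" if fc: "r \<in> first_class_types H z" for r
        proof -
          obtain k where k: "r \<in> I" "z r k = 2 * Q r"
            using fc unfolding first_class_types_def H by auto
          then have "k = js ! \<alpha> r" "k = js ! \<beta> r"
            unfolding z_def I_def by (auto simp: of_bool_def split: if_splits)
          then show ?thesis
            using k(1) nth_eq unfolding I_def by auto
        qed
        then have "(\<Sum>r\<in>first_class_types H z. z r j) = (\<Sum>r\<in>first_class_types H z. of_bool (\<alpha> r = \<beta> r) * z r j)"
          by (intro sum.cong) auto
        also have "\<dots> \<le> (\<Sum>r\<in>I. of_bool (\<alpha> r = \<beta> r) * z r j)"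
          by (rule sum_mono2) (use fI first z_nonneg in auto)
        finally show ?thesis .
      qed
      also have "\<dots> = (\<Sum>i\<in>on_types G. max 0 (2 * x i j - rate G i))"
        unfolding sum_I using z_diag j H by simp
      also have "\<dots> \<le> 1 - ln 2" using jl j H by simp
      finally show ?thesis .
    qed
  qed
  moreover have "frac_weight H z = frac_weight G x"
  proof -
    have "frac_weight H z = (\<Sum>(r, j)\<in>I \<times> offline G. weight G (fst r) j * z r j)"
      unfolding frac_weight_def
    proof (rule sum.mono_neutral_cong_left)
      show "\<forall>e\<in>I \<times> offline G - edges H. (case e of (r, j) \<Rightarrow> weight G (fst r) j * z r j) = 0"
        using z_off by auto
    qed (use fI fo sub in \<open>auto simp: H\<close>)
    also have "\<dots> = (\<Sum>j\<in>offline G. \<Sum>r\<in>I. weight G (fst r) j * z r j)"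
      by (simp add: sum.cartesian_product[symmetric] sum.swap[of _ I])
    also have "\<dots> = (\<Sum>j\<in>offline G. \<Sum>i\<in>on_types G. weight G i j * x i j)"
    proof (rule sum.cong[OF refl])
      fix j assume j: "j \<in> offline G"
      have "(\<Sum>r\<in>{r \<in> I. fst r = i}. weight G (fst r) j * z r j) = weight G i j * x i j" if "i \<in> on_types G" for i
        unfolding z_col[OF that j, symmetric] sum_distrib_left by (rule sum.cong) auto
      then show "(\<Sum>r\<in>I. weight G (fst r) j * z r j) = (\<Sum>i\<in>on_types G. weight G i j * x i j)"
        unfolding sum_I by simp
    qed
    also have "\<dots> = (\<Sum>(i, j)\<in>on_types G \<times> offline G. weight G i j * x i j)"
      by (simp add: sum.cartesian_product[symmetric] sum.swap[of _ "on_types G"])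
    also have "\<dots> = frac_weight G x"
      unfolding frac_weight_def by (rule sum.mono_neutral_right) (use fo sub xe in auto)
    finally show ?thesis .
  qed
  ultimately show ?thesis by blast
qed

lemma saturated_extension:
  fixes G :: "('i, 'j) osm"
  assumes G: "valid_osm G" and x: "jl_feasible G x"
  shows "\<exists>G' x'. dummy_extension G G' \<and> saturated G' x' \<and> frac_weight G' x' = frac_weight G x"
proof -
  have fe: "finite (edges G)" and fo: "finite (on_types G)" "finite (offline G)"
    and sub: "edges G \<subseteq> on_types G \<times> offline G" and r: "\<And>i. i \<in> on_types G \<Longrightarrow> 0 < rate G i"
    and w: "\<And>i j. (i, j) \<in> edges G \<Longrightarrow> 0 \<le> weight G i j"
    using G finite_subset[of "edges G" "on_types G \<times> offline G"] unfolding valid_osm_def by auto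
  have x0: "\<And>i j. 0 \<le> x i j" and xe: "\<And>i j. (i, j) \<notin> edges G \<Longrightarrow> x i j = 0"
    and rows: "\<And>i. i \<in> on_types G \<Longrightarrow> (\<Sum>j\<in>offline G. x i j) \<le> rate G i"
    and cols: "\<And>j. j \<in> offline G \<Longrightarrow> (\<Sum>i\<in>on_types G. x i j) \<le> 1"
    and jl: "\<And>j. j \<in> offline G \<Longrightarrow> (\<Sum>i\<in>on_types G. max 0 (2 * x i j - rate G i)) \<le> 1 - ln 2"
    using x unfolding jl_feasible_def by auto
  define d where "d i = rate G i - (\<Sum>j\<in>offline G. x i j)" for i
  define e where "e j = 1 - (\<Sum>i\<in>on_types G. x i j)" for j
  define D where "D = (\<Sum>i\<in>on_types G. d i)"
  define K where "K = nat \<lceil>D\<rceil> + 2"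
  define L where "L = (\<Sum>j\<in>offline G. e j) + real K - D"
  have d: "0 \<le> d i" "d i \<le> rate G i" if "i \<in> on_types G" for i
    using rows[OF that] x0 by (auto simp: d_def intro: sum_nonneg)
  have e: "0 \<le> e j" "e j \<le> 1" if "j \<in> offline G" for j
    using cols[OF that] x0 by (auto simp: e_def intro: sum_nonneg)
  have D: "0 \<le> D" unfolding D_def using d by (intro sum_nonneg) auto
  have K: "D + 2 \<le> real K" unfolding K_def using D by (simp add: of_nat_nat)
  have K0: "0 < K" "(0 :: real) < K" unfolding K_def by auto
  have L: "2 \<le> L" unfolding L_def using K sum_nonneg[of "offline G" e] e by auto
  define G' where "G' = \<lparr>on_types = insert (Dummy 0) (Orig ` on_types G), offline = Orig ` offline G \<union> Dummy ` {..<K},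
    edges = (\<lambda>(i, j). (Orig i, Orig j)) ` edges G \<union> insert (Dummy 0) (Orig ` on_types G) \<times> Dummy ` {..<K} \<union>
      {Dummy 0} \<times> Orig ` offline G,
    rate = (\<lambda>k. case k of Orig i \<Rightarrow> rate G i | Dummy _ \<Rightarrow> L),
    weight = (\<lambda>k l. case k of Orig i \<Rightarrow> (case l of Orig j \<Rightarrow> weight G i j | Dummy _ \<Rightarrow> 0) | Dummy _ \<Rightarrow> 0)\<rparr>"
  have G': "on_types G' = insert (Dummy 0) (Orig ` on_types G)" "offline G' = Orig ` offline G \<union> Dummy ` {..<K}"
    "edges G' = (\<lambda>(i, j). (Orig i, Orig j)) ` edges G \<union> insert (Dummy 0) (Orig ` on_types G) \<times> Dummy ` {..<K} \<union>
      {Dummy 0} \<times> Orig ` offline G"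
    "rate G' = (\<lambda>k. case k of Orig i \<Rightarrow> rate G i | Dummy _ \<Rightarrow> L)"
    "weight G' = (\<lambda>k l. case k of Orig i \<Rightarrow> (case l of Orig j \<Rightarrow> weight G i j | Dummy _ \<Rightarrow> 0) | Dummy _ \<Rightarrow> 0)"
    unfolding G'_def by simp_all
  define x' where "x' k l = (if (k, l) \<in> edges G' then
     (case k of Orig i \<Rightarrow> (case l of Orig j \<Rightarrow> x i j | Dummy _ \<Rightarrow> d i / K)
      | Dummy _ \<Rightarrow> (case l of Orig j \<Rightarrow> e j | Dummy _ \<Rightarrow> 1 - D / K)) else 0)" for k l
  have x'_simps: "x' (Orig i) (Orig j) = x i j"
    "i \<in> on_types G \<Longrightarrow> u < K \<Longrightarrow> x' (Orig i) (Dummy u) = d i / K"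
    "j \<in> offline G \<Longrightarrow> x' (Dummy 0) (Orig j) = e j"
    "u < K \<Longrightarrow> x' (Dummy 0) (Dummy u) = 1 - D / K" for i j u
  proof -
    have "(Orig i, Orig j) \<in> edges G' \<longleftrightarrow> (i, j) \<in> edges G"
      unfolding G' by auto
    then show "x' (Orig i) (Orig j) = x i j" unfolding x'_def using xe by simp
  qed (auto simp: x'_def G')
  have sum_off: "(\<Sum>l\<in>offline G'. f l) = (\<Sum>j\<in>offline G. f (Orig j)) + (\<Sum>u<K. f (Dummy u))" for f :: "_ \<Rightarrow> real"
    unfolding G' using fo by (subst sum.union_disjoint) (auto simp: sum.reindex inj_on_def)
  have sum_on: "(\<Sum>k\<in>on_types G'. f k) = f (Dummy 0) + (\<Sum>i\<in>on_types G. f (Orig i))" for f :: "_ \<Rightarrow> real"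
    unfolding G' using fo by (subst sum.insert) (auto simp: sum.reindex inj_on_def)
  have "dummy_extension G G'"
    unfolding dummy_extension_def
  proof (intro conjI)
    show "valid_osm G'"
      unfolding valid_osm_def using fo fe sub r w L by (auto simp: G')
  qed (auto simp: G' split: ext.splits)
  moreover have "saturated G' x'"
    unfolding saturated_def
  proof (intro conjI allI ballI impI)
    have DK: "D / K \<le> 1" using K K0 by (simp add: divide_le_eq)
    show "0 \<le> x' k l" for k l
      unfolding x'_def using x0 d e DK K0 by (auto simp: G' split: ext.splits)
    show "x' k l = 0" if "(k, l) \<notin> edges G'" for k l
      using that by (simp add: x'_def)
    show "(\<Sum>l\<in>offline G'. x' k l) = rate G' k" if k: "k \<in> on_types G'" for k
    proof (cases "k = Dummy 0")
      case True
      have "(\<Sum>l\<in>offline G'. x' k l) = (\<Sum>j\<in>offline G. e j) + (\<Sum>u<K. 1 - D / K)"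
        unfolding sum_off True by (intro arg_cong2[where f = "(+)"] sum.cong refl) (auto simp: x'_simps)
      then show ?thesis
        using K0 unfolding G' True by (simp add: L_def right_diff_distrib)
    next
      case False
      then obtain i where i: "k = Orig i" "i \<in> on_types G" using k unfolding G' by auto
      have "(\<Sum>l\<in>offline G'. x' k l) = (\<Sum>j\<in>offline G. x i j) + (\<Sum>u<K. d i / K)"
        unfolding sum_off i by (intro arg_cong2[where f = "(+)"] sum.cong refl) (use i in \<open>auto simp: x'_simps\<close>)
      then show ?thesis
        using K0 unfolding G' i by (simp add: d_def)
    qed
    show "(\<Sum>k\<in>on_types G'. x' k l) = 1" if "l \<in> offline G'" for l
      using that
    proof (cases l)
      case (Orig j)
      then have j: "j \<in> offline G" using that unfolding G' by auto
      then show ?thesis unfolding sum_on Orig by (simp add: x'_simps e_def)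
    next
      case (Dummy u)
      then have u: "u < K" using that unfolding G' by auto
      have "(\<Sum>i\<in>on_types G. x' (Orig i) (Dummy u)) = D / K"
        unfolding D_def sum_divide_distrib by (rule sum.cong) (use u in \<open>auto simp: x'_simps\<close>)
      then show ?thesis unfolding sum_on Dummy using u by (simp add: x'_simps)
    qed
    show "(\<Sum>k\<in>on_types G'. max 0 (2 * x' k l - rate G' k)) \<le> 1 - ln 2" if "l \<in> offline G'" for l
      using that
    proof (cases l)
      case (Orig j)
      then have j: "j \<in> offline G" using that unfolding G' by auto
      have "max 0 (2 * x' (Dummy 0) l - rate G' (Dummy 0)) = 0"
        using e[OF j] L j unfolding Orig by (simp add: x'_simps G')
      then show ?thesis
        using jl[OF j] unfolding sum_on by (simp add: Orig x'_simps G')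
    next
      case (Dummy u)
      then have u: "u < K" using that unfolding G' by auto
      have "0 \<le> D / K" using D by simp
      then have 1: "max 0 (2 * x' (Dummy 0) l - rate G' (Dummy 0)) = 0"
        using L u unfolding Dummy by (simp add: x'_simps G')
      have "max 0 (2 * x' (Orig i) l - rate G' (Orig i)) = 0" if i: "i \<in> on_types G" for i
      proof -
        have "2 * d i \<le> real K * rate G i"
          using d[OF i] K D by (intro mult_mono) auto
        then have "2 * (d i / K) \<le> rate G i"
          using K0 by (simp add: divide_le_eq mult.commute)
        then show ?thesis using u i unfolding Dummy by (simp add: x'_simps G')
      qed
      then show ?thesis
        unfolding sum_on 1 using ln_2_less_1 by simp
    qed
  qed
  moreover have "frac_weight G' x' = frac_weight G x"
  proof -
    have "frac_weight G' x' = (\<Sum>(k, l)\<in>(\<lambda>(i, j). (Orig i, Orig j)) ` edges G. weight G' k l * x' k l)"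
      unfolding frac_weight_def
    proof (rule sum.mono_neutral_right)
      show "finite (edges G')" unfolding G' using fe fo by auto
    qed (auto simp: G' split: ext.splits)
    also have "\<dots> = frac_weight G x"
      unfolding frac_weight_def by (subst sum.reindex) (auto simp: inj_on_def x'_simps G' intro!: sum.cong)
    finally show ?thesis .
  qed
  ultimately show ?thesis by blast
qed

lemma preprocessed_exists:
  assumes G: "valid_osm G" and x: "jl_feasible G x"
  shows "\<exists>G' H z. preprocessed G x G' H z"
proof -
  obtain G' x' where G': "dummy_extension G G'" "saturated G' x'" "frac_weight G' x' = frac_weight G x"
    using saturated_extension[OF G x] by blast
  then have "valid_osm G'" unfolding dummy_extension_def by blast
  from split_saturated[OF this G'(2)] G' show ?thesis
    unfolding preprocessed_def by metis
qed

theorem theorem2: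
  fixes G :: "('i, 'j) osm"
  assumes "valid_osm G"
  shows "(\<exists>x. jl_optimal G x) \<and>
    (\<forall>x. jl_optimal G x \<longrightarrow>
       (\<exists>G' H z. preprocessed G x G' H z) \<and>
       (\<forall>G' H z. preprocessed G x G' H z \<longrightarrow>
          (\<forall>(M :: 'w measure) A. poisson_arrivals M G' A \<longrightarrow>
             msm_expected_weight 0.05 0.75 G' H z M A
               \<ge> 0.645 * (\<integral>\<omega>. offline_opt G (\<lambda>i. A (Orig i) \<omega>) \<partial>M))))"
proof (intro conjI allI impI)
  show "\<exists>x. jl_optimal G x"
    by (rule jl_optimal_exists[OF assms])
next
  fix x assume "jl_optimal G x"
  then show "\<exists>G' H z. preprocessed G x G' H z"
    unfolding jl_optimal_def using preprocessed_exists[OF assms] by blast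
next
  fix x G' H z A and M :: "'w measure"
  assume x: "jl_optimal G x" and p: "preprocessed G x G' H z" and arr: "poisson_arrivals M G' A"
  have ext: "dummy_extension G G'" and split: "split_instance G' H" and tc: "two_class_matching H z"
    and w: "frac_weight H z = frac_weight G x"
    using p unfolding preprocessed_def by auto
  interpret split_two_class H z G'
    by unfold_locales (use ext split tc in \<open>auto simp: dummy_extension_def split_instance_def\<close>)
  have "(\<integral>\<omega>. offline_opt G (\<lambda>i. A (Orig i) \<omega>) \<partial>M) \<le> frac_weight G x"
    by (rule expected_offline_opt_le[OF assms x poisson_arrivals_dummy_extension[OF ext arr]])
  then have "129 / 200 * (\<integral>\<omega>. offline_opt G (\<lambda>i. A (Orig i) \<omega>) \<partial>M) \<le> 129 / 200 * frac_weight H z"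
    unfolding w by simp
  also have "\<dots> \<le> msm_expected_weight (1 / 20) (3 / 4) G' H z M A"
    by (rule msm_expected_weight_lower_bound[OF arr])
  finally show "msm_expected_weight 0.05 0.75 G' H z M A
      \<ge> 0.645 * (\<integral>\<omega>. offline_opt G (\<lambda>i. A (Orig i) \<omega>) \<partial>M)"
    by simp
qed

end
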